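(* Let $\alpha>0$ and $\rho>0$, and let the constants $\gamma_1,\dots,\gamma_N$, the matrix $B$ and the feedback $F$ be as described in the context. Consider the linear controlled equation $$u_t-u_{xx}-\alpha u=0 \text{ in } (0,1)\times(0,\infty),\qquad u(0,t)=0,\quad u(1,t)=U(t),\quad u(x,0)=u_0(x),$$ with the boundary feedback $U(t)=F(u(\cdot,t))$. Then for every $u_0\in L^2(0,1)$ the closed-loop system is exponentially stable: there exist constants $C>0$ and $\mu>0$ such that its solution satisfies $$\|u(t)\|\le Ce^{-\mu t}\|u_0\|,\qquad t\ge 0,$$ where $\|\cdot\|$ denotes the norm of $L^2(0,1)$.
   Context: Let $\lambda_j=(\pi j)^2-\alpha$ and $\phi_j(x)=\sin(\pi j x)$, $j=1,2,\dots$; these are the eigenvalues and eigenfunctions of $\mathcal{A}u=-u''-\alpha u$ on $H^2(0,1)\cap H^1_0(0,1)$. Let $N$ be the integer such that $\lambda_j<\rho$ for $j=1,\dots,N$ and $\lambda_j\ge\rho$ for $j\ge N+1$ (with $N\ge 1$ so the construction makes sense). Let $\rho<\gamma_1<\gamma_2<\dots<\gamma_N$ be constants chosen sufficiently large that, for each $j$ and each $V\in\mathbb{R}$, the problem $\gamma_j\psi+\psi''-\alpha\psi-2\sum_{k=1}^N\lambda_k\langle\psi,\phi_k\rangle\phi_k=0$ on $(0,1)$, $\psi(0)=0$, $\psi(1)=V$, has a solution (here $\langle\cdot,\cdot\rangle$ is the $L^2(0,1)$ inner product). Let $B_0$ be the $N\times N$ matrix with entries $(B_0)_{ij}=\phi_i'(1)\phi_j'(1)$,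 let $\Lambda_{\gamma_k}=\mathrm{diag}\big(\frac{1}{\gamma_k-\lambda_i}\big)_{1\le i\le N}$, $B_k=\Lambda_{\gamma_k}B_0\Lambda_{\gamma_k}$ for $k=1,\dots,N$, and $B=(B_1+\dots+B_N)^{-1}$. For $u\in L^2(0,1)$ define $$F_k(u)=\Big\langle B\big(\langle u,\phi_1\rangle,\dots,\langle u,\phi_N\rangle\big)^T,\ \Big(\tfrac{\phi_1'(1)}{\gamma_k-\lambda_1},\dots,\tfrac{\phi_N'(1)}{\gamma_k-\lambda_N}\Big)^T\Big\rangle_{\mathbb{R}^N},\qquad F(u)=\sum_{k=1}^N F_k(u),$$ where $\langle\cdot,\cdot\rangle_{\mathbb{R}^N}$ is the Euclidean inner product. *)

theory Defs
  imports "HOL-Analysis.Analysis" "Jordan_Normal_Form.Matrix"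
begin

(* Eigenvalues / eigenfunctions of  A u = -u'' - alpha u  on H^2 \<inter> H^1_0(0,1) *)
definition lam :: "real \<Rightarrow> nat \<Rightarrow> real" where
  "lam \<alpha> j = (pi * real j)^2 - \<alpha>"

definition phi :: "nat \<Rightarrow> real \<Rightarrow> real" where
  "phi j x = sin (pi * real j * x)"

definition dphi1 :: "nat \<Rightarrow> real" where
  "dphi1 j = deriv (phi j) 1"

definition L2 :: "(real \<Rightarrow> real) \<Rightarrow> bool" where
  "L2 f \<longleftrightarrow> set_borel_measurable lborel {0..1} f
              \<and> set_integrable lborel {0..1} (\<lambda>x. (f x)^2)"

definition inner_L2 :: "(real \<Rightarrow> real) \<Rightarrow> (real \<Rightarrow> real) \<Rightarrow> real" where
  "inner_L2 f g = (LBINT x:{0..1}. f x * g x)"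

definition norm_L2 :: "(real \<Rightarrow> real) \<Rightarrow> real" where
  "norm_L2 f = sqrt (LBINT x:{0..1}. (f x)^2)"

(* N = number of j \<ge> 1 with lam_j < rho (lam is increasing in j) *)
definition NN :: "real \<Rightarrow> real \<Rightarrow> nat" where
  "NN \<alpha> \<rho> = card {j. 1 \<le> j \<and> lam \<alpha> j < \<rho>}"

definition gamma_solvable :: "real \<Rightarrow> nat \<Rightarrow> real \<Rightarrow> bool" where
  "gamma_solvable \<alpha> N g \<longleftrightarrow>
     (\<forall>V::real. \<exists>\<psi> \<psi>' \<psi>''.
        (\<forall>x\<in>{0..1}. (\<psi> has_real_derivative \<psi>' x) (at x within {0..1})
                     \<and> (\<psi>' has_real_derivative \<psi>'' x) (at x within {0..1}))
      \<and> (\<forall>x\<in>{0<..<1}. g * \<psi> x + \<psi>'' x - \<alpha> * \<psi> x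
            - 2 * (\<Sum>k=1..N. lam \<alpha> k * inner_L2 \<psi> (phi k) * phi k x) = 0)
      \<and> \<psi> 0 = 0 \<and> \<psi> 1 = V)"

(* Matrices (JNF, indices 0..N-1 correspond to 1..N in the paper) *)
definition B0 :: "nat \<Rightarrow> real mat" where
  "B0 N = mat N N (\<lambda>(i,j). dphi1 (i+1) * dphi1 (j+1))"

definition Lam_gamma :: "real \<Rightarrow> nat \<Rightarrow> real \<Rightarrow> real mat" where
  "Lam_gamma \<alpha> N g = mat N N (\<lambda>(i,j). if i = j then 1 / (g - lam \<alpha> (i+1)) else 0)"

definition Bk :: "real \<Rightarrow> nat \<Rightarrow> (nat \<Rightarrow> real) \<Rightarrow> nat \<Rightarrow> real mat" where
  "Bk \<alpha> N \<gamma> k = Lam_gamma \<alpha> N (\<gamma> k) * B0 N * Lam_gamma \<alpha> N (\<gamma> k)"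

definition Bsum :: "real \<Rightarrow> nat \<Rightarrow> (nat \<Rightarrow> real) \<Rightarrow> real mat" where
  "Bsum \<alpha> N \<gamma> = foldr (+) (map (Bk \<alpha> N \<gamma>) [1..<N+1]) (0\<^sub>m N N)"

definition Bmat :: "real \<Rightarrow> nat \<Rightarrow> (nat \<Rightarrow> real) \<Rightarrow> real mat" where
  "Bmat \<alpha> N \<gamma> = (THE X. X \<in> carrier_mat N N \<and> Bsum \<alpha> N \<gamma> * X = 1\<^sub>m N)"

definition Fk :: "real \<Rightarrow> nat \<Rightarrow> (nat \<Rightarrow> real) \<Rightarrow> nat \<Rightarrow> (real \<Rightarrow> real) \<Rightarrow> real" where
  "Fk \<alpha> N \<gamma> k u =
     scalar_prod (Bmat \<alpha> N \<gamma> *\<^sub>v vec N (\<lambda>i. inner_L2 u (phi (i+1))))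
                 (vec N (\<lambda>i. dphi1 (i+1) / (\<gamma> k - lam \<alpha> (i+1))))"

definition Ffb :: "real \<Rightarrow> nat \<Rightarrow> (nat \<Rightarrow> real) \<Rightarrow> (real \<Rightarrow> real) \<Rightarrow> real" where
  "Ffb \<alpha> N \<gamma> u = (\<Sum>k=1..N. Fk \<alpha> N \<gamma> k u)"

definition closed_loop_solution ::
  "real \<Rightarrow> ((real \<Rightarrow> real) \<Rightarrow> real) \<Rightarrow> (real \<Rightarrow> real) \<Rightarrow> (real \<Rightarrow> real \<Rightarrow> real) \<Rightarrow> bool" where
  "closed_loop_solution \<alpha> F u0 u \<longleftrightarrow>
     continuous_on ({0<..} \<times> {0..1}) (\<lambda>(t,x). u t x)
   \<and> (\<forall>t>0. \<forall>x\<in>{0<..<1}. (u t has_real_derivative deriv (u t) x) (at x))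
   \<and> (\<forall>t>0. \<forall>x\<in>{0<..<1}. \<exists>ut uxx.
         ((\<lambda>s. u s x) has_real_derivative ut) (at t)
       \<and> (deriv (u t) has_real_derivative uxx) (at x)
       \<and> ut - uxx - \<alpha> * u t x = 0)
   \<and> (\<forall>t>0. u t 0 = 0 \<and> u t 1 = F (u t))
   \<and> (\<forall>x\<in>{0..1}. u 0 x = u0 x)
   \<and> ((\<lambda>t. norm_L2 (\<lambda>x. u t x - u0 x)) \<longlongrightarrow> 0) (at_right 0)"

end

theory Submission
  imports Defs "Jordan_Normal_Form.Determinant"
begin

text \<open>
  Testing the equation with \<open>\<phi>\<^sub>j\<close> gives \<open>z\<^sub>j' = - \<lambda>\<^sub>j z\<^sub>j - \<phi>\<^sub>j'(1) U\<close> for the modes \<open>z\<^sub>j = \<langle>u, \<phi>\<^sub>j\<rangle>\<close>. With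
  \<open>d\<^sub>k = (\<phi>\<^sub>i'(1) / (\<gamma>\<^sub>k - \<lambda>\<^sub>i))\<^sub>i\<close> the definition of \<open>B\<close> says that \<open>z = \<Sum>\<^sub>k F\<^sub>k(u) d\<^sub>k\<close>, and since
  \<open>\<lambda>\<^sub>i d\<^sub>k\<^sub>i = \<gamma>\<^sub>k d\<^sub>k\<^sub>i - \<phi>\<^sub>i'(1)\<close> the closed loop diagonalises completely on the first \<open>N\<close> modes:
  \<open>F\<^sub>k' = - \<gamma>\<^sub>k F\<^sub>k\<close>. Hence \<open>U\<close> is the sum of the \<open>F\<^sub>k(u(a)) exp (- \<gamma>\<^sub>k (t - a))\<close>, the modes beyond \<open>N\<close> are
  stable modes with exponentially small forcing, and Parseval's identity turns the estimates of
  the modes into the estimate of the norm.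

  Solutions are only assumed to be continuous with pointwise derivatives, so the equations of the
  modes cannot be obtained by differentiating under the integral. Instead, the parabolic maximum
  principle shows that every solution is a uniform limit of finite sums of separated solutions
  \<open>exp (c t) g(x)\<close>, for which they are explicit. Conversely, a solution is the sum of explicit
  solutions with boundary values \<open>exp (- \<gamma>\<^sub>k t)\<close> and a sine series.
\<close>

section \<open>The space of square integrable functions on the unit interval\<close>

text \<open>A solution attains its initial value only in the \<open>L2\<close> sense. The modes are
  therefore treated on compact intervals \<open>[a, b]\<close> with \<open>a > 0\<close>, in an
  integrated form that survives uniform limits, and the decay estimate is proved from time
  \<open>a\<close> with a constant independent of \<open>a\<close>; only then does \<open>a\<close>
  tend to 0. The rate is \<open>\<rho> / 2\<close> and not \<open>\<rho>\<close> because
  \<open>lam \<alpha> (N + 1)\<close> may equal \<open>\<rho>\<close>: half the rate keeps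
  \<open>lam \<alpha> j - \<rho> / 2\<close> bounded away from 0 for all \<open>j > N\<close>. The
  boundary input enters mode \<open>j\<close> with the weight \<open>dphi1 j\<close>, of size
  \<open>pi * j\<close>, while the damping grows like the square of \<open>j\<close>; so the gains
  are of order \<open>1 / j\<close> and square summable, which is what Parseval's identity needs.
  The matrix part rests on one fact: up to nonzero scaling factors the numbers
  \<open>feedback_dir \<alpha> \<gamma> k i\<close> form a Cauchy matrix, nonsingular because the
  \<open>\<gamma> k\<close> are distinct, the \<open>lam \<alpha> i\<close> are distinct, and the
  two families are separated.\<close>

abbreviation I01 :: "real measure" where
  "I01 \<equiv> restrict_space lborel {0..1}"

lemma finite_measure_I01: "finite_measure I01"
  by (rule finite_measureI) (simp add: space_restrict_space emeasure_restrict_space)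

text \<open>Set integrals over \<open>{0..1}\<close> become plain integrals over the finite measure
  space \<open>I01\<close>, where no indicator functions have to be carried along.\<close>

lemma L2_iff: "L2 f \<longleftrightarrow> f \<in> borel_measurable I01 \<and> integrable I01 (\<lambda>x. (f x)\<^sup>2)"
  unfolding L2_def set_borel_measurable_def set_integrable_def
  by (subst borel_measurable_restrict_space_iff)
     (auto simp: integrable_restrict_space mult.commute)

lemma inner_L2_eq: "inner_L2 f g = (\<integral>x. f x * g x \<partial>I01)"
  unfolding inner_L2_def set_lebesgue_integral_def
  by (subst integral_restrict_space) (auto simp: mult.commute)

lemma norm_L2_eq: "norm_L2 f = sqrt (inner_L2 f f)"
  unfolding norm_L2_def inner_L2_def by (simp add: power2_eq_square)

lemma L2_measurable: "L2 f \<Longrightarrow> f \<in> borel_measurable I01"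
  by (simp add: L2_iff)

lemma L2_integrable_mult:
  assumes "L2 f" "L2 g" shows "integrable I01 (\<lambda>x. f x * g x)"
proof (rule Bochner_Integration.integrable_bound)
  show "integrable I01 (\<lambda>x. (f x)\<^sup>2 + (g x)\<^sup>2)"
    using assms by (auto simp: L2_iff)
  show "(\<lambda>x. f x * g x) \<in> borel_measurable I01"
    using assms by (auto simp: L2_iff)
  show "AE x in I01. norm (f x * g x) \<le> norm ((f x)\<^sup>2 + (g x)\<^sup>2)"
  proof (rule AE_I2)
    fix x
    have "2 * \<bar>f x * g x\<bar> \<le> (f x)\<^sup>2 + (g x)\<^sup>2"
      using sum_squares_bound[of "\<bar>f x\<bar>" "\<bar>g x\<bar>"] by (simp add: abs_mult mult.assoc)
    then show "norm (f x * g x) \<le> norm ((f x)\<^sup>2 + (g x)\<^sup>2)" by simp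
  qed
qed

lemma inner_L2_cong:
  assumes "\<And>x. x \<in> {0..1} \<Longrightarrow> f x * g x = f' x * g' x"
  shows "inner_L2 f g = inner_L2 f' g'"
  unfolding inner_L2_eq
  by (rule Bochner_Integration.integral_cong) (auto simp: space_restrict_space assms)

lemma norm_L2_cong:
  assumes "\<And>x. x \<in> {0..1} \<Longrightarrow> f x = g x" shows "norm_L2 f = norm_L2 g"
  unfolding norm_L2_eq using inner_L2_cong[of f f g g] assms by simp

lemma L2_add: assumes "L2 f" "L2 g" shows "L2 (\<lambda>x. f x + g x)"
proof -
  have "integrable I01 (\<lambda>x. (f x)\<^sup>2 + 2 * (f x * g x) + (g x)\<^sup>2)"
    using assms L2_integrable_mult[OF assms] by (auto simp: L2_iff)
  moreover have "(\<lambda>x. (f x + g x)\<^sup>2) = (\<lambda>x. (f x)\<^sup>2 + 2 * (f x * g x) + (g x)\<^sup>2)"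
    by (auto simp: power2_eq_square algebra_simps)
  ultimately show ?thesis using assms by (auto simp: L2_iff)
qed

lemma L2_cmult: assumes "L2 f" shows "L2 (\<lambda>x. c * f x)"
  using assms by (auto simp: L2_iff power_mult_distrib)

lemma L2_diff: assumes "L2 f" "L2 g" shows "L2 (\<lambda>x. f x - g x)"
  using L2_add[OF assms(1) L2_cmult[OF assms(2), of "-1"]] by simp

lemma continuous_imp_integrable_I01:
  fixes f :: "real \<Rightarrow> real"
  assumes "continuous_on {0..1} f" shows "integrable I01 f"
  using borel_integrable_compact[OF compact_Icc assms]
  by (subst integrable_restrict_space) (auto simp: set_integrable_def)

lemma L2_continuous: assumes "continuous_on {0..1} f" shows "L2 f"
  using continuous_imp_integrable_I01[OF assms]
    continuous_imp_integrable_I01[OF continuous_on_power[OF assms, of 2]]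
  by (auto simp: L2_iff)

lemma L2_zero: "L2 (\<lambda>x. 0)"
  by (rule L2_continuous) auto

lemma L2_sum: assumes "\<And>i. i \<in> S \<Longrightarrow> L2 (f i)" shows "L2 (\<lambda>x. \<Sum>i\<in>S. f i x)"
  using assms by (induction S rule: infinite_finite_induct) (auto simp: L2_zero L2_add)

lemma inner_L2_commute: "inner_L2 f g = inner_L2 g f"
  by (simp add: inner_L2_eq mult.commute)

lemma inner_L2_add_left:
  assumes "L2 f" "L2 g" "L2 h"
  shows "inner_L2 (\<lambda>x. f x + g x) h = inner_L2 f h + inner_L2 g h"
  unfolding inner_L2_eq
  using L2_integrable_mult[OF assms(1,3)] L2_integrable_mult[OF assms(2,3)]
  by (simp add: distrib_right)

lemma inner_L2_add_right:
  assumes "L2 f" "L2 g" "L2 h"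
  shows "inner_L2 h (\<lambda>x. f x + g x) = inner_L2 h f + inner_L2 h g"
  using inner_L2_add_left[OF assms] by (simp add: inner_L2_commute)

lemma inner_L2_diff_left:
  assumes "L2 f" "L2 g" "L2 h"
  shows "inner_L2 (\<lambda>x. f x - g x) h = inner_L2 f h - inner_L2 g h"
  unfolding inner_L2_eq
  using L2_integrable_mult[OF assms(1,3)] L2_integrable_mult[OF assms(2,3)]
  by (simp add: left_diff_distrib)

lemma inner_L2_cmult_left: "inner_L2 (\<lambda>x. c * f x) h = c * inner_L2 f h"
  unfolding inner_L2_eq by (simp add: mult.assoc)

lemma inner_L2_cmult_right: "inner_L2 h (\<lambda>x. c * f x) = c * inner_L2 h f"
  by (metis inner_L2_cmult_left inner_L2_commute)

lemma inner_L2_sum_left: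
  assumes "\<And>i. i \<in> S \<Longrightarrow> L2 (f i)" "L2 h"
  shows "inner_L2 (\<lambda>x. \<Sum>i\<in>S. f i x) h = (\<Sum>i\<in>S. inner_L2 (f i) h)"
  using assms(1)
proof (induction S rule: infinite_finite_induct)
  case (insert i S)
  then show ?case using assms(2) by (simp add: inner_L2_add_left L2_sum)
qed (simp_all add: inner_L2_eq)

lemma inner_L2_nonneg: "inner_L2 f f \<ge> 0"
  unfolding inner_L2_eq by (rule integral_nonneg_AE) auto

lemma norm_L2_nonneg: "norm_L2 f \<ge> 0"
  by (simp add: norm_L2_eq inner_L2_nonneg)

lemma norm_L2_sq: "(norm_L2 f)\<^sup>2 = inner_L2 f f"
  by (simp add: norm_L2_eq inner_L2_nonneg)

lemma norm_L2_sq_add: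
  assumes "L2 f" "L2 g"
  shows "(norm_L2 (\<lambda>x. f x + g x))\<^sup>2 = (norm_L2 f)\<^sup>2 + 2 * inner_L2 f g + (norm_L2 g)\<^sup>2"
  unfolding norm_L2_sq
  using assms inner_L2_commute[of g f] by (simp add: inner_L2_add_left inner_L2_add_right L2_add)

lemma norm_L2_cmult: "norm_L2 (\<lambda>x. c * f x) = \<bar>c\<bar> * norm_L2 f"
proof -
  have "inner_L2 (\<lambda>x. c * f x) (\<lambda>x. c * f x) = c\<^sup>2 * inner_L2 f f"
    unfolding inner_L2_eq by (simp add: power2_eq_square mult_ac flip: integral_mult_right_zero)
  then show ?thesis by (simp add: norm_L2_eq real_sqrt_mult)
qed

lemma Cauchy_Schwarz_L2:
  assumes "L2 f" "L2 g" shows "\<bar>inner_L2 f g\<bar> \<le> norm_L2 f * norm_L2 g"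
proof -
  define a b c where "a = (norm_L2 f)\<^sup>2" and "b = inner_L2 f g" and "c = (norm_L2 g)\<^sup>2"
  have q: "0 \<le> a + 2 * s * b + s\<^sup>2 * c" for s
  proof -
    have "0 \<le> (norm_L2 (\<lambda>x. f x + s * g x))\<^sup>2" by simp
    also have "\<dots> = a + 2 * s * b + s\<^sup>2 * c"
      using assms by (subst norm_L2_sq_add)
        (auto simp: L2_cmult inner_L2_cmult_right norm_L2_cmult a_def b_def c_def power_mult_distrib)
    finally show ?thesis .
  qed
  have c: "c \<ge> 0" "a \<ge> 0" by (auto simp: a_def c_def)
  have "b\<^sup>2 \<le> a * c"
  proof (cases "c = 0")
    case True
    have "b = 0"
    proof (rule ccontr)
      assume "b \<noteq> 0"
      \<comment> \<open>With \<open>c = 0\<close> the form is affine in \<open>s\<close>; this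
        \<open>s\<close> gives it the value \<open>-1\<close>.\<close>
      then show False using q[of "-(a+1)/(2*b)"] True c by (simp add: field_simps)
    qed
    then show ?thesis using c by simp
  next
    case False
    then have "c > 0" using c by simp
    \<comment> \<open>The minimiser of the quadratic in \<open>s\<close>.\<close>
    then show ?thesis using q[of "-b/c"] by (simp add: field_simps power2_eq_square)
  qed
  then have "b\<^sup>2 \<le> (norm_L2 f * norm_L2 g)\<^sup>2" by (simp add: a_def c_def power_mult_distrib)
  then show ?thesis unfolding b_def
    by (metis abs_le_square_iff abs_of_nonneg norm_L2_nonneg mult_nonneg_nonneg)
qed

lemma norm_L2_triangle:
  assumes "L2 f" "L2 g" shows "norm_L2 (\<lambda>x. f x + g x) \<le> norm_L2 f + norm_L2 g"
proof (rule power2_le_imp_le)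
  have "inner_L2 f g \<le> norm_L2 f * norm_L2 g"
    using Cauchy_Schwarz_L2[OF assms] by simp
  then show "(norm_L2 (\<lambda>x. f x + g x))\<^sup>2 \<le> (norm_L2 f + norm_L2 g)\<^sup>2"
    unfolding norm_L2_sq_add[OF assms] by (simp add: power2_sum)
qed (simp add: norm_L2_nonneg)

lemma norm_L2_triangle_diff:
  assumes "L2 f" "L2 g" shows "norm_L2 f \<le> norm_L2 g + norm_L2 (\<lambda>x. f x - g x)"
  using norm_L2_triangle[OF assms(2) L2_diff[OF assms]] by simp

lemma measure_I01: "measure I01 (space I01) = 1"
  by (simp add: space_restrict_space measure_restrict_space)

text \<open>The unit interval has measure 1. For a non-integrable \<open>f\<close> the integral is 0
  by default, and \<open>e \<ge> 0\<close> follows from the bound at the point 0; so sup-norm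
  estimates carry no measurability conditions.\<close>

lemma abs_integral_I01_le:
  fixes f :: "real \<Rightarrow> real"
  assumes "\<And>x. x \<in> {0..1} \<Longrightarrow> \<bar>f x\<bar> \<le> e" shows "\<bar>\<integral>x. f x \<partial>I01\<bar> \<le> e"
proof (cases "integrable I01 f")
  case True
  interpret finite_measure I01 by (rule finite_measure_I01)
  have "\<bar>\<integral>x. f x \<partial>I01\<bar> \<le> (\<integral>x. \<bar>f x\<bar> \<partial>I01)" by simp
  also have "\<dots> \<le> (\<integral>x. e \<partial>I01)"
    using True assms by (intro integral_mono) (auto simp: space_restrict_space)
  also have "\<dots> = e" using measure_I01 by simp
  finally show ?thesis .
next
  case False
  then show ?thesis using assms[of 0] by (simp add: not_integrable_integral_eq)
qed

lemma norm_L2_le_sup: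
  assumes "\<And>x. x \<in> {0..1} \<Longrightarrow> \<bar>f x\<bar> \<le> e" shows "norm_L2 f \<le> e"
proof -
  have e: "e \<ge> 0" using assms[of 0] by auto
  have "\<bar>\<integral>x. f x * f x \<partial>I01\<bar> \<le> e * e"
    by (rule abs_integral_I01_le) (use assms e in \<open>simp add: abs_mult mult_mono del: abs_mult_self_eq\<close>)
  then have "inner_L2 f f \<le> e\<^sup>2" unfolding inner_L2_eq power2_eq_square by linarith
  then show ?thesis unfolding norm_L2_eq by (metis e real_le_lsqrt inner_L2_nonneg)
qed

section \<open>Completeness of the sine system\<close>

lemma integral_I01_FTC:
  fixes F :: "real \<Rightarrow> real"
  assumes "\<And>x. x \<in> {0..1} \<Longrightarrow> (F has_real_derivative f x) (at x within {0..1})"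
    and "continuous_on {0..1} f"
  shows "(\<integral>x. f x \<partial>I01) = F 1 - F 0"
proof -
  have "(\<integral>x. f x \<partial>I01) = (\<integral>x. indicator {0..1} x *\<^sub>R f x \<partial>lborel)"
    by (subst integral_restrict_space) auto
  also have "\<dots> = F 1 - F 0"
    using assms by (intro integral_FTC_Icc) (auto simp: has_real_derivative_iff_has_vector_derivative)
  finally show ?thesis .
qed

lemma phi_deriv: "(phi j has_real_derivative pi * real j * cos (pi * real j * x)) (at x within S)"
  unfolding phi_def[abs_def] by (auto intro!: derivative_eq_intros)

lemma dphi1_eq: "dphi1 j = pi * real j * cos (pi * real j)"
  unfolding dphi1_def using DERIV_imp_deriv[OF phi_deriv[of j 1 UNIV]] by simp

lemma abs_dphi1: "\<bar>dphi1 j\<bar> = pi * real j"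
  by (simp add: dphi1_eq abs_mult mult.commute[of pi])

lemma dphi1_nonzero: "j \<ge> 1 \<Longrightarrow> dphi1 j \<noteq> 0"
  using abs_dphi1[of j] by auto

lemma continuous_on_phi [continuous_intros]: "continuous_on S (phi j)"
  unfolding phi_def[abs_def] by (intro continuous_intros)

lemma L2_phi [simp]: "L2 (phi j)"
  by (intro L2_continuous continuous_intros)

lemma phi_0 [simp]: "phi j 0 = 0" by (simp add: phi_def)

lemma phi_1 [simp]: "phi j 1 = 0" by (simp add: phi_def mult.commute[of pi])

lemma abs_phi_le: "\<bar>phi j x\<bar> \<le> 1" by (simp add: phi_def)

text \<open>Green's identity: the antiderivative is \<open>g'\<close> times \<open>phi j\<close>
  minus \<open>g\<close> times the derivative of \<open>phi j\<close>, and since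
  \<open>phi j\<close> vanishes at both end points only the boundary values of \<open>g\<close>
  survive. This is how the boundary input enters mode \<open>j\<close> with the weight
  \<open>dphi1 j\<close>.\<close>

lemma inner_L2_deriv2_phi:
  assumes g: "\<And>x. x \<in> {0..1} \<Longrightarrow> (g has_real_derivative g' x) (at x within {0..1})"
    and g': "\<And>x. x \<in> {0..1} \<Longrightarrow> (g' has_real_derivative g'' x) (at x within {0..1})"
    and c: "continuous_on {0..1} g''"
  shows "inner_L2 g'' (phi j) = pi * real j * g 0 - dphi1 j * g 1 - (pi * real j)\<^sup>2 * inner_L2 g (phi j)"
proof -
  have cg: "continuous_on {0..1} g" using g
    by (meson DERIV_continuous continuous_on_eq_continuous_within)
  have "(\<integral>x. g'' x * phi j x + (pi * real j)\<^sup>2 * (g x * phi j x) \<partial>I01) =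
    (g' 1 * phi j 1 - g 1 * (pi * real j * cos (pi * real j * 1))) -
    (g' 0 * phi j 0 - g 0 * (pi * real j * cos (pi * real j * 0)))"
  proof (rule integral_I01_FTC)
    fix x :: real assume x: "x \<in> {0..1}"
    show "((\<lambda>x. g' x * phi j x - g x * (pi * real j * cos (pi * real j * x))) has_real_derivative
      g'' x * phi j x + (pi * real j)\<^sup>2 * (g x * phi j x)) (at x within {0..1})"
      by (rule derivative_eq_intros phi_deriv g[OF x] g'[OF x] refl)+
        (simp add: phi_def algebra_simps power2_eq_square)
  qed (intro continuous_intros c cg)
  moreover have "(\<integral>x. g'' x * phi j x + (pi * real j)\<^sup>2 * (g x * phi j x) \<partial>I01)
      = inner_L2 g'' (phi j) + (pi * real j)\<^sup>2 * inner_L2 g (phi j)"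
    unfolding inner_L2_eq
    by (subst Bochner_Integration.integral_add)
      (auto intro!: integrable_mult_right L2_integrable_mult L2_continuous c cg continuous_on_phi)
  ultimately show ?thesis by (simp add: dphi1_eq algebra_simps)
qed

text \<open>Distinct frequencies are orthogonal by Green's identity, both functions being
  eigenfunctions with zero boundary values. The value \<open>1/2\<close> is the origin of the
  factors 2 in the sine coefficients and in Parseval's identity.\<close>

lemma inner_phi_phi:
  assumes "i \<ge> 1" "j \<ge> 1"
  shows "inner_L2 (phi i) (phi j) = (if i = j then 1/2 else 0)"
proof (cases "i = j")
  case False
  have "inner_L2 (\<lambda>x. - ((pi * real i)\<^sup>2) * phi i x) (phi j)
      = pi * real j * phi i 0 - dphi1 j * phi i 1 - (pi * real j)\<^sup>2 * inner_L2 (phi i) (phi j)"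
  proof (rule inner_L2_deriv2_phi[OF phi_deriv])
    fix x :: real
    show "((\<lambda>x. pi * real i * cos (pi * real i * x)) has_real_derivative
        - ((pi * real i)\<^sup>2) * phi i x) (at x within {0..1})"
      unfolding phi_def by (auto intro!: derivative_eq_intros simp: power2_eq_square)
  qed (intro continuous_intros)
  then have "((pi * real i)\<^sup>2 - (pi * real j)\<^sup>2) * inner_L2 (phi i) (phi j) = 0"
    unfolding inner_L2_cmult_left by (simp add: algebra_simps)
  moreover have "(pi * real i)\<^sup>2 \<noteq> (pi * real j)\<^sup>2"
    using False by (simp add: power_mult_distrib)
  ultimately show ?thesis using False by simp
next
  case True
  have "(\<integral>x. phi j x * phi j x \<partial>I01) =
     (1/2 - sin (2 * (pi * real j * 1)) / (4 * (pi * real j))) - (0/2 - sin (2 * (pi * real j * 0)) / (4 * (pi * real j)))"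
  proof (rule integral_I01_FTC)
    fix x :: real
    have "phi j x * phi j x = 1/2 - cos (2 * (pi * real j * x)) / 2"
      unfolding phi_def cos_double_sin by (simp add: power2_eq_square diff_divide_distrib)
    moreover have "((\<lambda>x. x/2 - sin (2 * (pi * real j * x)) / (4 * (pi * real j))) has_real_derivative
        1/2 - cos (2 * (pi * real j * x)) / 2) (at x within {0..1})"
      using assms by (auto intro!: derivative_eq_intros)
    ultimately show "((\<lambda>x. x/2 - sin (2 * (pi * real j * x)) / (4 * (pi * real j))) has_real_derivative
        phi j x * phi j x) (at x within {0..1})"
      by simp
  qed (intro continuous_intros)
  then show ?thesis using True by (simp add: inner_L2_eq sin_double mult.commute[of pi])
qed

section \<open>Sine polynomials and their uniform density\<close>

inductive sine_poly :: "(real \<Rightarrow> real) \<Rightarrow> bool" where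
  zero: "sine_poly (\<lambda>x. 0)"
| add_phi: "sine_poly f \<Longrightarrow> sine_poly (\<lambda>x. f x + a * phi (Suc j) x)"

lemma sine_poly_add: "sine_poly g \<Longrightarrow> sine_poly f \<Longrightarrow> sine_poly (\<lambda>x. f x + g x)"
proof (induction rule: sine_poly.induct)
  case (add_phi g a j)
  then show ?case using sine_poly.add_phi[of "\<lambda>x. f x + g x" a j] by (simp add: add.assoc)
qed simp

lemma sine_poly_cmult: "sine_poly f \<Longrightarrow> sine_poly (\<lambda>x. c * f x)"
proof (induction rule: sine_poly.induct)
  case (add_phi g a j)
  then show ?case using sine_poly.add_phi[of "\<lambda>x. c * g x" "c * a" j] by (simp add: algebra_simps)
qed (simp add: sine_poly.zero)

lemma sine_poly_phi: "sine_poly (\<lambda>x. a * phi j x)"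
proof (cases j)
  case 0
  then show ?thesis by (simp add: phi_def sine_poly.zero)
next
  case (Suc i)
  then show ?thesis using sine_poly.add_phi[OF sine_poly.zero, of a i] by simp
qed

text \<open>Multiplication by \<open>cos (pi * x)\<close> shifts a frequency by plus and minus one;
  the lower neighbour of frequency 1 is \<open>phi 0\<close>, which is zero. Iterated, this makes
  \<open>sin (pi * x)\<close> times any polynomial in \<open>cos (pi * x)\<close> a sine
  polynomial.\<close>

lemma sine_poly_times_cos: "sine_poly f \<Longrightarrow> sine_poly (\<lambda>x. f x * cos (pi * x))"
proof (induction rule: sine_poly.induct)
  case (add_phi g a j)
  have "phi (Suc j) x * cos (pi * x) = 1/2 * phi (Suc (Suc j)) x + 1/2 * phi j x" for x
  proof -
    have "pi * real (Suc j) * x + pi * x = pi * real (Suc (Suc j)) * x"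
      "pi * real (Suc j) * x - pi * x = pi * real j * x" by (simp_all add: algebra_simps)
    then show ?thesis unfolding phi_def by (simp only: sin_times_cos) simp
  qed
  then have "(\<lambda>x. (g x + a * phi (Suc j) x) * cos (pi * x)) =
      (\<lambda>x. (g x * cos (pi * x) + (a/2) * phi (Suc (Suc j)) x) + (a/2) * phi j x)"
    by (auto simp: fun_eq_iff algebra_simps)
  then show ?case
    by (simp only:) (intro sine_poly_add sine_poly_phi add_phi.IH)
qed (simp add: sine_poly.zero)

lemma sine_poly_sum: "(\<And>i. i \<in> S \<Longrightarrow> sine_poly (f i)) \<Longrightarrow> sine_poly (\<lambda>x. \<Sum>i\<in>S. f i x)"
  by (induction S rule: infinite_finite_induct) (auto intro: sine_poly.zero sine_poly_add)

lemma sine_poly_sin_cos_power: "sine_poly (\<lambda>x. sin (pi * x) * cos (pi * x) ^ k)"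
proof (induction k)
  case 0
  then show ?case using sine_poly_phi[of 1 1] by (simp add: phi_def)
next
  case (Suc k)
  then show ?case using sine_poly_times_cos[OF Suc] by (simp add: mult_ac)
qed

text \<open>A derivation may add the same frequency several times, so the coefficients have to be
  collected into one sequence.\<close>

lemma sine_poly_sum_form:
  "sine_poly f \<Longrightarrow> \<exists>n a. \<forall>x. f x = (\<Sum>j<n. a j * phi (Suc j) x)"
proof (induction rule: sine_poly.induct)
  case zero
  then show ?case by (intro exI[of _ 0]) simp
next
  case (add_phi f c i)
  then obtain n a where f: "\<And>x. f x = (\<Sum>j<n. a j * phi (Suc j) x)" by auto
  define m where "m = max n (Suc i)"
  define b where "b j = (if j < n then a j else 0) + (if j = i then c else 0)" for j
  have "f x + c * phi (Suc i) x = (\<Sum>j<m. b j * phi (Suc j) x)" for x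
  proof -
    have "(\<Sum>j<m. b j * phi (Suc j) x) = (\<Sum>j<m. if j < n then a j * phi (Suc j) x else 0)
        + (\<Sum>j<m. if j = i then c * phi (Suc j) x else 0)"
      unfolding b_def sum.distrib[symmetric] by (intro sum.cong) (auto simp: algebra_simps)
    also have "(\<Sum>j<m. if j < n then a j * phi (Suc j) x else 0) = (\<Sum>j<n. a j * phi (Suc j) x)"
      by (intro sum.mono_neutral_cong_right) (auto simp: m_def)
    also have "(\<Sum>j<m. if j = i then c * phi (Suc j) x else 0) = c * phi (Suc i) x"
      by (simp add: m_def)
    finally show ?thesis by (simp add: f)
  qed
  then show ?case by blast
qed

text \<open>If \<open>f\<close> vanishes near both end points, \<open>f x / sin (pi * x)\<close> is
  continuous and can be written as a function of \<open>cos (pi * x)\<close>, the cosine being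
  injective there. A polynomial approximation of that function, multiplied back by
  \<open>sin (pi * x)\<close>, is a sine polynomial. The general case is reduced to this one at the
  cost of half the error.\<close>

lemma sine_poly_uniform_dense:
  fixes f :: "real \<Rightarrow> real"
  assumes cf: "continuous_on {0..1} f" and f0: "f 0 = 0" and f1: "f 1 = 0" and e: "e > 0"
  shows "\<exists>s. sine_poly s \<and> (\<forall>x\<in>{0..1}. \<bar>f x - s x\<bar> \<le> e)"
proof -
  define d where "d = e / 2"
  have d: "d > 0" using e by (simp add: d_def)
  \<comment> \<open>Soft thresholding: \<open>h\<close> is uniformly close to \<open>f\<close> and vanishes near both end points.\<close>
  define h where "h x = f x - max (-d) (min (f x) d)" for x
  have ch: "continuous_on {0..1} h" unfolding h_def by (intro continuous_intros cf)
  have hf: "\<bar>f x - h x\<bar> \<le> d" for x unfolding h_def using d by auto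
  have hz: "h x = 0" if "\<bar>f x\<bar> < d" for x using that unfolding h_def by auto
  obtain d0 where d0: "d0 > 0" "\<And>x. x \<in> {0..1} \<Longrightarrow> dist x 0 < d0 \<Longrightarrow> dist (f x) (f 0) < d"
    using cf d unfolding continuous_on_iff by (metis atLeastAtMost_iff order_refl zero_le_one)
  obtain d1 where d1: "d1 > 0" "\<And>x. x \<in> {0..1} \<Longrightarrow> dist x 1 < d1 \<Longrightarrow> dist (f x) (f 1) < d"
    using cf d unfolding continuous_on_iff by (metis atLeastAtMost_iff order_refl zero_le_one)
  \<comment> \<open>Halving makes the bounds by \<open>d0\<close> and \<open>d1\<close> strict and
    gives \<open>r \<le> 1/4\<close>, so that the two end zones are disjoint.\<close>
  define r where "r = min (1/2) (min d0 d1) / 2"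
  have r: "r > 0" "r < 1 - r" "r < d0" "r < d1" using d0 d1 by (auto simp: r_def)
  have z0: "h x = 0" if "x \<in> {0..r}" for x
    using that r d0(2)[of x] f0 by (intro hz) (auto simp: dist_real_def)
  have z1: "h x = 0" if "x \<in> {1-r..1}" for x
    using that r d1(2)[of x] f1 by (intro hz) (auto simp: dist_real_def)
  define G where "G x = h x / sin (pi * x)" for x
  have "continuous_on ({0..r} \<union> ({r..1-r} \<union> {1-r..1})) G"
  proof (intro continuous_on_closed_Un)
    show "continuous_on {0..r} G"
      by (rule continuous_on_eq[of _ "\<lambda>x. 0"]) (auto simp: G_def z0)
    show "continuous_on {1-r..1} G"
      by (rule continuous_on_eq[of _ "\<lambda>x. 0"]) (auto simp: G_def z1)
    have "sin (pi * x) \<noteq> 0" if "x \<in> {r..1-r}" for x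
      using that r sin_gt_zero[of "pi * x"] by (auto simp: less_eq_real_def)
    then show "continuous_on {r..1-r} G" unfolding G_def
      by (intro continuous_intros continuous_on_subset[OF ch]) (use r in auto)
  qed auto
  moreover have "{0..r} \<union> ({r..1-r} \<union> {1-r..1}) = {0..1}" using r by auto
  ultimately have cG: "continuous_on {0..1} G" by simp
  \<comment> \<open>The substitution \<open>y = cos (pi * x)\<close> moves \<open>G\<close> to
    \<open>[-1, 1]\<close>, where Weierstrass' theorem applies.\<close>
  have "continuous_on {-1..1} (\<lambda>y. G (arccos y / pi))"
  proof (rule continuous_on_compose2[OF cG])
    show "continuous_on {-1..1} (\<lambda>y. arccos y / pi)"
      by (intro continuous_intros) auto
    show "(\<lambda>y. arccos y / pi) ` {- 1..1} \<subseteq> {0..1}"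
      using arccos_lbound arccos_ubound by (auto simp: field_simps)
  qed
  then obtain p where p: "real_polynomial_function p"
      "\<And>y. y \<in> {-1..1} \<Longrightarrow> \<bar>G (arccos y / pi) - p y\<bar> < d"
    using Stone_Weierstrass_real_polynomial_function[of "{-1..1}" _ d] d by auto
  from p(1) obtain a n where pa: "p = (\<lambda>x. \<Sum>i\<le>n. a i * x ^ i)"
    unfolding real_polynomial_function_iff_sum by auto
  define s where "s x = sin (pi * x) * p (cos (pi * x))" for x
  have "s = (\<lambda>x. \<Sum>i\<le>n. a i * (sin (pi * x) * cos (pi * x) ^ i))"
    unfolding s_def pa by (auto simp: sum_distrib_left mult_ac)
  then have sp: "sine_poly s" by (simp add: sine_poly_sum sine_poly_cmult sine_poly_sin_cos_power)
  have "\<bar>f x - s x\<bar> \<le> e" if x: "x \<in> {0..1}" for x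
  proof -
    have ac: "arccos (cos (pi * x)) / pi = x"
      using x by (subst arccos_cos) (auto simp: mult_le_cancel_left1)
    have 1: "\<bar>G x - p (cos (pi * x))\<bar> \<le> d"
      using p(2)[of "cos (pi * x)"] unfolding ac by auto
    have "h x = sin (pi * x) * G x"
    proof (cases "x = 0 \<or> x = 1")
      case True
      then show ?thesis using z0[of 0] z1[of 1] r by auto
    next
      case False
      then have "sin (pi * x) > 0" using x by (intro sin_gt_zero) auto
      then show ?thesis by (simp add: G_def)
    qed
    then have "h x - s x = sin (pi * x) * (G x - p (cos (pi * x)))"
      by (simp add: s_def algebra_simps)
    then have "\<bar>h x - s x\<bar> \<le> 1 * d"
      using 1 by (simp only: abs_mult) (intro mult_mono, auto)
    then show ?thesis using hf[of x] unfolding d_def by linarith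
  qed
  then show ?thesis using sp by blast
qed

section \<open>Density of the sine polynomials in the mean-square norm\<close>

lemma bounded_L2_approx:
  assumes fm: "f \<in> borel_measurable I01" and K: "\<And>x. x \<in> {0..1} \<Longrightarrow> \<bar>f x\<bar> \<le> K" and e: "e > 0"
  shows "\<exists>h. continuous_on {0..1} h \<and> h 0 = 0 \<and> h 1 = 0 \<and> norm_L2 (\<lambda>x. f x - h x) < e"
proof -
  interpret finite_measure I01 by (rule finite_measure_I01)
  have K0: "K \<ge> 0" using K[of 0] by auto
  have "f \<in> borel_measurable (lebesgue_on {0..1})"
    using fm by (auto simp: borel_measurable_restrict_space_iff intro: measurable_completion)
  then have "f measurable_on {0..1}"
    by (subst measurable_on_iff_borel_measurable) auto
  \<comment> \<open>\<open>measurable_on\<close> means pointwise convergence of continuous functions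
    off a negligible set, which is the raw material of the approximation.\<close>
  then obtain Z g where Z: "negligible Z" and cg: "\<And>n. continuous_on UNIV (g n)"
    and lim: "\<And>x. x \<notin> Z \<Longrightarrow> (\<lambda>n. g n x) \<longlonglongrightarrow> (if x \<in> {0..1} then f x else 0)"
    unfolding measurable_on_def by blast
  \<comment> \<open>Clamping to \<open>[-K, K]\<close> supplies the integrable majorant. The second
    factor vanishes at both end points and is eventually 1 at every interior point.\<close>
  define h where "h n x = max (-K) (min K (g n x)) * min 1 (real n * min x (1 - x))"
    for n :: nat and x :: real
  have ch: "continuous_on {0..1} (h n)" for n
    unfolding h_def by (intro continuous_intros continuous_on_subset[OF cg]) auto
  have hb: "\<bar>h n x\<bar> \<le> K * 1" if "x \<in> {0..1}" for n x
    unfolding h_def abs_mult using that K0 by (intro mult_mono) auto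
  have lim2: "(\<lambda>n. (f x - h n x)\<^sup>2) \<longlonglongrightarrow> 0" if x: "x \<in> {0<..<1}" "x \<notin> Z" for x
  proof -
    have "(\<lambda>n. max (-K) (min K (g n x))) \<longlonglongrightarrow> max (-K) (min K (f x))"
      using lim[OF x(2)] x(1) by (intro tendsto_intros) auto
    then have 1: "(\<lambda>n. max (-K) (min K (g n x))) \<longlonglongrightarrow> f x"
      using K[of x] x by (subst (asm) min_absorb2) (auto simp: max_absorb2)
    have "\<forall>\<^sub>F n in sequentially. min 1 (real n * min x (1 - x)) = 1"
    proof -
      have m: "min x (1 - x) > 0" using x by auto
      obtain k :: nat where k: "1 < real k * min x (1 - x)"
        using reals_Archimedean3[OF m] by blast
      have "min 1 (real n * min x (1 - x)) = 1" if "n \<ge> k" for n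
      proof -
        have "real k * min x (1 - x) \<le> real n * min x (1 - x)"
          using that m by (intro mult_right_mono) auto
        then show ?thesis using k by linarith
      qed
      then show ?thesis unfolding eventually_sequentially by blast
    qed
    then have 2: "(\<lambda>n. min 1 (real n * min x (1 - x))) \<longlonglongrightarrow> 1"
      by (rule tendsto_eventually)
    have "(\<lambda>n. (f x - h n x)\<^sup>2) \<longlonglongrightarrow> (f x - f x * 1)\<^sup>2"
      unfolding h_def by (intro tendsto_intros 1 2)
    then show ?thesis by simp
  qed
  have "AE x in lborel. x \<notin> Z"
    using AE_not_in[of Z lebesgue] Z by (simp add: AE_completion_iff negligible_iff_null_sets)
  moreover have "AE x in lborel. x \<noteq> (0::real)" "AE x in lborel. x \<noteq> (1::real)"
    by (rule AE_lborel_singleton)+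
  ultimately have "AE x in lborel. x \<in> {0..1} \<longrightarrow> (\<lambda>n. (f x - h n x)\<^sup>2) \<longlonglongrightarrow> 0"
    by eventually_elim (intro impI lim2, auto)
  then have ae: "AE x in I01. (\<lambda>n. (f x - h n x)\<^sup>2) \<longlonglongrightarrow> 0"
    by (subst AE_restrict_space_iff) auto
  have "(\<lambda>n. \<integral>x. (f x - h n x)\<^sup>2 \<partial>I01) \<longlonglongrightarrow> (\<integral>x. 0 \<partial>I01)"
  proof (rule integral_dominated_convergence)
    show "integrable I01 (\<lambda>x. (2 * K)\<^sup>2)" by simp
    show "(\<lambda>x. (f x - h n x)\<^sup>2) \<in> borel_measurable I01" for n
      using fm L2_measurable[OF L2_continuous[OF ch[of n]]] by simp
    show "AE x in I01. norm ((f x - h n x)\<^sup>2) \<le> (2 * K)\<^sup>2" for n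
    proof (rule AE_I2)
      fix x assume "x \<in> space I01"
      then have x: "x \<in> {0..1}" by (simp add: space_restrict_space)
      have "\<bar>f x - h n x\<bar> \<le> 2 * K" using K[OF x] hb[OF x, of n] by linarith
      then show "norm ((f x - h n x)\<^sup>2) \<le> (2 * K)\<^sup>2"
        using power_mono[of "\<bar>f x - h n x\<bar>" "2 * K" 2] by simp
    qed
  qed (use ae in auto)
  then have "(\<lambda>n. norm_L2 (\<lambda>x. f x - h n x)) \<longlonglongrightarrow> sqrt 0"
    unfolding norm_L2_eq inner_L2_eq by (intro tendsto_real_sqrt) (simp add: power2_eq_square)
  then have "\<forall>\<^sub>F n in sequentially. norm_L2 (\<lambda>x. f x - h n x) < e"
    using e by (auto dest: order_tendstoD(2))
  then obtain n where "norm_L2 (\<lambda>x. f x - h n x) < e"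
    by (auto simp: eventually_sequentially)
  moreover have "h n 0 = 0" "h n 1 = 0" by (auto simp: h_def)
  ultimately show ?thesis using ch by blast
qed

text \<open>Dominated convergence: the truncation error is at most \<open>\<bar>f x\<bar>\<close>
  and vanishes as soon as the level exceeds \<open>\<bar>f x\<bar>\<close>.\<close>

lemma L2_truncation:
  assumes f: "L2 f" and e: "e > 0"
  shows "\<exists>K. norm_L2 (\<lambda>x. f x - max (-K) (min K (f x))) < e"
proof -
  define T where "T n x = max (- real n) (min (real n) (f x))" for n x
  have "(\<lambda>n. \<integral>x. (f x - T n x)\<^sup>2 \<partial>I01) \<longlonglongrightarrow> (\<integral>x. 0 \<partial>I01)"
  proof (rule integral_dominated_convergence)
    show "integrable I01 (\<lambda>x. (f x)\<^sup>2)" using f by (simp add: L2_iff)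
    show "(\<lambda>x. (f x - T n x)\<^sup>2) \<in> borel_measurable I01" for n
      using L2_measurable[OF f] unfolding T_def by simp
    show "AE x in I01. norm ((f x - T n x)\<^sup>2) \<le> (f x)\<^sup>2" for n
      by (rule AE_I2) (simp add: abs_le_square_iff[symmetric] T_def)
    show "AE x in I01. (\<lambda>n. (f x - T n x)\<^sup>2) \<longlonglongrightarrow> 0"
    proof (rule AE_I2)
      fix x
      obtain k :: nat where k: "\<bar>f x\<bar> \<le> real k" using real_arch_simple by blast
      have "(f x - T n x)\<^sup>2 = 0" if "n \<ge> k" for n
        using k that of_nat_mono[OF that, where 'a=real] by (auto simp: T_def)
      then show "(\<lambda>n. (f x - T n x)\<^sup>2) \<longlonglongrightarrow> 0"
        by (intro tendsto_eventually) (auto simp: eventually_sequentially)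
    qed
  qed auto
  then have "(\<lambda>n. norm_L2 (\<lambda>x. f x - T n x)) \<longlonglongrightarrow> sqrt 0"
    unfolding norm_L2_eq inner_L2_eq by (intro tendsto_real_sqrt) (simp add: power2_eq_square)
  then have "\<forall>\<^sub>F n in sequentially. norm_L2 (\<lambda>x. f x - T n x) < e"
    using e by (auto dest: order_tendstoD(2))
  then show ?thesis unfolding T_def by (auto simp: eventually_sequentially)
qed

lemma L2_sine_poly: "sine_poly s \<Longrightarrow> L2 s"
  by (induction rule: sine_poly.induct) (auto intro!: L2_zero L2_add L2_cmult L2_phi)

text \<open>Truncation, approximation by continuous functions vanishing at the end points, and
  uniform approximation by sine polynomials contribute a third of the error each.\<close>

lemma sine_poly_L2_dense:
  assumes f: "L2 f" and e: "e > 0"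
  shows "\<exists>s. sine_poly s \<and> norm_L2 (\<lambda>x. f x - s x) < e"
proof -
  have e3: "e / 3 > 0" using e by simp
  obtain K where K: "norm_L2 (\<lambda>x. f x - max (-K) (min K (f x))) < e / 3"
    using L2_truncation[OF f e3] by blast
  define g where "g x = max (-K) (min K (f x))" for x
  have gm: "g \<in> borel_measurable I01" using L2_measurable[OF f] unfolding g_def by simp
  have gb: "\<bar>g x\<bar> \<le> \<bar>K\<bar>" for x unfolding g_def by auto
  obtain h where h: "continuous_on {0..1} h" "h 0 = 0" "h 1 = 0" "norm_L2 (\<lambda>x. g x - h x) < e/3"
    using bounded_L2_approx[OF gm gb e3] by blast
  obtain s where s: "sine_poly s" "\<And>x. x \<in> {0..1} \<Longrightarrow> \<bar>h x - s x\<bar> \<le> e/3"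
    using sine_poly_uniform_dense[OF h(1-3) e3] by blast
  interpret finite_measure I01 by (rule finite_measure_I01)
  have gL: "L2 g"
    unfolding L2_iff
  proof
    show "integrable I01 (\<lambda>x. (g x)\<^sup>2)"
    proof (rule integrable_const_bound[of _ "K\<^sup>2"])
      show "AE x in I01. norm ((g x)\<^sup>2) \<le> K\<^sup>2"
        using gb by (intro AE_I2) (simp add: abs_le_square_iff)
    qed (use gm in simp)
  qed (rule gm)
  note L = f gL L2_continuous[OF h(1)] L2_sine_poly[OF s(1)]
  have "norm_L2 (\<lambda>x. f x - s x) = norm_L2 (\<lambda>x. (f x - g x) + ((g x - h x) + (h x - s x)))" by simp
  also have "\<dots> \<le> norm_L2 (\<lambda>x. f x - g x) + norm_L2 (\<lambda>x. (g x - h x) + (h x - s x))"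
    by (intro norm_L2_triangle L2_diff L2_add L)
  also have "norm_L2 (\<lambda>x. (g x - h x) + (h x - s x)) \<le> norm_L2 (\<lambda>x. g x - h x) + norm_L2 (\<lambda>x. h x - s x)"
    by (intro norm_L2_triangle L2_diff L2_add L)
  also have "norm_L2 (\<lambda>x. h x - s x) \<le> e/3"
    using s(2) by (rule norm_L2_le_sup)
  finally show ?thesis using K h(4) s(1) unfolding g_def[symmetric] by (intro exI[of _ s]) auto
qed

section \<open>Bessel's and Parseval's identities for the sine system\<close>

lemma norm_L2_sq_diff_sine_sum:
  assumes f: "L2 f"
  shows "(norm_L2 (\<lambda>x. f x - (\<Sum>j<n. a j * phi (Suc j) x)))\<^sup>2 =
    (norm_L2 f)\<^sup>2 - 2 * (\<Sum>j<n. (inner_L2 f (phi (Suc j)))\<^sup>2)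
    + (\<Sum>j<n. (a j - 2 * inner_L2 f (phi (Suc j)))\<^sup>2) / 2"
proof (induction n)
  case (Suc n)
  define g where "g x = f x - (\<Sum>j<n. a j * phi (Suc j) x)" for x
  define c where "c = inner_L2 f (phi (Suc n))"
  have L: "L2 (\<lambda>x. \<Sum>j<n. a j * phi (Suc j) x)"
    by (intro L2_sum L2_cmult L2_phi)
  then have gL: "L2 g" unfolding g_def using f by (rule L2_diff[rotated])
  \<comment> \<open>Orthogonality: subtracting the earlier terms leaves the coefficient of the new
    frequency unchanged.\<close>
  have "inner_L2 (\<lambda>x. \<Sum>j<n. a j * phi (Suc j) x) (phi (Suc n)) = 0"
    by (subst inner_L2_sum_left) (auto simp: L2_cmult inner_L2_cmult_left inner_phi_phi)
  then have gc: "inner_L2 g (phi (Suc n)) = c"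
    unfolding g_def using f L by (simp add: inner_L2_diff_left c_def)
  define b where "b = - a n"
  have "(norm_L2 (\<lambda>x. f x - (\<Sum>j<Suc n. a j * phi (Suc j) x)))\<^sup>2
      = (norm_L2 (\<lambda>x. g x + b * phi (Suc n) x))\<^sup>2"
    by (simp add: g_def b_def algebra_simps)
  also have "\<dots> = (norm_L2 g)\<^sup>2 + 2 * b * c + b\<^sup>2 / 2"
    using gc by (subst norm_L2_sq_add[OF gL])
      (auto simp: L2_cmult inner_L2_cmult_right norm_L2_cmult power_mult_distrib norm_L2_sq inner_phi_phi)
  also have "(norm_L2 g)\<^sup>2 = (norm_L2 f)\<^sup>2 - 2 * (\<Sum>j<n. (inner_L2 f (phi (Suc j)))\<^sup>2)
    + (\<Sum>j<n. (a j - 2 * inner_L2 f (phi (Suc j)))\<^sup>2) / 2"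
    unfolding g_def by (rule Suc.IH)
  finally show ?case
    unfolding sum.lessThan_Suc by (simp add: c_def[symmetric] b_def power2_eq_square field_simps)
qed simp

text \<open>In the preceding identity, taking \<open>a j\<close> as twice the mode annihilates the
  last sum and yields Bessel's inequality. For the coefficients of a close sine polynomial the last
  sum is merely nonnegative, which gives the converse inequality up to \<open>e\<close>.\<close>

theorem Parseval_sine:
  assumes f: "L2 f"
  shows "(\<lambda>j. (inner_L2 f (phi (Suc j)))\<^sup>2) sums ((norm_L2 f)\<^sup>2 / 2)"
proof -
  let ?c = "\<lambda>j. inner_L2 f (phi (Suc j))"
  have le: "2 * (\<Sum>j<n. (?c j)\<^sup>2) \<le> (norm_L2 f)\<^sup>2" for n
    using norm_L2_sq_diff_sine_sum[OF f, where n = n and a = "\<lambda>j. 2 * ?c j"]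
      zero_le_power2[of "norm_L2 (\<lambda>x. f x - (\<Sum>j<n. 2 * ?c j * phi (Suc j) x))"] by simp
  have "\<exists>n0. \<forall>n\<ge>n0. \<bar>(\<Sum>j<n. (?c j)\<^sup>2) - (norm_L2 f)\<^sup>2 / 2\<bar> < e" if e: "e > 0" for e
  proof -
    obtain s where s: "sine_poly s" "norm_L2 (\<lambda>x. f x - s x) < sqrt e"
      using sine_poly_L2_dense[OF f, of "sqrt e"] e by auto
    obtain m a where sa: "\<And>x. s x = (\<Sum>j<m. a j * phi (Suc j) x)"
      using sine_poly_sum_form[OF s(1)] by blast
    have "(norm_L2 (\<lambda>x. f x - s x))\<^sup>2 < e"
      using power_strict_mono[OF s(2) norm_L2_nonneg, of 2] e by simp
    moreover have "(norm_L2 f)\<^sup>2 - 2 * (\<Sum>j<m. (?c j)\<^sup>2) \<le> (norm_L2 (\<lambda>x. f x - s x))\<^sup>2"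
      unfolding sa norm_L2_sq_diff_sine_sum[OF f] by (simp add: sum_nonneg)
    ultimately have m: "(norm_L2 f)\<^sup>2 - 2 * (\<Sum>j<m. (?c j)\<^sup>2) < e" by linarith
    have "\<bar>(\<Sum>j<n. (?c j)\<^sup>2) - (norm_L2 f)\<^sup>2 / 2\<bar> < e" if n: "n \<ge> m" for n
    proof -
      have "(\<Sum>j<m. (?c j)\<^sup>2) \<le> (\<Sum>j<n. (?c j)\<^sup>2)"
        using n by (intro sum_mono2) auto
      then show ?thesis using m le[of n] e unfolding abs_less_iff by linarith
    qed
    then show ?thesis by blast
  qed
  then show ?thesis unfolding sums_def by (intro LIMSEQ_I) (unfold real_norm_def)
qed

lemma norm_phi_le: "norm_L2 (phi j) \<le> 1"
  by (rule norm_L2_le_sup) (rule abs_phi_le)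

lemma abs_mode_le: "L2 f \<Longrightarrow> \<bar>inner_L2 f (phi j)\<bar> \<le> norm_L2 f"
  using Cauchy_Schwarz_L2[of f "phi j"] mult_left_mono[OF norm_phi_le norm_L2_nonneg, of f j] by simp

section \<open>Maximum principle and mode equations for the heat equation\<close>

text \<open>One function \<open>D\<close> serves as time derivative and as second space derivative,
  which encodes the equation. The time set is a parameter because the maximum principle works on
  \<open>{a<..b}\<close> and the rest mostly on \<open>{0<..}\<close>.\<close>

definition heat_derivs ::
  "real set \<Rightarrow> (real \<Rightarrow> real \<Rightarrow> real) \<Rightarrow> (real \<Rightarrow> real \<Rightarrow> real) \<Rightarrow> (real \<Rightarrow> real \<Rightarrow> real) \<Rightarrow> bool" where
  "heat_derivs T w wx D \<longleftrightarrow> (\<forall>t\<in>T. \<forall>x\<in>{0<..<1}. (w t has_real_derivative wx t x) (at x) \<and>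
     ((\<lambda>s. w s x) has_real_derivative D t x) (at t) \<and> (wx t has_real_derivative D t x) (at x))"

definition heat_solution :: "real set \<Rightarrow> (real \<Rightarrow> real \<Rightarrow> real) \<Rightarrow> bool" where
  "heat_solution T w \<longleftrightarrow> (\<exists>wx D. heat_derivs T w wx D)"

lemma heat_solutionI: "heat_derivs T w wx D \<Longrightarrow> heat_solution T w"
  unfolding heat_solution_def by blast

lemma heat_solution_subset: "heat_solution T w \<Longrightarrow> S \<subseteq> T \<Longrightarrow> heat_solution S w"
  unfolding heat_solution_def heat_derivs_def subset_eq by fast

lemma heat_solution_add:
  assumes "heat_solution T v" "heat_solution T w"
  shows "heat_solution T (\<lambda>t x. v t x + w t x)"
proof -
  obtain vx Dv wx Dw where "heat_derivs T v vx Dv" "heat_derivs T w wx Dw"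
    using assms unfolding heat_solution_def by auto
  then have "heat_derivs T (\<lambda>t x. v t x + w t x) (\<lambda>t x. vx t x + wx t x) (\<lambda>t x. Dv t x + Dw t x)"
    unfolding heat_derivs_def by (auto intro!: DERIV_add)
  then show ?thesis by (rule heat_solutionI)
qed

lemma heat_solution_cmult:
  assumes "heat_solution T w" shows "heat_solution T (\<lambda>t x. c * w t x)"
proof -
  obtain wx D where "heat_derivs T w wx D"
    using assms unfolding heat_solution_def by auto
  then have "heat_derivs T (\<lambda>t x. c * w t x) (\<lambda>t x. c * wx t x) (\<lambda>t x. c * D t x)"
    unfolding heat_derivs_def by (auto intro!: DERIV_cmult)
  then show ?thesis by (rule heat_solutionI)
qed

lemma heat_solution_diff:
  assumes "heat_solution T v" "heat_solution T w"
  shows "heat_solution T (\<lambda>t x. v t x - w t x)"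
  using heat_solution_add[OF assms(1) heat_solution_cmult[OF assms(2), of "-1"]] by simp

lemma heat_solution_zero: "heat_solution T (\<lambda>t x. 0)"
  by (rule heat_solutionI[where wx = "\<lambda>t x. 0" and D = "\<lambda>t x. 0"]) (simp add: heat_derivs_def)

lemma heat_solution_sum:
  "(\<And>i. i \<in> S \<Longrightarrow> heat_solution T (w i)) \<Longrightarrow> heat_solution T (\<lambda>t x. \<Sum>i\<in>S. w i t x)"
  by (induction S rule: infinite_finite_induct) (auto intro: heat_solution_zero heat_solution_add)

text \<open>The exponent may have either sign: hyperbolic profiles belong to \<open>c > 0\<close>,
  trigonometric ones to \<open>c < 0\<close>.\<close>

lemma heat_solution_separated:
  assumes "\<And>x. (g has_real_derivative g' x) (at x)" "\<And>x. (g' has_real_derivative c * g x) (at x)"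
  shows "heat_solution T (\<lambda>t x. exp (c * t) * g x)"
  by (rule heat_solutionI[where wx = "\<lambda>t x. exp (c * t) * g' x" and D = "\<lambda>t x. exp (c * t) * (c * g x)"])
    (auto simp: heat_derivs_def intro!: derivative_eq_intros assms)

section \<open>The parabolic maximum principle\<close>

lemma second_deriv_nonpos_at_max:
  fixes f :: "real \<Rightarrow> real"
  assumes f: "\<And>y. y \<in> {0<..<1} \<Longrightarrow> (f has_real_derivative f' y) (at y)"
    and D: "(f' has_real_derivative D) (at x)" and x: "x \<in> {0<..<1}"
    and max: "\<And>y. y \<in> {0<..<1} \<Longrightarrow> f y \<le> f x"
  shows "D \<le> 0"
proof (rule ccontr)
  assume "\<not> D \<le> 0"
  then obtain d where d: "d > 0" "\<And>h. 0 < h \<Longrightarrow> h < d \<Longrightarrow> f' x < f' (x + h)"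
    using DERIV_pos_inc_right[OF D] by force
  have "f' x = 0"
  proof (rule DERIV_local_max[OF f[OF x]])
    show "0 < min x (1 - x)" using x by auto
    show "\<forall>y. \<bar>x - y\<bar> < min x (1 - x) \<longrightarrow> f y \<le> f x"
      by (intro allI impI max) (use x in \<open>simp add: abs_less_iff\<close>)
  qed
  \<comment> \<open>Since \<open>f'\<close> vanishes at \<open>x\<close> and is positive just to the
    right of it, the mean value theorem on \<open>[x, x + h]\<close> makes \<open>f\<close> exceed
    its maximum.\<close>
  define h where "h = min d (1 - x) / 2"
  have h: "h > 0" "h < d" "h < 1 - x" using d x unfolding h_def by auto
  obtain z where z: "x < z" "z < x + h" "f (x + h) - f x = (x + h - x) * f' z"
    using MVT2[of x "x + h" f f'] f h x by (auto simp: less_diff_eq)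
  have "f' z > 0" using d(2)[of "z - x"] z h \<open>f' x = 0\<close> by simp
  then have "(x + h - x) * f' z > 0" using h by simp
  then have "f (x + h) > f x" using z(3) by linarith
  then show False using max[of "x + h"] h x by auto
qed

text \<open>Tilting by \<open>- d * (t - a)\<close> makes the argument strict: at an interior
  maximum of the tilted function the equation gives a time derivative of \<open>w\<close> that is at
  most 0, so the tilted function decreases in time there and was larger shortly before. Only earlier
  times are compared, which lets the maximum lie at \<open>t = b\<close>.\<close>

lemma heat_maximum_principle:
  assumes hs: "heat_solution {a<..b} w"
    and cw: "continuous_on ({a..b} \<times> {0..1}) (\<lambda>(t, x). w t x)"
    and init: "\<And>x. x \<in> {0..1} \<Longrightarrow> w a x \<le> M"
    and bdry: "\<And>t. t \<in> {a..b} \<Longrightarrow> w t 0 \<le> M" "\<And>t. t \<in> {a..b} \<Longrightarrow> w t 1 \<le> M"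
    and tx: "t \<in> {a..b}" "x \<in> {0..1}"
  shows "w t x \<le> M"
proof (rule ccontr)
  assume "\<not> w t x \<le> M"
  then have gt: "w t x > M" by simp
  \<comment> \<open>Over the whole interval the tilt costs at most half of the excess
    \<open>w t x - M\<close>; the summand 1 keeps the denominator positive when
    \<open>a = b\<close>.\<close>
  define d where "d = (w t x - M) / (2 * (b - a + 1))"
  have ba: "b - a + 1 > 0" using tx by auto
  have d: "d > 0" using gt ba by (simp add: d_def)
  define g where "g = (\<lambda>p. w (fst p) (snd p) - d * (fst p - a))"
  have "continuous_on ({a..b} \<times> {0..1}) (\<lambda>p. w (fst p) (snd p))"
    using cw by (simp add: case_prod_unfold)
  then have cg: "continuous_on ({a..b} \<times> {0..1}) g"
    unfolding g_def by (intro continuous_intros)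
  have "compact ({a..b} \<times> {0..1::real})" by (intro compact_Times) auto
  moreover have "{a..b} \<times> {0..1::real} \<noteq> {}" using tx by auto
  ultimately obtain p where p: "p \<in> {a..b} \<times> {0..1}" "\<And>q. q \<in> {a..b} \<times> {0..1} \<Longrightarrow> g q \<le> g p"
    using continuous_attains_sup[OF _ _ cg] by blast
  obtain s y where sy: "p = (s, y)" by (cases p)
  have s: "s \<in> {a..b}" and y: "y \<in> {0..1}" using p(1) sy by auto
  have mx: "w r z - d * (r - a) \<le> w s y - d * (s - a)" if "r \<in> {a..b}" "z \<in> {0..1}" for r z
    using p(2)[of "(r, z)"] that by (simp add: g_def sy)
  have "d * (t - a) \<le> d * (b - a + 1)" using d tx by (intro mult_left_mono) auto
  also have "\<dots> = (w t x - M) / 2" 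
    using ba unfolding d_def by (metis less_irrefl mult.commute nonzero_mult_divide_mult_cancel_left times_divide_eq_right)
  finally have "w t x - d * (t - a) > M" using gt by argo
  then have "w s y - d * (s - a) > M" using mx[OF tx] by linarith
  moreover have "d * (s - a) \<ge> 0" using d s by simp
  ultimately have big: "w s y > M" by linarith
  have s': "s \<in> {a<..b}" using s init[OF y] big by (cases "s = a") auto
  have y': "y \<in> {0<..<1}" using y bdry[OF s] big by (cases "y = 0"; cases "y = 1") auto
  obtain wx D where "heat_derivs {a<..b} w wx D"
    using hs unfolding heat_solution_def by auto
  then have w: "(w s has_real_derivative wx s z) (at z)" "((\<lambda>s. w s z) has_real_derivative D s z) (at s)"
    "(wx s has_real_derivative D s z) (at z)" if "z \<in> {0<..<1}" for z
    using s' that unfolding heat_derivs_def by auto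
  have "D s y \<le> 0"
    using second_deriv_nonpos_at_max[OF w(1) w(3)[OF y'] y'] mx[OF s] by simp
  then have neg: "D s y - d < 0" using d by simp
  have "((\<lambda>r. w r y - d * (r - a)) has_real_derivative D s y - d) (at s)"
    by (auto intro!: derivative_eq_intros w(2)[OF y'])
  from DERIV_neg_dec_left[OF this neg] obtain e where e: "e > 0"
    "\<And>h. 0 < h \<Longrightarrow> h < e \<Longrightarrow> w s y - d * (s - a) < w (s - h) y - d * (s - h - a)" by blast
  define h where "h = min e (s - a) / 2"
  have "0 < h" "h < e" "s - h \<in> {a..b}" using e s' by (auto simp: h_def min_def field_simps)
  then show False using e(2)[of h] mx[of "s - h" y] y by fastforce
qed

lemma heat_maximum_principle_abs:
  assumes hs: "heat_solution {a<..b} w"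
    and cw: "continuous_on ({a..b} \<times> {0..1}) (\<lambda>(t, x). w t x)"
    and init: "\<And>x. x \<in> {0..1} \<Longrightarrow> \<bar>w a x\<bar> \<le> M"
    and bdry: "\<And>t. t \<in> {a..b} \<Longrightarrow> \<bar>w t 0\<bar> \<le> M" "\<And>t. t \<in> {a..b} \<Longrightarrow> \<bar>w t 1\<bar> \<le> M"
    and tx: "t \<in> {a..b}" "x \<in> {0..1}"
  shows "\<bar>w t x\<bar> \<le> M"
proof -
  have "w t x \<le> M"
    by (rule heat_maximum_principle[OF hs cw _ _ _ tx])
      (rule abs_le_D1, (rule init bdry, assumption))+
  moreover have "- w t x \<le> M"
  proof (rule heat_maximum_principle[OF _ _ _ _ _ tx])
    show "heat_solution {a<..b} (\<lambda>t x. - w t x)"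
      using heat_solution_cmult[OF hs, of "-1"] by simp
    show "continuous_on ({a..b} \<times> {0..1}) (\<lambda>(t, x). - w t x)"
      using continuous_on_minus[OF cw] by (simp add: case_prod_unfold)
  qed (rule abs_le_D2, (rule init bdry, assumption))+
  ultimately show ?thesis by simp
qed

section \<open>The mode equations in integrated form\<close>

definition mode_law :: "real \<Rightarrow> real \<Rightarrow> nat \<Rightarrow> (real \<Rightarrow> real \<Rightarrow> real) \<Rightarrow> bool" where
  "mode_law a b j w \<longleftrightarrow> continuous_on ({a..b} \<times> {0..1}) (\<lambda>(t, x). w t x) \<and>
    (\<forall>t\<in>{a..b}. exp ((pi * real j)\<^sup>2 * t) * inner_L2 (w t) (phi j)
        - exp ((pi * real j)\<^sup>2 * a) * inner_L2 (w a) (phi j)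
      = - dphi1 j * integral {a..t} (\<lambda>s. exp ((pi * real j)\<^sup>2 * s) * w s 1))"

lemma continuous_on_slice_x:
  assumes "continuous_on (T \<times> X) (\<lambda>(t, x). w t x)" "t \<in> T"
  shows "continuous_on X (w t)"
proof -
  have "continuous_on X (\<lambda>x. (\<lambda>(t, x). w t x) (t, x))"
    by (rule continuous_on_compose2[OF assms(1)]) (use assms(2) in \<open>auto intro!: continuous_on_Pair\<close>)
  then show ?thesis by simp
qed

lemma continuous_on_slice_t:
  assumes "continuous_on (T \<times> X) (\<lambda>(t, x). w t x)" "x \<in> X"
  shows "continuous_on T (\<lambda>t. w t x)"
proof -
  have "continuous_on T (\<lambda>t. (\<lambda>(t, x). w t x) (t, x))"
    by (rule continuous_on_compose2[OF assms(1)]) (use assms(2) in \<open>auto intro!: continuous_on_Pair\<close>)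
  then show ?thesis by simp
qed

lemma mode_law_add:
  assumes v: "mode_law a b j v" and w: "mode_law a b j w"
  shows "mode_law a b j (\<lambda>t x. v t x + w t x)"
proof -
  define E where "E t = exp ((pi * real j)\<^sup>2 * t)" for t
  have c: "continuous_on ({a..b} \<times> {0..1}) (\<lambda>(t, x). v t x)" "continuous_on ({a..b} \<times> {0..1}) (\<lambda>(t, x). w t x)"
    using v w by (auto simp: mode_law_def)
  have law: "E t * inner_L2 (v t) (phi j) - E a * inner_L2 (v a) (phi j)
      = - dphi1 j * integral {a..t} (\<lambda>s. E s * v s 1)"
      "E t * inner_L2 (w t) (phi j) - E a * inner_L2 (w a) (phi j)
      = - dphi1 j * integral {a..t} (\<lambda>s. E s * w s 1)" if "t \<in> {a..b}" for t
    using v w that unfolding mode_law_def E_def by simp_all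
  have "continuous_on ({a..b} \<times> {0..1}) (\<lambda>(t, x). v t x + w t x)"
    using continuous_on_add[OF c] by (simp add: case_prod_unfold)
  moreover have "E t * inner_L2 (\<lambda>x. v t x + w t x) (phi j) - E a * inner_L2 (\<lambda>x. v a x + w a x) (phi j)
      = - dphi1 j * integral {a..t} (\<lambda>s. E s * (v s 1 + w s 1))"
    if t: "t \<in> {a..b}" for t
  proof -
    have a: "a \<in> {a..b}" using t by auto
    have sub: "{a..t} \<subseteq> {a..b}" using t by auto
    have add: "inner_L2 (\<lambda>x. v r x + w r x) (phi j) = inner_L2 (v r) (phi j) + inner_L2 (w r) (phi j)"
      if "r \<in> {a..b}" for r
      by (intro inner_L2_add_left L2_phi L2_continuous continuous_on_slice_x[OF c(1) that]
          continuous_on_slice_x[OF c(2) that])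
    have "continuous_on {a..t} (\<lambda>s. v s 1)" "continuous_on {a..t} (\<lambda>s. w s 1)"
      using continuous_on_subset[OF continuous_on_slice_t[OF c(1)] sub]
        continuous_on_subset[OF continuous_on_slice_t[OF c(2)] sub] by simp_all
    then have "(\<lambda>s. E s * v s 1) integrable_on {a..t}" "(\<lambda>s. E s * w s 1) integrable_on {a..t}"
      unfolding E_def by (auto intro!: integrable_continuous_real continuous_intros)
    then have "integral {a..t} (\<lambda>s. E s * (v s 1 + w s 1)) =
       integral {a..t} (\<lambda>s. E s * v s 1) + integral {a..t} (\<lambda>s. E s * w s 1)"
      unfolding distrib_left by (rule integral_add)
    then show ?thesis
      using law[OF t] unfolding add[OF t] add[OF a] by (simp add: distrib_left)
  qed
  ultimately show ?thesis unfolding mode_law_def E_def by (intro conjI ballI)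
qed

lemma mode_law_cmult:
  assumes w: "mode_law a b j w" shows "mode_law a b j (\<lambda>t x. c * w t x)"
proof -
  have cw: "continuous_on ({a..b} \<times> {0..1}) (\<lambda>(t, x). w t x)"
    using w by (auto simp: mode_law_def)
  have "continuous_on ({a..b} \<times> {0..1}) (\<lambda>(t, x). c * w t x)"
    using continuous_on_mult_left[OF cw, of c] by (simp add: case_prod_unfold)
  moreover have "exp ((pi * real j)\<^sup>2 * t) * inner_L2 (\<lambda>x. c * w t x) (phi j)
        - exp ((pi * real j)\<^sup>2 * a) * inner_L2 (\<lambda>x. c * w a x) (phi j)
      = - dphi1 j * integral {a..t} (\<lambda>s. exp ((pi * real j)\<^sup>2 * s) * (c * w s 1))"
    if t: "t \<in> {a..b}" for t
  proof -
    have "integral {a..t} (\<lambda>s. exp ((pi * real j)\<^sup>2 * s) * (c * w s 1))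
        = c * integral {a..t} (\<lambda>s. exp ((pi * real j)\<^sup>2 * s) * w s 1)"
      by (simp add: mult.left_commute)
    moreover have "exp ((pi * real j)\<^sup>2 * t) * inner_L2 (w t) (phi j)
        - exp ((pi * real j)\<^sup>2 * a) * inner_L2 (w a) (phi j)
      = - dphi1 j * integral {a..t} (\<lambda>s. exp ((pi * real j)\<^sup>2 * s) * w s 1)"
      using w t by (simp add: mode_law_def)
    ultimately show ?thesis
      unfolding inner_L2_cmult_left mult.left_commute[of _ c] right_diff_distrib[symmetric] by simp
  qed
  ultimately show ?thesis unfolding mode_law_def by (intro conjI ballI)
qed

lemma mode_law_zero: "mode_law a b j (\<lambda>t x. 0)"
  by (auto simp: mode_law_def case_prod_unfold inner_L2_eq)

lemma mode_law_sum:
  "(\<And>i. i \<in> S \<Longrightarrow> mode_law a b j (w i)) \<Longrightarrow> mode_law a b j (\<lambda>t x. \<Sum>i\<in>S. w i t x)"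
  by (induction S rule: infinite_finite_induct) (auto intro: mode_law_zero mode_law_add)

text \<open>Green's identity gives \<open>c * G + k * G = - dphi1 j * g 1\<close>, so the derivative
  of \<open>exp (k * s) * (exp (c * s) * G)\<close> is exactly the boundary integrand. Nothing is
  divided by \<open>c + k\<close>, so the resonant case \<open>c = - k\<close> is covered.\<close>

lemma mode_law_separated:
  assumes g: "\<And>x. (g has_real_derivative g' x) (at x)" "\<And>x. (g' has_real_derivative c * g x) (at x)"
    and g0: "g 0 = 0"
  shows "mode_law a b j (\<lambda>t x. exp (c * t) * g x)"
proof -
  define k where "k = (pi * real j)\<^sup>2"
  define G where "G = inner_L2 g (phi j)"
  have cg: "continuous_on S g" for S
    using g(1) by (meson DERIV_isCont continuous_at_imp_continuous_on)
  have "inner_L2 (\<lambda>x. c * g x) (phi j) = pi * real j * g 0 - dphi1 j * g 1 - k * G"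
    unfolding k_def G_def
    by (rule inner_L2_deriv2_phi[where g' = g'])
      (intro g[THEN has_field_derivative_at_within] continuous_on_mult_left cg)+
  then have G: "c * G = - dphi1 j * g 1 - k * G"
    by (simp add: inner_L2_cmult_left G_def g0)
  have "continuous_on ({a..b} \<times> {0..1}) (\<lambda>(t, x). exp (c * t) * g x)"
    unfolding case_prod_unfold
    by (intro continuous_intros continuous_on_compose2[OF cg[of UNIV]]) auto
  moreover have "exp (k * t) * (exp (c * t) * G) - exp (k * a) * (exp (c * a) * G)
      = - dphi1 j * integral {a..t} (\<lambda>s. exp (k * s) * (exp (c * s) * g 1))" if t: "t \<in> {a..b}" for t
  proof -
    have "((\<lambda>s. - dphi1 j * (exp (k * s) * (exp (c * s) * g 1))) has_integral
       exp (k * t) * (exp (c * t) * G) - exp (k * a) * (exp (c * a) * G)) {a..t}"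
    proof (rule fundamental_theorem_of_calculus)
      fix s
      have "((\<lambda>s. exp (k * s) * (exp (c * s) * G)) has_real_derivative
        exp (k * s) * exp (c * s) * (k * G + c * G)) (at s within {a..t})"
        by (rule derivative_eq_intros refl)+ (simp add: algebra_simps)
      then show "((\<lambda>s. exp (k * s) * (exp (c * s) * G)) has_vector_derivative
        - dphi1 j * (exp (k * s) * (exp (c * s) * g 1))) (at s within {a..t})"
        unfolding G has_real_derivative_iff_has_vector_derivative by (simp add: mult_ac)
    qed (use t in auto)
    from integral_unique[OF this] show ?thesis unfolding integral_mult_right by (rule sym)
  qed
  ultimately show ?thesis unfolding mode_law_def inner_L2_cmult_left k_def G_def by simp
qed

text \<open>The integrated law contains no derivative of \<open>w\<close>: its defect
  \<open>m w t\<close> is linear in \<open>w\<close> and bounded by a constant times the supremum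
  norm on the rectangle. It therefore passes to uniform limits, which a differential form would
  not.\<close>

lemma mode_law_uniform_limit:
  assumes cw: "continuous_on ({a..b} \<times> {0..1}) (\<lambda>(t, x). w t x)"
    and approx: "\<And>e. e > 0 \<Longrightarrow> \<exists>v. mode_law a b j v \<and> (\<forall>t\<in>{a..b}. \<forall>x\<in>{0..1}. \<bar>w t x - v t x\<bar> \<le> e)"
  shows "mode_law a b j w"
proof -
  define E where "E t = exp ((pi * real j)\<^sup>2 * t)" for t
  define m where "m u t = E t * inner_L2 (u t) (phi j) - E a * inner_L2 (u a) (phi j)
      + dphi1 j * integral {a..t} (\<lambda>s. E s * u s 1)" for u :: "real \<Rightarrow> real \<Rightarrow> real" and t
  have "m w t = 0" if t: "t \<in> {a..b}" for t
  proof -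
    \<comment> \<open>Two mode terms contribute at most \<open>E b * e\<close> each, the boundary
      integral at most its integrand bound times the length \<open>t - a\<close>.\<close>
    define K where "K = E b * (2 + \<bar>dphi1 j\<bar> * (t - a))"
    have Ele: "0 < E s" "E s \<le> E b" if "s \<in> {a..b}" for s
      using that by (auto simp: E_def intro!: mult_left_mono)
    have a: "a \<in> {a..b}" using t by auto
    have sub: "{a..t} \<subseteq> {a..b}" using t by auto
    have K: "K > 0" unfolding K_def using t Ele[OF a]
      by (intro mult_pos_pos add_pos_nonneg) auto
    have "\<bar>m w t\<bar> \<le> K * e" if e: "e > 0" for e
    proof -
      obtain v where v: "mode_law a b j v" and wv: "\<And>t x. t \<in> {a..b} \<Longrightarrow> x \<in> {0..1} \<Longrightarrow> \<bar>w t x - v t x\<bar> \<le> e"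
        using approx[OF e] by blast
      have cv: "continuous_on ({a..b} \<times> {0..1}) (\<lambda>(t, x). v t x)"
        using v by (simp add: mode_law_def)
      have mv: "m v t = 0" using v t by (auto simp: mode_law_def m_def E_def)
      have I: "\<bar>inner_L2 (w s) (phi j) - inner_L2 (v s) (phi j)\<bar> \<le> e" if s: "s \<in> {a..b}" for s
      proof -
        note L = continuous_on_slice_x[OF cw s, THEN L2_continuous] continuous_on_slice_x[OF cv s, THEN L2_continuous]
        have "\<bar>inner_L2 (\<lambda>x. w s x - v s x) (phi j)\<bar> \<le> norm_L2 (\<lambda>x. w s x - v s x)"
          by (intro abs_mode_le L2_diff L)
        also have "\<dots> \<le> e" by (rule norm_L2_le_sup) (rule wv[OF s])
        finally show ?thesis by (simp add: inner_L2_diff_left L)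
      qed
      have c1: "continuous_on {a..t} (\<lambda>s. w s 1)" "continuous_on {a..t} (\<lambda>s. v s 1)"
        using continuous_on_subset[OF continuous_on_slice_t[OF cw] sub]
          continuous_on_subset[OF continuous_on_slice_t[OF cv] sub] by simp_all
      then have i: "(\<lambda>s. E s * w s 1) integrable_on {a..t}" "(\<lambda>s. E s * v s 1) integrable_on {a..t}"
        unfolding E_def by (auto intro!: integrable_continuous_real continuous_intros)
      have "norm (integral {a..t} (\<lambda>s. E s * w s 1 - E s * v s 1)) \<le> E b * e * (t - a)"
      proof (rule integral_bound)
        show "continuous_on {a..t} (\<lambda>s. E s * w s 1 - E s * v s 1)"
          unfolding E_def by (intro continuous_intros c1)
        fix s assume s: "s \<in> {a..t}"
        then have s': "s \<in> {a..b}" using sub by auto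
        have "\<bar>E s * w s 1 - E s * v s 1\<bar> = E s * \<bar>w s 1 - v s 1\<bar>"
          using Ele[OF s'] by (simp add: abs_mult flip: right_diff_distrib)
        also have "\<dots> \<le> E b * e"
          using Ele[OF s'] wv[OF s', of 1] by (intro mult_mono) auto
        finally show "norm (E s * w s 1 - E s * v s 1) \<le> E b * e" by simp
      qed (use t in auto)
      then have J: "\<bar>integral {a..t} (\<lambda>s. E s * w s 1) - integral {a..t} (\<lambda>s. E s * v s 1)\<bar> \<le> E b * e * (t - a)"
        by (simp add: Henstock_Kurzweil_Integration.integral_diff[OF i])
      have "m w t - m v t = E t * (inner_L2 (w t) (phi j) - inner_L2 (v t) (phi j))
        - E a * (inner_L2 (w a) (phi j) - inner_L2 (v a) (phi j))
        + dphi1 j * (integral {a..t} (\<lambda>s. E s * w s 1) - integral {a..t} (\<lambda>s. E s * v s 1))"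
        unfolding m_def by (simp add: algebra_simps)
      also have "\<bar>\<dots>\<bar> \<le> E b * e + E b * e + \<bar>dphi1 j\<bar> * (E b * e * (t - a))"
        using Ele[OF t] Ele[OF a] I[OF t] I[OF a] J
        by (intro abs_triangle_ineq[THEN order_trans] abs_triangle_ineq4[THEN order_trans] add_mono)
          (auto simp: abs_mult intro!: mult_mono)
      also have "\<dots> = K * e" by (simp add: K_def algebra_simps)
      finally show ?thesis using mv by simp
    qed
    then have "\<bar>m w t\<bar> \<le> 0 + e" if "e > 0" for e
      using that K by (metis add_0 divide_pos_pos less_irrefl nonzero_mult_div_cancel_left times_divide_eq_right)
    then have "\<bar>m w t\<bar> \<le> 0" by (rule field_le_epsilon)
    then show ?thesis by simp
  qed
  then have "E t * inner_L2 (w t) (phi j) - E a * inner_L2 (w a) (phi j)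
      = - dphi1 j * integral {a..t} (\<lambda>s. E s * w s 1)" if "t \<in> {a..b}" for t
    using that unfolding m_def by (simp add: eq_neg_iff_add_eq_0)
  then show ?thesis unfolding mode_law_def using cw by (simp add: E_def)
qed

section \<open>Approximation of heat solutions by separated ones\<close>

lemma exp_poly_uniform_dense:
  fixes W :: "real \<Rightarrow> real"
  assumes cW: "continuous_on {a..b} W" and e: "e > 0"
  shows "\<exists>n c. \<forall>t\<in>{a..b}. \<bar>W t - (\<Sum>i\<le>n. c i * exp (real (Suc i) * t))\<bar> \<le> e"
proof -
  \<comment> \<open>In the variable \<open>y = exp t\<close> exponential sums are polynomials.
    Dividing by \<open>y\<close> here and multiplying by it at the end removes the constant term, so
    that all exponents \<open>Suc i\<close> are positive and the divisors
    \<open>sinh (sqrt (real (Suc i)))\<close> of the profiles are nonzero. The multiplication is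
    paid for by the tolerance \<open>e / exp b\<close>.\<close>
  have "continuous_on {exp a..exp b} (\<lambda>y. W (ln y) / y)"
  proof (intro continuous_intros continuous_on_compose2[OF cW])
    show "ln ` {exp a..exp b} \<subseteq> {a..b}"
    proof safe
      fix y assume y: "y \<in> {exp a..exp b}"
      then have "y > 0" by (meson atLeastAtMost_iff exp_gt_zero less_le_trans)
      then show "ln y \<in> {a..b}" using y by (auto simp: ln_ge_iff ln_le_cancel_iff[of y "exp b", simplified])
    qed
  qed (auto dest: less_le_trans[OF exp_gt_zero])
  then obtain p where p: "real_polynomial_function p"
      "\<And>y. y \<in> {exp a..exp b} \<Longrightarrow> \<bar>W (ln y) / y - p y\<bar> < e / exp b"
    using Stone_Weierstrass_real_polynomial_function[of "{exp a..exp b}" _ "e / exp b"] e by auto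
  from p(1) obtain c n where pc: "p = (\<lambda>x. \<Sum>i\<le>n. c i * x ^ i)"
    unfolding real_polynomial_function_iff_sum by auto
  have "\<bar>W t - (\<Sum>i\<le>n. c i * exp (real (Suc i) * t))\<bar> \<le> e" if t: "t \<in> {a..b}" for t
  proof -
    have "(\<Sum>i\<le>n. c i * exp (real (Suc i) * t)) = exp t * p (exp t)"
      unfolding pc sum_distrib_left
      by (intro sum.cong) (auto simp: exp_of_nat_mult[symmetric] distrib_right exp_add)
    then have "W t - (\<Sum>i\<le>n. c i * exp (real (Suc i) * t)) = exp t * (W (ln (exp t)) / exp t - p (exp t))"
      by (simp add: right_diff_distrib)
    also have "\<bar>\<dots>\<bar> \<le> exp b * (e / exp b)"
      unfolding abs_mult using t p(2)[of "exp t"] by (intro mult_mono) auto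
    finally show ?thesis by simp
  qed
  then show ?thesis by blast
qed

text \<open>The elementary solutions \<open>exp (k\<^sup>2 t) sinh (k x) / sinh k\<close> realise the boundary values
  \<open>exp (k\<^sup>2 t)\<close> at \<open>x = 1\<close>; unlike their trigonometric counterparts they are never resonant.\<close>

lemma heat_mode_law:
  assumes hs: "heat_solution {a<..b} w"
    and cw: "continuous_on ({a..b} \<times> {0..1}) (\<lambda>(t, x). w t x)"
    and w0: "\<And>t. t \<in> {a..b} \<Longrightarrow> w t 0 = 0"
    and ab: "a \<le> b"
  shows "mode_law a b j w"
proof (rule mode_law_uniform_limit[OF cw])
  fix e' :: real assume e': "e' > 0"
  \<comment> \<open>Two errors of size \<open>e\<close> add up at the initial time: the linear
    correction \<open>x * r 1\<close> and the sine approximation.\<close>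
  define e where "e = e' / 2"
  have e: "e > 0" using e' by (simp add: e_def)
  have a: "a \<in> {a..b}" using ab by simp
  have "continuous_on {a..b} (\<lambda>t. w t 1)"
    by (rule continuous_on_slice_t[OF cw]) simp
  then obtain n c where W: "\<And>t. t \<in> {a..b} \<Longrightarrow> \<bar>w t 1 - (\<Sum>i\<le>n. c i * exp (real (Suc i) * t))\<bar> \<le> e"
    using exp_poly_uniform_dense[OF _ e] by blast
  define g where "g i x = sinh (sqrt (real (Suc i)) * x) / sinh (sqrt (real (Suc i)))" for i x
  define g' where "g' i x = sqrt (real (Suc i)) * cosh (sqrt (real (Suc i)) * x) / sinh (sqrt (real (Suc i)))" for i x
  have g: "(g i has_real_derivative g' i x) (at x)" for i x
    unfolding g_def g'_def by (auto intro!: derivative_eq_intros)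
  have g': "(g' i has_real_derivative real (Suc i) * g i x) (at x)" for i x
  proof -
    have "(g' i has_real_derivative (sqrt (real (Suc i)) * sqrt (real (Suc i))) * g i x) (at x)"
      unfolding g_def g'_def by (auto intro!: derivative_eq_intros)
    then show ?thesis by simp
  qed
  have g0: "g i 0 = 0" and g1: "g i 1 = 1" for i by (auto simp: g_def)
  define E where "E t x = (\<Sum>i\<le>n. c i * (exp (real (Suc i) * t) * g i x))" for t x
  have Eh: "heat_solution {a<..b} E"
    unfolding E_def by (intro heat_solution_sum heat_solution_cmult heat_solution_separated[OF g g'])
  have Em: "mode_law a b j E"
    unfolding E_def by (intro mode_law_sum mode_law_cmult mode_law_separated[OF g g' g0])
  have Ec: "continuous_on ({a..b} \<times> {0..1}) (\<lambda>(t, x). E t x)"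
    using Em by (simp add: mode_law_def)
  define r where "r x = w a x - E a x" for x
  have r1: "\<bar>r 1\<bar> \<le> e" using W[OF a] by (simp add: r_def E_def g1)
  \<comment> \<open>Sine polynomials vanish at both end points, whereas \<open>r\<close> need not
    vanish at 1. As the boundary values are already matched up to \<open>e\<close>, subtracting the
    linear function \<open>x * r 1\<close> changes \<open>r\<close> by at most
    \<open>e\<close>.\<close>
  have "\<exists>s. sine_poly s \<and> (\<forall>x\<in>{0..1}. \<bar>(r x - x * r 1) - s x\<bar> \<le> e)"
  proof (rule sine_poly_uniform_dense[OF _ _ _ e])
    show "continuous_on {0..1} (\<lambda>x. r x - x * r 1)"
      unfolding r_def by (intro continuous_intros continuous_on_slice_x[OF cw a] continuous_on_slice_x[OF Ec a])
  qed (auto simp: r_def E_def g0 w0[OF a])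
  then obtain s where s: "sine_poly s" "\<And>x. x \<in> {0..1} \<Longrightarrow> \<bar>(r x - x * r 1) - s x\<bar> \<le> e" by blast
  obtain m d where sd: "\<And>x. s x = (\<Sum>i<m. d i * phi (Suc i) x)"
    using sine_poly_sum_form[OF s(1)] by blast
  define k where "k i = - ((pi * real (Suc i))\<^sup>2)" for i
  \<comment> \<open>The factor \<open>exp (- k i * a)\<close> shifts the initial time, so that
    \<open>S\<close> equals \<open>s\<close> at time \<open>a\<close>.\<close>
  define S where "S t x = (\<Sum>i<m. d i * exp (- k i * a) * (exp (k i * t) * phi (Suc i) x))" for t x
  have ph: "((\<lambda>x. pi * real (Suc i) * cos (pi * real (Suc i) * x)) has_real_derivative k i * phi (Suc i) x) (at x)" for i x
    unfolding phi_def k_def by (auto intro!: derivative_eq_intros simp: power2_eq_square)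
  have Sh: "heat_solution {a<..b} S"
    unfolding S_def by (intro heat_solution_sum heat_solution_cmult heat_solution_separated[OF phi_deriv ph])
  have Sm: "mode_law a b j S"
    unfolding S_def by (intro mode_law_sum mode_law_cmult mode_law_separated[OF phi_deriv ph phi_0])
  have Sc: "continuous_on ({a..b} \<times> {0..1}) (\<lambda>(t, x). S t x)"
    using Sm by (simp add: mode_law_def)
  have Sa: "S a x = s x" for x
    unfolding S_def sd by (intro sum.cong) (auto simp: mult.assoc simp flip: exp_add)
  have "\<bar>w t x - (E t x + S t x)\<bar> \<le> 2 * e" if tx: "t \<in> {a..b}" "x \<in> {0..1}" for t x
  proof (rule heat_maximum_principle_abs[OF _ _ _ _ _ tx])
    show "heat_solution {a<..b} (\<lambda>t x. w t x - (E t x + S t x))"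
      by (intro heat_solution_diff heat_solution_add hs Eh Sh)
    show "continuous_on ({a..b} \<times> {0..1}) (\<lambda>(t, x). w t x - (E t x + S t x))"
      using continuous_on_diff[OF cw continuous_on_add[OF Ec Sc]] by (simp add: case_prod_unfold)
    fix y :: real assume y: "y \<in> {0..1}"
    have "\<bar>y * r 1\<bar> \<le> 1 * e" unfolding abs_mult using y r1 by (intro mult_mono) auto
    then show "\<bar>w a y - (E a y + S a y)\<bar> \<le> 2 * e"
      using s(2)[OF y] unfolding Sa r_def by linarith
  next
    fix t assume t: "t \<in> {a..b}"
    show "\<bar>w t 0 - (E t 0 + S t 0)\<bar> \<le> 2 * e" using w0[OF t] e by (simp add: E_def S_def g0)
    show "\<bar>w t 1 - (E t 1 + S t 1)\<bar> \<le> 2 * e" using W[OF t] e by (simp add: E_def S_def g1)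
  qed
  then show "\<exists>v. mode_law a b j v \<and> (\<forall>t\<in>{a..b}. \<forall>x\<in>{0..1}. \<bar>w t x - v t x\<bar> \<le> e')"
    using mode_law_add[OF Em Sm] by (intro exI[of _ "\<lambda>t x. E t x + S t x"]) (simp add: e_def)
qed

text \<open>On \<open>[t / 2, 2 * t]\<close>, a compact neighbourhood of \<open>t\<close> away from
  time 0, the integrated law is solved for the mode; continuity of the boundary values then allows
  the integral to be differentiated.\<close>

lemma heat_mode_ODE:
  assumes hs: "heat_solution {0<..} w"
    and cw: "continuous_on ({0<..} \<times> {0..1}) (\<lambda>(t, x). w t x)"
    and w0: "\<And>t. t > 0 \<Longrightarrow> w t 0 = 0"
    and t: "t > 0"
  shows "((\<lambda>t. inner_L2 (w t) (phi j)) has_real_derivative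
      - ((pi * real j)\<^sup>2) * inner_L2 (w t) (phi j) - dphi1 j * w t 1) (at t)"
proof -
  define a b where "a = t / 2" and "b = 2 * t"
  have ab: "0 < a" "a < t" "t < b" using t by (auto simp: a_def b_def)
  define k where "k = (pi * real j)\<^sup>2"
  have sub: "{a..b} \<subseteq> {0<..}" using ab by auto
  have cw': "continuous_on ({a..b} \<times> {0..1}) (\<lambda>(t, x). w t x)"
    by (rule continuous_on_subset[OF cw]) (use sub in auto)
  have "mode_law a b j w"
    by (rule heat_mode_law[OF heat_solution_subset[OF hs] cw' w0]) (use ab in auto)
  then have law: "exp (k * s) * inner_L2 (w s) (phi j) =
      exp (k * a) * inner_L2 (w a) (phi j) - dphi1 j * integral {a..s} (\<lambda>s. exp (k * s) * w s 1)"
    if "s \<in> {a..b}" for s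
    using that unfolding mode_law_def k_def by (auto simp: algebra_simps)
  have rep: "inner_L2 (w s) (phi j) = exp (- k * s) *
      (exp (k * a) * inner_L2 (w a) (phi j) - dphi1 j * integral {a..s} (\<lambda>s. exp (k * s) * w s 1))"
    if "s \<in> {a..b}" for s
    unfolding law[OF that, symmetric] by (simp add: mult.assoc[symmetric] flip: exp_add)
  have "continuous_on {a..b} (\<lambda>s. exp (k * s) * w s 1)"
    using continuous_on_slice_t[OF cw', of 1] by (intro continuous_intros) auto
  then have "((\<lambda>s. integral {a..s} (\<lambda>s. exp (k * s) * w s 1)) has_real_derivative exp (k * t) * w t 1) (at t within {a..b})"
    using ab by (intro integral_has_real_derivative) auto
  then have I: "((\<lambda>s. integral {a..s} (\<lambda>s. exp (k * s) * w s 1)) has_real_derivative exp (k * t) * w t 1) (at t)"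
    using ab by (simp add: at_within_Icc_at)
  define R where "R s = exp (- k * s) *
      (exp (k * a) * inner_L2 (w a) (phi j) - dphi1 j * integral {a..s} (\<lambda>s. exp (k * s) * w s 1))" for s
  have "(R has_real_derivative - k * R t - dphi1 j * (exp (- k * t) * exp (k * t) * w t 1)) (at t)"
    unfolding R_def by (rule derivative_eq_intros I refl)+ (simp add: algebra_simps)
  then have dR: "(R has_real_derivative - k * inner_L2 (w t) (phi j) - dphi1 j * w t 1) (at t)"
    using rep[of t] ab by (simp add: R_def flip: exp_add)
  show ?thesis unfolding k_def[symmetric]
  proof (rule has_field_derivative_transform_within_open[OF dR, of "{a<..<b}"])
    show "R s = inner_L2 (w s) (phi j)" if "s \<in> {a<..<b}" for s
      using rep[of s] that by (simp add: R_def)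
  qed (use ab in auto)
qed

section \<open>Construction of heat solutions\<close>

lemma exp_neg_le_inverse_square: "y > 0 \<Longrightarrow> exp (- y) \<le> 2 / y\<^sup>2" for y :: real
proof -
  assume y: "y > 0"
  have "y\<^sup>2 / 2 \<le> exp y" using exp_lower_Taylor_quadratic[of y] y by simp
  then have "inverse (exp y) \<le> inverse (y\<^sup>2 / 2)" using y by (intro le_imp_inverse_le) auto
  then show ?thesis by (simp add: exp_minus)
qed

text \<open>Boundedness is all that is asked of the coefficients: for \<open>t > 0\<close> the
  exponential factor makes the series and its derivatives converge.\<close>

locale sine_series =
  fixes c :: "nat \<Rightarrow> real" and K :: real
  assumes c_bound: "\<And>j. \<bar>c j\<bar> \<le> K"
begin

definition freq :: "nat \<Rightarrow> real" where
  "freq j = pi * real (Suc j)"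

definition v :: "real \<Rightarrow> real \<Rightarrow> real" where
  "v t x = (\<Sum>j. c j * (exp (- ((freq j)\<^sup>2) * t) * sin (freq j * x)))"

definition majorant :: "real \<Rightarrow> nat \<Rightarrow> real" where
  "majorant d j = K * (2 / (d\<^sup>2 * pi\<^sup>2)) * (1 / (real (Suc j))\<^sup>2)"

lemma freq_ge_1: "freq j \<ge> 1"
proof -
  have "1 * 1 \<le> pi * real (Suc j)" using pi_gt3 by (intro mult_mono) auto
  then show ?thesis by (simp add: freq_def)
qed

lemma summable_majorant: "summable (majorant d)"
proof -
  have "summable (\<lambda>j. 1 / (real (Suc j))\<^sup>2)"
    using inverse_power_summable[of 2, where 'a = real]
    by (subst summable_Suc_iff) (simp add: inverse_eq_divide)
  then show ?thesis unfolding majorant_def by (rule summable_mult)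
qed

lemma K_nonneg: "K \<ge> 0" using c_bound[of 0] by auto

text \<open>The bound \<open>2 / y^2\<close> for \<open>exp (- y)\<close> at
  \<open>y = (freq j)^2 * d\<close>, multiplied by \<open>(freq j)^2\<close>, leaves
  \<open>2 / (d^2 * (freq j)^2)\<close>. Because \<open>freq j \<ge> 1\<close>, this single majorant
  serves the series and all its derivatives up to \<open>m = 2\<close>.\<close>

lemma term_bound:
  assumes d: "d > 0" and t: "t \<ge> d" and m: "m \<le> 2" and s: "\<bar>s\<bar> \<le> 1"
  shows "norm (c j * (exp (- ((freq j)\<^sup>2) * t) * ((freq j) ^ m * s))) \<le> majorant d j"
proof -
  have f: "freq j > 0" using freq_ge_1[of j] by simp
  have "exp (- ((freq j)\<^sup>2) * t) \<le> exp (- ((freq j)\<^sup>2 * d))"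
    using t by (simp add: mult_left_mono)
  also have "\<dots> \<le> 2 / ((freq j)\<^sup>2 * d)\<^sup>2"
    using d f by (intro exp_neg_le_inverse_square) auto
  finally have 1: "exp (- ((freq j)\<^sup>2) * t) \<le> 2 / ((freq j)\<^sup>2 * d)\<^sup>2" .
  have "\<bar>(freq j) ^ m * s\<bar> \<le> (freq j)\<^sup>2 * 1"
    unfolding abs_mult using f freq_ge_1[of j] s m
    by (intro mult_mono) (auto simp: power_abs intro!: power_increasing)
  then have "norm (c j * (exp (- ((freq j)\<^sup>2) * t) * ((freq j) ^ m * s)))
      \<le> K * (2 / ((freq j)\<^sup>2 * d)\<^sup>2 * ((freq j)\<^sup>2 * 1))"
    unfolding real_norm_def abs_mult[of "c j"] abs_mult[of "exp _"] using c_bound[of j] 1 f d K_nonneg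
    by (intro mult_mono) auto
  also have "\<dots> = K * (2 / (d\<^sup>2 * (freq j)\<^sup>2))"
    using f d by (simp add: field_simps power2_eq_square)
  also have "\<dots> = majorant d j"
    by (simp only: majorant_def freq_def power_mult_distrib times_divide_eq_right times_divide_eq_left
        mult.assoc divide_divide_eq_left mult_1_right)
  finally show ?thesis .
qed

lemma term_bound_0:
  assumes "d > 0" "t \<ge> d"
  shows "norm (c j * (exp (- ((freq j)\<^sup>2) * t) * sin (freq j * x))) \<le> majorant d j"
  using term_bound[OF assms, of 0 "sin (freq j * x)" j] by simp

lemma summable_term: "t > 0 \<Longrightarrow> summable (\<lambda>j. c j * (exp (- ((freq j)\<^sup>2) * t) * sin (freq j * x)))"
  by (rule summable_comparison_test'[OF summable_majorant[of t], of 0]) (rule term_bound_0, auto)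

definition vx :: "real \<Rightarrow> real \<Rightarrow> real" where
  "vx t x = (\<Sum>j. c j * (exp (- ((freq j)\<^sup>2) * t) * (freq j * cos (freq j * x))))"

definition vt :: "real \<Rightarrow> real \<Rightarrow> real" where
  "vt t x = (\<Sum>j. c j * (exp (- ((freq j)\<^sup>2) * t) * (- ((freq j)\<^sup>2) * sin (freq j * x))))"

lemma summable_term_x: "t > 0 \<Longrightarrow> summable (\<lambda>j. c j * (exp (- ((freq j)\<^sup>2) * t) * (freq j * cos (freq j * x))))"
proof (rule summable_comparison_test'[OF summable_majorant[of t], of 0])
  fix j assume "t > 0"
  then show "norm (c j * (exp (- ((freq j)\<^sup>2) * t) * (freq j * cos (freq j * x)))) \<le> majorant t j"
    using term_bound[of t t 1 "cos (freq j * x)" j] by simp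
qed

lemma v_deriv_x:
  assumes t: "t > 0" shows "(v t has_real_derivative vx t x) (at x)"
  unfolding v_def[abs_def] vx_def
proof (rule has_field_derivative_series'(2)[where S = UNIV and ?x0.0 = 0])
  fix n x
  show "((\<lambda>x. c n * (exp (- ((freq n)\<^sup>2) * t) * sin (freq n * x))) has_real_derivative
      c n * (exp (- ((freq n)\<^sup>2) * t) * (freq n * cos (freq n * x)))) (at x within UNIV)"
    by (auto intro!: derivative_eq_intros)
next
  show "uniformly_convergent_on UNIV (\<lambda>n x. \<Sum>j<n. c j * (exp (- ((freq j)\<^sup>2) * t) * (freq j * cos (freq j * x))))"
  proof (rule Weierstrass_m_test'[OF _ summable_majorant[of t]])
    show "norm (c n * (exp (- ((freq n)\<^sup>2) * t) * (freq n * cos (freq n * x)))) \<le> majorant t n" for n x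
      using term_bound[OF t, of t 1 "cos (freq n * x)" n] by simp
  qed
qed (use summable_term[OF t] in auto)

lemma vx_deriv_x:
  assumes t: "t > 0" shows "(vx t has_real_derivative vt t x) (at x)"
  unfolding vx_def[abs_def] vt_def
proof (rule has_field_derivative_series'(2)[where S = UNIV and ?x0.0 = 0])
  fix n x
  show "((\<lambda>x. c n * (exp (- ((freq n)\<^sup>2) * t) * (freq n * cos (freq n * x)))) has_real_derivative
      c n * (exp (- ((freq n)\<^sup>2) * t) * (- ((freq n)\<^sup>2) * sin (freq n * x)))) (at x within UNIV)"
    by (auto intro!: derivative_eq_intros simp: power2_eq_square)
next
  show "uniformly_convergent_on UNIV (\<lambda>n x. \<Sum>j<n. c j * (exp (- ((freq j)\<^sup>2) * t) * (- ((freq j)\<^sup>2) * sin (freq j * x))))"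
  proof (rule Weierstrass_m_test'[OF _ summable_majorant[of t]])
    show "norm (c n * (exp (- ((freq n)\<^sup>2) * t) * (- ((freq n)\<^sup>2) * sin (freq n * x)))) \<le> majorant t n" for n x
      using term_bound[OF t, of t 2 "sin (freq n * x)" n] by (simp add: norm_mult)
  qed
qed (use summable_term_x[OF t, of 0] in auto)

lemma v_deriv_t:
  assumes t: "t > 0" shows "((\<lambda>t. v t x) has_real_derivative vt t x) (at t)"
  unfolding v_def vt_def
\<comment> \<open>The majorant needs a positive lower bound of the times; \<open>{t/2..}\<close> is
  a neighbourhood of \<open>t\<close> with such a bound.\<close>
proof (rule has_field_derivative_series'(2)[where S = "{t/2..}" and ?x0.0 = t])
  fix n s
  show "((\<lambda>s. c n * (exp (- ((freq n)\<^sup>2) * s) * sin (freq n * x))) has_real_derivative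
      c n * (exp (- ((freq n)\<^sup>2) * s) * (- ((freq n)\<^sup>2) * sin (freq n * x)))) (at s within {t/2..})"
    by (auto intro!: derivative_eq_intros)
next
  show "uniformly_convergent_on {t/2..} (\<lambda>n s. \<Sum>j<n. c j * (exp (- ((freq j)\<^sup>2) * s) * (- ((freq j)\<^sup>2) * sin (freq j * x))))"
  proof (rule Weierstrass_m_test'[OF _ summable_majorant[of "t/2"]])
    show "norm (c n * (exp (- ((freq n)\<^sup>2) * s) * (- ((freq n)\<^sup>2) * sin (freq n * x)))) \<le> majorant (t/2) n"
      if "s \<in> {t/2..}" for n s
      using term_bound[of "t/2" s 2 "sin (freq n * x)" n] that t by (simp add: norm_mult)
  qed
qed (use summable_term[OF t] t in \<open>auto simp: interior_Ici\<close>)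

lemma heat_solution_v: "heat_solution {0<..} v"
  by (rule heat_solutionI[where wx = vx and D = vt])
    (simp add: heat_derivs_def v_deriv_x vx_deriv_x v_deriv_t)

lemma continuous_on_v: "continuous_on ({0<..} \<times> S) (\<lambda>(t, x). v t x)"
proof -
  have "continuous_on ({d<..} \<times> UNIV) (\<lambda>p. v (fst p) (snd p))" if d: "d > 0" for d
    unfolding v_def
  proof (rule uniform_limit_theorem)
    show "uniform_limit ({d<..} \<times> UNIV)
        (\<lambda>n p. \<Sum>j<n. c j * (exp (- ((freq j)\<^sup>2) * fst p) * sin (freq j * snd p)))
        (\<lambda>p. \<Sum>j. c j * (exp (- ((freq j)\<^sup>2) * fst p) * sin (freq j * snd p))) sequentially"
      by (rule Weierstrass_m_test[OF _ summable_majorant[of d]]) (intro term_bound_0 d, auto)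
  qed (auto intro!: always_eventually continuous_intros)
  then have "continuous_on (\<Union>d\<in>{0<..}. {d<..} \<times> (UNIV :: real set)) (\<lambda>p. v (fst p) (snd p))"
    by (intro continuous_on_open_UN) (auto intro: open_Times)
  moreover have "{0::real<..} \<times> S \<subseteq> (\<Union>d\<in>{0<..}. {d<..} \<times> (UNIV :: real set))"
  proof
    fix p :: "real \<times> real" assume "p \<in> {0<..} \<times> S"
    then have "p \<in> {fst p / 2<..} \<times> UNIV" "fst p / 2 \<in> {0<..}" by auto
    then show "p \<in> (\<Union>d\<in>{0<..}. {d<..} \<times> (UNIV :: real set))" by blast
  qed
  ultimately show ?thesis unfolding case_prod_unfold by (rule continuous_on_subset)
qed

lemma v_boundary: "v t 0 = 0" "v t 1 = 0"
proof -
  show "v t 0 = 0" by (simp add: v_def)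
  have "sin (freq j * 1) = 0" for j
    using sin_npi2[of "Suc j"] by (simp only: freq_def mult_1_right)
  then show "v t 1 = 0" unfolding v_def by (simp only: mult_zero_right suminf_zero)
qed

text \<open>At a fixed positive time the series converges uniformly in \<open>x\<close>, so its
  modes are the limits of those of the partial sums, which orthogonality makes eventually
  constant.\<close>

lemma v_mode:
  assumes t: "t > 0"
  shows "inner_L2 (v t) (phi (Suc i)) = c i * exp (- ((freq i)\<^sup>2) * t) / 2"
proof -
  define p where "p n x = (\<Sum>j<n. c j * (exp (- ((freq j)\<^sup>2) * t) * sin (freq j * x)))" for n x
  have u: "uniform_limit UNIV p (v t) sequentially"
    unfolding p_def v_def[abs_def]
    by (rule Weierstrass_m_test[OF _ summable_majorant[of t]]) (intro term_bound_0 t order_refl)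
  have vc: "continuous_on {0..1} (v t)"
    using v_deriv_x[OF t] by (meson DERIV_isCont continuous_at_imp_continuous_on)
  have pL: "L2 (p n)" for n unfolding p_def by (intro L2_continuous continuous_intros)
  have "(\<lambda>n. inner_L2 (p n) (phi (Suc i))) \<longlonglongrightarrow> inner_L2 (v t) (phi (Suc i))"
  proof (rule LIMSEQ_I)
    fix r :: real assume r: "r > 0"
    then have "r / 2 > 0" by simp
    then obtain n0 where n0: "\<And>n x. n \<ge> n0 \<Longrightarrow> dist (p n x) (v t x) < r / 2"
      using u unfolding uniform_limit_iff eventually_sequentially by blast
    have "norm (inner_L2 (p n) (phi (Suc i)) - inner_L2 (v t) (phi (Suc i))) < r" if n: "n \<ge> n0" for n
    proof -
      have "\<bar>inner_L2 (\<lambda>x. p n x - v t x) (phi (Suc i))\<bar> \<le> norm_L2 (\<lambda>x. p n x - v t x)"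
        by (intro abs_mode_le L2_diff pL L2_continuous vc)
      also have "\<dots> \<le> r / 2"
        by (rule norm_L2_le_sup) (use n0[OF n] in \<open>auto simp: dist_real_def less_imp_le\<close>)
      finally show ?thesis using r by (simp add: inner_L2_diff_left pL L2_continuous vc)
    qed
    then show "\<exists>n0. \<forall>n\<ge>n0. norm (inner_L2 (p n) (phi (Suc i)) - inner_L2 (v t) (phi (Suc i))) < r" by blast
  qed
  moreover have "(\<lambda>n. inner_L2 (p n) (phi (Suc i))) \<longlonglongrightarrow> c i * exp (- ((freq i)\<^sup>2) * t) / 2"
  proof (rule tendsto_eventually)
    have "inner_L2 (p n) (phi (Suc i)) = c i * exp (- ((freq i)\<^sup>2) * t) / 2" if n: "n > i" for n
    proof -
      have "p n = (\<lambda>x. \<Sum>j<n. (c j * exp (- ((freq j)\<^sup>2) * t)) * phi (Suc j) x)"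
        by (simp add: p_def phi_def freq_def fun_eq_iff mult.assoc)
      then have "inner_L2 (p n) (phi (Suc i)) = (\<Sum>j<n. (c j * exp (- ((freq j)\<^sup>2) * t)) * inner_L2 (phi (Suc j)) (phi (Suc i)))"
        by (simp only:) (subst inner_L2_sum_left, auto simp: L2_cmult inner_L2_cmult_left simp del: mult.assoc)
      also have "\<dots> = (\<Sum>j<n. if j = i then c i * exp (- ((freq i)\<^sup>2) * t) / 2 else 0)"
        by (intro sum.cong) (auto simp: inner_phi_phi)
      finally show ?thesis using n by simp
    qed
    then show "\<forall>\<^sub>F n in sequentially. inner_L2 (p n) (phi (Suc i)) = c i * exp (- ((freq i)\<^sup>2) * t) / 2"
      unfolding eventually_sequentially by (intro exI[of _ "Suc i"]) auto
  qed
  ultimately show ?thesis by (rule LIMSEQ_unique)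
qed

end

section \<open>Heat solutions with zero and with exponential boundary values\<close>

lemma homogeneous_heat_solution:
  assumes f: "L2 f"
  shows "\<exists>v. heat_solution {0<..} v \<and> continuous_on ({0<..} \<times> {0..1}) (\<lambda>(t, x). v t x) \<and>
    (\<forall>t. v t 0 = 0 \<and> v t 1 = 0) \<and> ((\<lambda>t. norm_L2 (\<lambda>x. v t x - f x)) \<longlongrightarrow> 0) (at_right 0)"
proof -
  define m where "m j = inner_L2 f (phi (Suc j))" for j
  \<comment> \<open>The sine coefficient is twice the mode because
    \<open>inner_L2 (phi j) (phi j)\<close> is \<open>1/2\<close>.\<close>
  interpret sine_series "\<lambda>j. 2 * m j" "2 * norm_L2 f"
    by unfold_locales (use abs_mode_le[OF f] in \<open>auto simp: m_def abs_mult\<close>)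
  have vL: "L2 (v t)" if "t > 0" for t
    using that by (intro L2_continuous continuous_on_slice_x[OF continuous_on_v[of "{0..1}"]]) auto
  have sq: "summable (\<lambda>j. (m j)\<^sup>2)"
    using Parseval_sine[OF f] by (auto simp: m_def sums_iff)
  \<comment> \<open>The squared mode of \<open>v t - f\<close>. It is dominated by the summable
    \<open>(m j)^2\<close> uniformly for \<open>t \<ge> 0\<close>, so the sum over \<open>j\<close>
    is continuous down to \<open>t = 0\<close>, where it vanishes.\<close>
  define q where "q t j = (m j)\<^sup>2 * (exp (- ((freq j)\<^sup>2) * t) - 1)\<^sup>2" for t j
  have qs: "(norm_L2 (\<lambda>x. v t x - f x))\<^sup>2 = 2 * (\<Sum>j. q t j)" if t: "t > 0" for t
  proof -
    have "inner_L2 (\<lambda>x. v t x - f x) (phi (Suc j)) = m j * (exp (- ((freq j)\<^sup>2) * t) - 1)" for j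
      using v_mode[OF t, of j] by (simp add: inner_L2_diff_left vL[OF t] f right_diff_distrib m_def[symmetric])
    then have "(\<lambda>j. q t j) sums ((norm_L2 (\<lambda>x. v t x - f x))\<^sup>2 / 2)"
      using Parseval_sine[OF L2_diff[OF vL[OF t] f]] by (simp add: q_def power_mult_distrib)
    then show ?thesis by (simp add: sums_iff)
  qed
  have qle: "norm (q t j) \<le> (m j)\<^sup>2" if "t \<ge> 0" for t j
  proof -
    have "\<bar>exp (- ((freq j)\<^sup>2) * t) - 1\<bar> \<le> 1" using that by (simp add: abs_le_iff)
    then have "(exp (- ((freq j)\<^sup>2) * t) - 1)\<^sup>2 \<le> 1" by (rule abs_square_le_1[THEN iffD2])
    then show ?thesis unfolding q_def by (simp add: abs_mult mult_left_le)
  qed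
  have "uniform_limit {0..} (\<lambda>n t. \<Sum>j<n. q t j) (\<lambda>t. \<Sum>j. q t j) sequentially"
    by (rule Weierstrass_m_test[OF _ sq]) (use qle in auto)
  then have "continuous_on {0..} (\<lambda>t. \<Sum>j. q t j)"
    by (rule uniform_limit_theorem[rotated])
      (auto intro!: always_eventually continuous_intros simp: q_def)
  then have "((\<lambda>t. \<Sum>j. q t j) \<longlongrightarrow> (\<Sum>j. q 0 j)) (at_right 0)"
    unfolding continuous_on_def by (auto intro: tendsto_within_subset)
  then have "((\<lambda>t. sqrt (2 * (\<Sum>j. q t j))) \<longlongrightarrow> sqrt (2 * (\<Sum>j. q 0 j))) (at_right 0)"
    by (intro tendsto_intros)
  then have "((\<lambda>t. sqrt (2 * (\<Sum>j. q t j))) \<longlongrightarrow> 0) (at_right 0)"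
    by (simp add: q_def)
  then have "((\<lambda>t. norm_L2 (\<lambda>x. v t x - f x)) \<longlongrightarrow> 0) (at_right 0)"
    by (rule Lim_transform_eventually)
      (auto simp: eventually_at_right_less eventually_at_filter qs[symmetric] norm_L2_nonneg)
  then show ?thesis
    using heat_solution_v continuous_on_v[of "{0..1}"] v_boundary by blast
qed

text \<open>The profile \<open>sin (k * x) / sin k\<close> fails when \<open>sin k = 0\<close>. This
  cannot be excluded: \<open>k^2\<close> will be \<open>\<gamma> l + \<alpha>\<close> for a channel
  \<open>l\<close>, and that may coincide with \<open>(pi * j)^2\<close> for some
  \<open>j > N\<close>. The replacement is the derivative of
  \<open>exp (- k^2 * t) * sin (k * x)\<close> with respect to \<open>k\<close>, divided by
  \<open>cos k\<close>; its term growing in \<open>t\<close> vanishes at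
  \<open>x = 1\<close>.\<close>

lemma exponential_boundary_heat_solution:
  fixes k :: real
  assumes k: "k > 0"
  shows "\<exists>h. heat_solution {0<..} h \<and> continuous_on UNIV (\<lambda>(t, x). h t x) \<and>
    (\<forall>t. h t 0 = 0 \<and> h t 1 = exp (- (k\<^sup>2) * t))"
proof (cases "sin k = 0")
  case False
  define h where "h t x = exp (- (k\<^sup>2) * t) * (sin (k * x) / sin k)" for t x
  have "heat_solution {0<..} h" unfolding h_def
    by (rule heat_solution_separated[where g' = "\<lambda>x. k * cos (k * x) / sin k"])
      (auto intro!: derivative_eq_intros simp: False power2_eq_square)
  moreover have "continuous_on UNIV (\<lambda>(t, x). h t x)"
    unfolding h_def case_prod_unfold by (intro continuous_intros) (auto simp: False)
  moreover have "\<forall>t. h t 0 = 0 \<and> h t 1 = exp (- (k\<^sup>2) * t)" using False by (simp add: h_def)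
  ultimately show ?thesis by blast
next
  case True
  \<comment> \<open>Resonance: \<open>k\<^sup>2\<close> is a Dirichlet eigenvalue, and a secular term is needed.\<close>
  then have ck: "cos k \<noteq> 0" using sin_cos_squared_add[of k] by auto
  define h where "h t x = exp (- (k\<^sup>2) * t) * ((x * cos (k * x) - 2 * k * t * sin (k * x)) / cos k)" for t x
  have "heat_derivs {0<..} h
    (\<lambda>t x. exp (- (k\<^sup>2) * t) * ((cos (k * x) - k * x * sin (k * x) - 2 * k\<^sup>2 * t * cos (k * x)) / cos k))
    (\<lambda>t x. exp (- (k\<^sup>2) * t) * ((- 2 * k * sin (k * x) - k\<^sup>2 * x * cos (k * x) + 2 * k^3 * t * sin (k * x)) / cos k))"
    unfolding heat_derivs_def h_def using ck
    by (auto intro!: derivative_eq_intros simp: power2_eq_square power3_eq_cube field_simps)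
  then have "heat_solution {0<..} h" by (rule heat_solutionI)
  moreover have "continuous_on UNIV (\<lambda>(t, x). h t x)"
    unfolding h_def case_prod_unfold by (intro continuous_intros) (auto simp: ck)
  moreover have "\<forall>t. h t 0 = 0 \<and> h t 1 = exp (- (k\<^sup>2) * t)" using ck True by (simp add: h_def)
  ultimately show ?thesis by blast
qed

section \<open>The feedback law\<close>

text \<open>\<open>P\<close> is the numerator of the sum of the \<open>c i / (z - y i)\<close> over
  the common denominator. Its degree is below \<open>card I\<close>, yet every \<open>x k\<close> is
  a root, so it is zero; at \<open>z = y i\<close> all summands but one vanish, which isolates
  \<open>c i\<close>.\<close>

lemma Cauchy_matrix_independent:
  fixes x :: "'k \<Rightarrow> real" and y :: "'i \<Rightarrow> real"
  assumes fin: "finite I" "finite K" and card: "card I \<le> card K"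
    and inj: "inj_on x K" "inj_on y I"
    and ne: "\<And>k i. k \<in> K \<Longrightarrow> i \<in> I \<Longrightarrow> x k \<noteq> y i"
    and zero: "\<And>k. k \<in> K \<Longrightarrow> (\<Sum>i\<in>I. c i / (x k - y i)) = 0"
    and i: "i \<in> I"
  shows "c i = 0"
proof -
  define P where "P = (\<Sum>i\<in>I. Polynomial.smult (c i) (\<Prod>l\<in>I - {i}. [:- y l, 1:]))"
  have cI: "card I > 0" using fin i by (auto simp: card_gt_0_iff)
  have "degree P \<le> card I - 1"
    unfolding P_def
  proof (rule degree_sum_le[OF fin(1)])
    fix i assume "i \<in> I"
    have "degree (Polynomial.smult (c i) (\<Prod>l\<in>I - {i}. [:- y l, 1:])) \<le> degree (\<Prod>l\<in>I - {i}. [:- y l, 1:])"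
      by (rule degree_smult_le)
    also have "\<dots> \<le> (\<Sum>l\<in>I - {i}. degree [:- y l, 1:])"
      using degree_prod_sum_le[of "I - {i}" "\<lambda>l. [:- y l, 1:]"] fin by (simp add: o_def)
    also have "\<dots> = card I - 1" using fin \<open>i \<in> I\<close> by (simp add: card_Diff_singleton)
    finally show "degree (Polynomial.smult (c i) (\<Prod>l\<in>I - {i}. [:- y l, 1:])) \<le> card I - 1" .
  qed
  then have deg: "degree P < card I" using cI by simp
  have root: "poly P (x k) = 0" if k: "k \<in> K" for k
  proof -
    have "poly P (x k) = (\<Sum>i\<in>I. c i * (\<Prod>l\<in>I - {i}. x k - y l))"
      by (simp add: P_def poly_sum poly_prod)
    also have "\<dots> = (\<Sum>i\<in>I. c i / (x k - y i) * (\<Prod>l\<in>I. x k - y l))"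
    proof (rule sum.cong[OF refl])
      fix i assume "i \<in> I"
      then show "c i * (\<Prod>l\<in>I - {i}. x k - y l) = c i / (x k - y i) * (\<Prod>l\<in>I. x k - y l)"
        using ne[OF k] fin by (subst prod.remove[of I i]) auto
    qed
    also have "\<dots> = 0" using zero[OF k] unfolding sum_distrib_right[symmetric] by simp
    finally show ?thesis .
  qed
  have "P = 0"
  proof (rule ccontr)
    assume P: "P \<noteq> 0"
    have "card K = card (x ` K)" using inj by (simp add: card_image)
    also have "\<dots> \<le> card {z. poly P z = 0}"
      using root P by (intro card_mono poly_roots_finite) auto
    also have "\<dots> \<le> degree P" using P by (rule card_poly_roots_bound)
    finally show False using deg card by simp
  qed
  have "poly P (y i) = (\<Sum>m\<in>I. c m * (\<Prod>l\<in>I - {m}. y i - y l))"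
    by (simp add: P_def poly_sum poly_prod)
  also have "\<dots> = (\<Sum>m\<in>I. if m = i then c i * (\<Prod>l\<in>I - {i}. y i - y l) else 0)"
    using fin i by (intro sum.cong) (auto simp: prod_zero_iff)
  also have "\<dots> = c i * (\<Prod>l\<in>I - {i}. y i - y l)" using fin i by simp
  finally have "c i * (\<Prod>l\<in>I - {i}. y i - y l) = 0" using \<open>P = 0\<close> by simp
  moreover have "(\<Prod>l\<in>I - {i}. y i - y l) \<noteq> 0"
    using inj(2) fin i by (auto simp: prod_zero_iff inj_on_def)
  ultimately show ?thesis by simp
qed

text \<open>The vectors \<open>\<Lambda>\<^bsub>\<gamma>\<^sub>k\<^esub> b\<close> with \<open>b = (\<phi>\<^sub>i'(1))\<close>: they are the columns of a scaled Cauchy matrix, the sum of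
  their dyads is the matrix inverted by \<open>B\<close>, and \<open>F\<^sub>k(u)\<close> is the \<open>k\<close>-th coordinate of the mode
  vector of \<open>u\<close> in the basis they form.\<close>

definition feedback_dir :: "real \<Rightarrow> (nat \<Rightarrow> real) \<Rightarrow> nat \<Rightarrow> nat \<Rightarrow> real" where
  "feedback_dir \<alpha> \<gamma> k i = dphi1 i / (\<gamma> k - lam \<alpha> i)"

section \<open>Entries of the feedback matrices\<close>

lemma Bk_carrier [simp]: "Bk \<alpha> N \<gamma> k \<in> carrier_mat N N"
  unfolding Bk_def Lam_gamma_def B0_def by (intro mult_carrier_mat) auto

text \<open>\<open>B0\<close> is the dyad of the vector of the \<open>dphi1\<close>, and scaling by
  the diagonal matrix on both sides gives the dyad of the scaled vector.\<close>

lemma Bk_index: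
  assumes i: "i < N" and j: "j < N"
  shows "Bk \<alpha> N \<gamma> k $$ (i, j) = feedback_dir \<alpha> \<gamma> k (Suc i) * feedback_dir \<alpha> \<gamma> k (Suc j)"
proof -
  have LB: "(Lam_gamma \<alpha> N (\<gamma> k) * B0 N) $$ (i, l) = feedback_dir \<alpha> \<gamma> k (Suc i) * dphi1 (Suc l)" if l: "l < N" for l
  proof -
    have "(Lam_gamma \<alpha> N (\<gamma> k) * B0 N) $$ (i, l) =
        (\<Sum>m = 0..<N. (if i = m then 1 / (\<gamma> k - lam \<alpha> (i + 1)) else 0) * (dphi1 (m + 1) * dphi1 (l + 1)))"
      using i l by (simp add: Lam_gamma_def B0_def scalar_prod_def)
    also have "\<dots> = (\<Sum>m = 0..<N. if m = i then feedback_dir \<alpha> \<gamma> k (Suc i) * dphi1 (Suc l) else 0)"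
      by (intro sum.cong) (auto simp: feedback_dir_def)
    finally show ?thesis using i by simp
  qed
  have "Bk \<alpha> N \<gamma> k $$ (i, j) = (\<Sum>l = 0..<N. (Lam_gamma \<alpha> N (\<gamma> k) * B0 N) $$ (i, l) * Lam_gamma \<alpha> N (\<gamma> k) $$ (l, j))"
    unfolding Bk_def using i j
    by (subst index_mult_mat) (auto simp: Lam_gamma_def B0_def scalar_prod_def)
  also have "\<dots> = (\<Sum>l = 0..<N. if l = j then feedback_dir \<alpha> \<gamma> k (Suc i) * feedback_dir \<alpha> \<gamma> k (Suc j) else 0)"
    using j by (intro sum.cong) (auto simp: LB, simp_all add: Lam_gamma_def feedback_dir_def)
  finally show ?thesis using j by simp
qed

lemma foldr_mat_sum:
  assumes "\<And>x. x \<in> set xs \<Longrightarrow> f x \<in> carrier_mat n n"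
  shows "foldr (+) (map f xs) (0\<^sub>m n n :: real mat) \<in> carrier_mat n n \<and>
    (\<forall>i<n. \<forall>j<n. foldr (+) (map f xs) (0\<^sub>m n n) $$ (i, j) = (\<Sum>x\<leftarrow>xs. f x $$ (i, j)))"
  using assms by (induction xs) auto

lemma Bsum_carrier: "Bsum \<alpha> N \<gamma> \<in> carrier_mat N N"
  unfolding Bsum_def using foldr_mat_sum[of "[1..<N+1]" "Bk \<alpha> N \<gamma>" N] by simp

lemma Bsum_index:
  assumes "i < N" "j < N"
  shows "Bsum \<alpha> N \<gamma> $$ (i, j) = (\<Sum>k=1..N. feedback_dir \<alpha> \<gamma> k (Suc i) * feedback_dir \<alpha> \<gamma> k (Suc j))"
proof -
  have "Bsum \<alpha> N \<gamma> $$ (i, j) = (\<Sum>k\<leftarrow>[1..<N+1]. Bk \<alpha> N \<gamma> k $$ (i, j))"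
    unfolding Bsum_def using foldr_mat_sum[of "[1..<N+1]" "Bk \<alpha> N \<gamma>" N] assms by simp
  also have "\<dots> = (\<Sum>k=1..N. Bk \<alpha> N \<gamma> k $$ (i, j))"
    by (simp only: sum_list_distinct_conv_sum_set[OF distinct_upt] set_upt Suc_eq_plus1[symmetric] atLeastLessThanSuc_atLeastAtMost)
  finally show ?thesis using assms by (simp add: Bk_index)
qed

text \<open>With \<open>D\<close> the matrix whose columns are the directions, this is the
  factorisation of \<open>Bsum\<close> as \<open>D\<close> times its transpose.\<close>

lemma Bsum_mult_vec_index:
  assumes y: "y \<in> carrier_vec N" and i: "i < N"
  shows "(Bsum \<alpha> N \<gamma> *\<^sub>v y) $ i =
    (\<Sum>k=1..N. feedback_dir \<alpha> \<gamma> k (Suc i) * (\<Sum>j<N. feedback_dir \<alpha> \<gamma> k (Suc j) * y $ j))"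
proof -
  have "(Bsum \<alpha> N \<gamma> *\<^sub>v y) $ i = (\<Sum>j<N. Bsum \<alpha> N \<gamma> $$ (i, j) * y $ j)"
    using i y Bsum_carrier[of \<alpha> N \<gamma>] by (auto simp: scalar_prod_def lessThan_atLeast0)
  also have "\<dots> = (\<Sum>j<N. \<Sum>k=1..N. feedback_dir \<alpha> \<gamma> k (Suc i) * (feedback_dir \<alpha> \<gamma> k (Suc j) * y $ j))"
    using i by (intro sum.cong) (auto simp: Bsum_index sum_distrib_right mult.assoc)
  also have "\<dots> = (\<Sum>k=1..N. \<Sum>j<N. feedback_dir \<alpha> \<gamma> k (Suc i) * (feedback_dir \<alpha> \<gamma> k (Suc j) * y $ j))"
    by (rule sum.swap)
  finally show ?thesis by (simp add: sum_distrib_left)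
qed

section \<open>Invertibility and the coordinates of the mode vector\<close>

locale feedback =
  fixes \<alpha> :: real and N :: nat and \<gamma> :: "nat \<Rightarrow> real"
  assumes gap: "\<And>k i. k \<in> {1..N} \<Longrightarrow> i \<in> {1..N} \<Longrightarrow> lam \<alpha> i < \<gamma> k"
    and inj_gamma: "inj_on \<gamma> {1..N}"
begin

lemma inj_lam: "inj_on (lam \<alpha>) {1..N}"
  by (auto simp: inj_on_def lam_def)

text \<open>The factors \<open>dphi1 i\<close> are absorbed into the coefficients, which leaves a
  Cauchy system evaluated at the \<open>\<gamma> k\<close> with poles
  \<open>lam \<alpha> i\<close>.\<close>

lemma feedback_dir_independent_modes:
  assumes "\<And>k. k \<in> {1..N} \<Longrightarrow> (\<Sum>i=1..N. feedback_dir \<alpha> \<gamma> k i * y i) = 0" and i: "i \<in> {1..N}"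
  shows "y i = 0"
proof -
  have "dphi1 i * y i = 0"
  proof (rule Cauchy_matrix_independent[where I = "{1..N}" and K = "{1..N}" and x = \<gamma> and y = "lam \<alpha>"
        and c = "\<lambda>i. dphi1 i * y i"])
    show "\<gamma> k \<noteq> lam \<alpha> i" if "k \<in> {1..N}" "i \<in> {1..N}" for k i using gap[OF that] by simp
    show "(\<Sum>i=1..N. dphi1 i * y i / (\<gamma> k - lam \<alpha> i)) = 0" if "k \<in> {1..N}" for k
      using assms(1)[OF that] by (simp add: feedback_dir_def)
  qed (use inj_gamma inj_lam i in auto)
  then show ?thesis using dphi1_nonzero[of i] i by simp
qed

text \<open>The transposed system: the nonzero factor \<open>dphi1 i\<close> is common to a whole
  equation and cancels, and evaluation points and poles change places at the price of a
  sign.\<close>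

lemma feedback_dir_independent_channels:
  assumes "\<And>i. i \<in> {1..N} \<Longrightarrow> (\<Sum>k=1..N. feedback_dir \<alpha> \<gamma> k i * c k) = 0" and k: "k \<in> {1..N}"
  shows "c k = 0"
proof (rule Cauchy_matrix_independent[where I = "{1..N}" and K = "{1..N}" and x = "lam \<alpha>" and y = \<gamma>])
  show "lam \<alpha> i \<noteq> \<gamma> k" if "i \<in> {1..N}" "k \<in> {1..N}" for i k using gap[OF that(2,1)] by simp
  show "(\<Sum>k=1..N. c k / (lam \<alpha> i - \<gamma> k)) = 0" if i: "i \<in> {1..N}" for i
  proof -
    have "(\<Sum>k=1..N. feedback_dir \<alpha> \<gamma> k i * c k) = - dphi1 i * (\<Sum>k=1..N. c k / (lam \<alpha> i - \<gamma> k))"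
      unfolding sum_distrib_left
    proof (rule sum.cong[OF refl])
      fix k assume "k \<in> {1..N}"
      then have "\<gamma> k - lam \<alpha> i \<noteq> 0" "lam \<alpha> i - \<gamma> k \<noteq> 0" using gap[OF _ i, of k] by auto
      then show "feedback_dir \<alpha> \<gamma> k i * c k = - dphi1 i * (c k / (lam \<alpha> i - \<gamma> k))"
        by (simp add: feedback_dir_def field_simps)
    qed
    then show ?thesis using assms(1)[OF i] dphi1_nonzero[of i] i by simp
  qed
qed (use inj_gamma inj_lam k in auto)

text \<open>\<open>Bsum\<close> factors through the coordinates \<open>s k\<close>: independence of
  the channels gives \<open>s k = 0\<close>, and independence of the modes then gives
  \<open>y = 0\<close>.\<close>

lemma Bsum_kernel:
  assumes y: "y \<in> carrier_vec N" and z: "Bsum \<alpha> N \<gamma> *\<^sub>v y = 0\<^sub>v N"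
  shows "y = 0\<^sub>v N"
proof -
  define s where "s k = (\<Sum>j<N. feedback_dir \<alpha> \<gamma> k (Suc j) * y $ j)" for k
  have 0: "(\<Sum>k=1..N. feedback_dir \<alpha> \<gamma> k (Suc i) * s k) = 0" if i: "i < N" for i
    using Bsum_mult_vec_index[OF y i, of \<alpha> \<gamma>] z i by (simp add: s_def)
  have s0: "s k = 0" if "k \<in> {1..N}" for k
  proof (rule feedback_dir_independent_channels[OF _ that])
    show "(\<Sum>k=1..N. feedback_dir \<alpha> \<gamma> k i * s k) = 0" if "i \<in> {1..N}" for i
      using 0[of "i - 1"] that by auto
  qed
  have "y $ (i - 1) = 0" if i: "i \<in> {1..N}" for i
  proof (rule feedback_dir_independent_modes[OF _ i])
    fix k assume "k \<in> {1..N}"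
    then show "(\<Sum>i=1..N. feedback_dir \<alpha> \<gamma> k i * y $ (i - 1)) = 0"
      using s0[of k] by (simp add: s_def sum.atLeast1_atMost_eq)
  qed
  from this[of "Suc i" for i] have "y $ i = 0" if "i < N" for i using that by simp
  then show ?thesis using y by (intro eq_vecI) auto
qed

text \<open>\<open>Bmat\<close> is a definite description, so it has to be shown that a right
  inverse exists and is unique: existence comes from the nonzero determinant, uniqueness from the
  inverse being two-sided.\<close>

lemma Bmat_inverse: "Bmat \<alpha> N \<gamma> \<in> carrier_mat N N" "Bsum \<alpha> N \<gamma> * Bmat \<alpha> N \<gamma> = 1\<^sub>m N"
proof -
  let ?A = "Bsum \<alpha> N \<gamma>"
  have A: "?A \<in> carrier_mat N N" by (rule Bsum_carrier)
  have "det ?A \<noteq> 0"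
  proof
    assume "det ?A = 0"
    then obtain y where "y \<in> carrier_vec N" "y \<noteq> 0\<^sub>v N" "?A *\<^sub>v y = 0\<^sub>v N"
      unfolding det_0_iff_vec_prod_zero[OF A] by auto
    then show False using Bsum_kernel by simp
  qed
  then have "?A \<in> Units (ring_mat TYPE(real) N ())" by (rule det_non_zero_imp_unit[OF A])
  then obtain X where X: "X \<in> carrier_mat N N" "?A * X = 1\<^sub>m N" "X * ?A = 1\<^sub>m N"
    by (auto simp: Units_def ring_mat_simps)
  have uniq: "Y = X" if Y: "Y \<in> carrier_mat N N" "?A * Y = 1\<^sub>m N" for Y
  proof -
    have "Y = (X * ?A) * Y" using X Y by simp
    also have "\<dots> = X * (?A * Y)" by (rule assoc_mult_mat[OF X(1) A Y(1)])
    finally show ?thesis using X Y by simp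
  qed
  have "Bmat \<alpha> N \<gamma> = X"
    unfolding Bmat_def by (rule the_equality, intro conjI X(1,2)) (elim conjE, rule uniq)
  then show "Bmat \<alpha> N \<gamma> \<in> carrier_mat N N" "?A * Bmat \<alpha> N \<gamma> = 1\<^sub>m N" using X by auto
qed

lemma Fk_eq:
  "Fk \<alpha> N \<gamma> k u = (\<Sum>j<N. feedback_dir \<alpha> \<gamma> k (Suc j) * (Bmat \<alpha> N \<gamma> *\<^sub>v vec N (\<lambda>i. inner_L2 u (phi (i+1)))) $ j)"
  unfolding Fk_def scalar_prod_def by (simp add: feedback_dir_def lessThan_atLeast0 mult.commute)

text \<open>Expanding \<open>Bsum * (Bmat * z)\<close>, which equals \<open>z\<close>, into dyads:
  the coefficient of the \<open>k\<close>-th direction is its scalar product with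
  \<open>Bmat * z\<close>, and that is \<open>Fk\<close>.\<close>

lemma mode_eq_sum_Fk:
  assumes i: "i \<in> {1..N}"
  shows "inner_L2 u (phi i) = (\<Sum>k=1..N. feedback_dir \<alpha> \<gamma> k i * Fk \<alpha> N \<gamma> k u)"
proof -
  define z where "z = vec N (\<lambda>i. inner_L2 u (phi (i+1)))"
  define y where "y = Bmat \<alpha> N \<gamma> *\<^sub>v z"
  have z: "z \<in> carrier_vec N" by (simp add: z_def)
  have y: "y \<in> carrier_vec N" using Bmat_inverse(1) z by (simp add: y_def)
  have "Bsum \<alpha> N \<gamma> *\<^sub>v y = (Bsum \<alpha> N \<gamma> * Bmat \<alpha> N \<gamma>) *\<^sub>v z"
    unfolding y_def using assoc_mult_mat_vec[OF Bsum_carrier Bmat_inverse(1) z] by simp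
  then have "Bsum \<alpha> N \<gamma> *\<^sub>v y = z" using Bmat_inverse(2) z by simp
  then have "z $ (i - 1) = (\<Sum>k=1..N. feedback_dir \<alpha> \<gamma> k i * (\<Sum>j<N. feedback_dir \<alpha> \<gamma> k (Suc j) * y $ j))"
    using Bsum_mult_vec_index[OF y, of "i - 1" \<alpha> \<gamma>] i by auto
  moreover have "z $ (i - 1) = inner_L2 u (phi i)" using i by (auto simp: z_def)
  ultimately show ?thesis by (simp add: Fk_eq y_def z_def)
qed

text \<open>The channels as explicit functionals of the first \<open>N\<close> modes, which makes
  them bounded and differentiable along solutions. Modes are counted from 1 and matrix columns from
  0, hence \<open>i - 1\<close>.\<close>

definition coef :: "nat \<Rightarrow> nat \<Rightarrow> real" where
  "coef k i = (\<Sum>j<N. feedback_dir \<alpha> \<gamma> k (Suc j) * Bmat \<alpha> N \<gamma> $$ (j, i - 1))"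

lemma Fk_linear: "Fk \<alpha> N \<gamma> k u = (\<Sum>i=1..N. coef k i * inner_L2 u (phi i))"
proof -
  have "Fk \<alpha> N \<gamma> k u = (\<Sum>j<N. \<Sum>i<N. feedback_dir \<alpha> \<gamma> k (Suc j) * Bmat \<alpha> N \<gamma> $$ (j, i) * inner_L2 u (phi (Suc i)))"
    unfolding Fk_eq using Bmat_inverse(1)
    by (intro sum.cong) (auto simp: scalar_prod_def sum_distrib_left lessThan_atLeast0 mult.assoc)
  also have "\<dots> = (\<Sum>i<N. \<Sum>j<N. feedback_dir \<alpha> \<gamma> k (Suc j) * Bmat \<alpha> N \<gamma> $$ (j, i) * inner_L2 u (phi (Suc i)))"
    by (rule sum.swap)
  also have "\<dots> = (\<Sum>i=1..N. coef k i * inner_L2 u (phi i))"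
    by (simp add: coef_def sum.atLeast1_atMost_eq sum_distrib_right)
  finally show ?thesis .
qed

lemma Fk_bound:
  assumes "L2 u"
  shows "\<bar>Fk \<alpha> N \<gamma> k u\<bar> \<le> (\<Sum>i=1..N. \<bar>coef k i\<bar>) * norm_L2 u"
proof -
  have "\<bar>Fk \<alpha> N \<gamma> k u\<bar> \<le> (\<Sum>i=1..N. \<bar>coef k i * inner_L2 u (phi i)\<bar>)"
    unfolding Fk_linear by (rule sum_abs)
  also have "\<dots> \<le> (\<Sum>i=1..N. \<bar>coef k i\<bar> * norm_L2 u)"
    using abs_mode_le[OF assms] by (intro sum_mono) (auto simp: abs_mult intro!: mult_left_mono)
  finally show ?thesis by (simp add: sum_distrib_right)
qed

end

section \<open>Decay of closed-loop solutions\<close>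

lemma linear_ODE_unique:
  fixes f :: "real \<Rightarrow> real"
  assumes f: "\<And>t. t > 0 \<Longrightarrow> (f has_real_derivative - c * f t) (at t)" and "a > 0" "t > 0"
  shows "f t = f a * exp (- c * (t - a))"
proof -
  have "((\<lambda>t. f t * exp (c * t)) has_real_derivative 0) (at t within {0<..})" if "t \<in> {0<..}" for t
  proof -
    have "((\<lambda>t. f t * exp (c * t)) has_real_derivative - c * f t * exp (c * t) + exp (c * t) * c * f t) (at t)"
      using that by (auto intro!: derivative_eq_intros f)
    then show ?thesis by (simp add: has_field_derivative_at_within)
  qed
  then obtain k where k: "\<And>t. t \<in> {0<..} \<Longrightarrow> f t * exp (c * t) = k"
    using has_field_derivative_zero_constant[of "{0<..}" "\<lambda>t. f t * exp (c * t)"] by auto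
  have "f t * exp (c * t) = f a * exp (c * a)" using k[of t] k[of a] assms by simp
  then have "f t * exp (c * t) * exp (- (c * t)) = f a * exp (c * a) * exp (- (c * t))" by simp
  then show ?thesis by (simp add: mult.assoc right_diff_distrib flip: exp_add)
qed

text \<open>After multiplication by the integrating factor the forcing is at most
  \<open>R * exp ((l - m) * (s - a))\<close>, with antiderivative \<open>R / (l - m)\<close> times
  the same exponential. Subtracting it gives a nonincreasing \<open>G\<close>; the strict inequality
  \<open>m < l\<close> is what keeps the constant free of \<open>t\<close>.\<close>

lemma forced_decay_upper:
  fixes f B :: "real \<Rightarrow> real"
  assumes f: "\<And>t. t \<ge> a \<Longrightarrow> (f has_real_derivative - l * f t - B t) (at t)"
    and B: "\<And>t. t \<ge> a \<Longrightarrow> \<bar>B t\<bar> \<le> R * exp (- m * (t - a))"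
    and m: "m < l" and t: "t \<ge> a"
  shows "f t \<le> exp (- m * (t - a)) * (\<bar>f a\<bar> + R / (l - m))"
proof -
  have expo: "exp ((l - m) * r) = exp (l * r) * exp (- m * r)" for r
    by (simp add: mult_exp_exp left_diff_distrib)
  define G where "G s = exp (l * (s - a)) * f s - R / (l - m) * exp ((l - m) * (s - a))" for s
  have "G t \<le> G a"
  proof (rule DERIV_nonpos_imp_nonincreasing[OF t])
    fix s assume s: "a \<le> s" "s \<le> t"
    have "(G has_real_derivative (exp (l * (s - a)) * l) * f s + exp (l * (s - a)) * (- l * f s - B s)
        - R / (l - m) * (exp ((l - m) * (s - a)) * (l - m))) (at s)"
      unfolding G_def by (auto intro!: derivative_eq_intros f[OF s(1)])
    moreover have "R / (l - m) * (exp ((l - m) * (s - a)) * (l - m)) = R * exp ((l - m) * (s - a))"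
      using m by simp
    moreover have "(exp (l * (s - a)) * l) * f s + exp (l * (s - a)) * (- l * f s - B s) = exp (l * (s - a)) * (- B s)"
      by (simp add: algebra_simps)
    moreover have "exp (l * (s - a)) * (- B s) \<le> exp (l * (s - a)) * (R * exp (- m * (s - a)))"
      using B[OF s(1)] by (intro mult_left_mono) auto
    moreover have "exp (l * (s - a)) * (R * exp (- m * (s - a))) = R * exp ((l - m) * (s - a))"
      unfolding expo by simp
    ultimately show "\<exists>y. (G has_real_derivative y) (at s) \<and> y \<le> 0"
      by (intro exI conjI) (assumption, linarith)
  qed
  then have 1: "exp (l * (t - a)) * f t \<le> f a - R / (l - m) + R / (l - m) * exp ((l - m) * (t - a))"
    by (simp add: G_def)
  have R: "R / (l - m) \<ge> 0" using B[of a] m by simp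
  have "1 \<le> exp ((l - m) * (t - a))" using m t by simp
  then have "\<bar>f a\<bar> * 1 \<le> \<bar>f a\<bar> * exp ((l - m) * (t - a))" by (intro mult_left_mono) auto
  then have "exp (l * (t - a)) * f t \<le> exp ((l - m) * (t - a)) * (\<bar>f a\<bar> + R / (l - m))"
    using 1 R by (simp add: algebra_simps)
  also have "\<dots> = exp (l * (t - a)) * (exp (- m * (t - a)) * (\<bar>f a\<bar> + R / (l - m)))"
    unfolding expo by (simp only: mult.assoc)
  finally show ?thesis by simp
qed

lemma forced_decay:
  fixes f B :: "real \<Rightarrow> real"
  assumes f: "\<And>t. t \<ge> a \<Longrightarrow> (f has_real_derivative - l * f t - B t) (at t)"
    and B: "\<And>t. t \<ge> a \<Longrightarrow> \<bar>B t\<bar> \<le> R * exp (- m * (t - a))"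
    and m: "m < l" and t: "t \<ge> a"
  shows "\<bar>f t\<bar> \<le> exp (- m * (t - a)) * (\<bar>f a\<bar> + R / (l - m))"
proof -
  have "- f t \<le> exp (- m * (t - a)) * (\<bar>- f a\<bar> + R / (l - m))"
  proof (rule forced_decay_upper[where f = "\<lambda>t. - f t" and B = "\<lambda>t. - B t"])
    show "((\<lambda>t. - f t) has_real_derivative - l * - f t - - B t) (at t)" if "t \<ge> a" for t
      using DERIV_minus[OF f[OF that]] by (simp add: add.commute)
  qed (use B m t in auto)
  then show ?thesis using forced_decay_upper[OF f B m t] by (simp add: abs_le_iff)
qed

section \<open>The closed loop in modes and channels\<close>

lemma closed_loop_heat:
  assumes u: "closed_loop_solution \<alpha> F u0 u"
  shows "heat_solution {0<..} (\<lambda>t x. exp (- \<alpha> * t) * u t x)"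
\<comment> \<open>The exponential factor removes the term with \<open>\<alpha>\<close>. The second
  space derivative of a solution is only asserted to exist, so it is named as an iterated
  \<open>deriv\<close>.\<close>
proof (rule heat_solutionI[where wx = "\<lambda>t x. exp (- \<alpha> * t) * deriv (u t) x"
      and D = "\<lambda>t x. exp (- \<alpha> * t) * deriv (deriv (u t)) x"])
  show "heat_derivs {0<..} (\<lambda>t x. exp (- \<alpha> * t) * u t x) (\<lambda>t x. exp (- \<alpha> * t) * deriv (u t) x)
     (\<lambda>t x. exp (- \<alpha> * t) * deriv (deriv (u t)) x)"
    unfolding heat_derivs_def
  proof (intro ballI)
    fix t x :: real assume "t \<in> {0<..}" and x: "x \<in> {0<..<1}"
    then have t: "t > 0" by simp
    have ux: "(u t has_real_derivative deriv (u t) x) (at x)"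
      using u t x unfolding closed_loop_solution_def by blast
    obtain ut uxx where d: "((\<lambda>s. u s x) has_real_derivative ut) (at t)"
      "(deriv (u t) has_real_derivative uxx) (at x)" "ut - uxx - \<alpha> * u t x = 0"
      using u t x unfolding closed_loop_solution_def by blast
    have D: "deriv (deriv (u t)) x = uxx" using d(2) by (rule DERIV_imp_deriv)
    have ut: "ut = uxx + \<alpha> * u t x" using d(3) by simp
    have "((\<lambda>s. exp (- \<alpha> * s) * u s x) has_real_derivative exp (- \<alpha> * t) * (- \<alpha>) * u t x + exp (- \<alpha> * t) * ut) (at t)"
      by (auto intro!: derivative_eq_intros d(1))
    then have "((\<lambda>s. exp (- \<alpha> * s) * u s x) has_real_derivative exp (- \<alpha> * t) * uxx) (at t)"
      unfolding ut by (simp add: algebra_simps)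
    then show "((\<lambda>x. exp (- \<alpha> * t) * u t x) has_real_derivative exp (- \<alpha> * t) * deriv (u t) x) (at x) \<and>
       ((\<lambda>s. exp (- \<alpha> * s) * u s x) has_real_derivative exp (- \<alpha> * t) * deriv (deriv (u t)) x) (at t) \<and>
       ((\<lambda>x. exp (- \<alpha> * t) * deriv (u t) x) has_real_derivative exp (- \<alpha> * t) * deriv (deriv (u t)) x) (at x)"
      unfolding D using DERIV_cmult[OF ux] DERIV_cmult[OF d(2)] by auto
  qed
qed

lemma closed_loop_mode_ODE:
  assumes u: "closed_loop_solution \<alpha> F u0 u" and t: "t > 0"
  shows "((\<lambda>t. inner_L2 (u t) (phi j)) has_real_derivative
      - lam \<alpha> j * inner_L2 (u t) (phi j) - dphi1 j * u t 1) (at t)"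
proof -
  define w where "w t x = exp (- \<alpha> * t) * u t x" for t x
  have cu: "continuous_on ({0<..} \<times> {0..1}) (\<lambda>(t, x). u t x)" and u0: "\<And>t. t > 0 \<Longrightarrow> u t 0 = 0"
    using u unfolding closed_loop_solution_def by auto
  have "continuous_on ({0<..} \<times> {0..1}) (\<lambda>p. exp (- \<alpha> * fst p) * (\<lambda>(t, x). u t x) p)"
    by (intro continuous_intros cu)
  then have cw: "continuous_on ({0<..} \<times> {0..1}) (\<lambda>(t, x). w t x)"
    unfolding w_def by (simp add: case_prod_unfold)
  have "heat_solution {0<..} w" unfolding w_def by (rule closed_loop_heat[OF u])
  have w0: "w s 0 = 0" if "s > 0" for s using u0[OF that] by (simp add: w_def)
  have d: "((\<lambda>t. inner_L2 (w t) (phi j)) has_real_derivative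
      - ((pi * real j)\<^sup>2) * inner_L2 (w t) (phi j) - dphi1 j * w t 1) (at t)"
    by (rule heat_mode_ODE[OF \<open>heat_solution {0<..} w\<close> cw w0 t])
  have e: "inner_L2 (u s) (phi j) = exp (\<alpha> * s) * inner_L2 (w s) (phi j)" for s
  proof -
    have "inner_L2 (w s) (phi j) = exp (- \<alpha> * s) * inner_L2 (u s) (phi j)"
      unfolding w_def by (rule inner_L2_cmult_left)
    then show ?thesis by (simp add: mult.assoc[symmetric] flip: exp_add)
  qed
  have u1: "u t 1 = exp (\<alpha> * t) * w t 1"
    unfolding w_def by (simp add: mult.assoc[symmetric] flip: exp_add)
  have "((\<lambda>t. exp (\<alpha> * t) * inner_L2 (w t) (phi j)) has_real_derivative
      exp (\<alpha> * t) * \<alpha> * inner_L2 (w t) (phi j) +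
      exp (\<alpha> * t) * (- ((pi * real j)\<^sup>2) * inner_L2 (w t) (phi j) - dphi1 j * w t 1)) (at t)"
    by (auto intro!: derivative_eq_intros d)
  moreover have "exp (\<alpha> * t) * \<alpha> * inner_L2 (w t) (phi j) +
      exp (\<alpha> * t) * (- ((pi * real j)\<^sup>2) * inner_L2 (w t) (phi j) - dphi1 j * w t 1)
    = - lam \<alpha> j * (exp (\<alpha> * t) * inner_L2 (w t) (phi j)) - dphi1 j * (exp (\<alpha> * t) * w t 1)"
    by (simp add: lam_def algebra_simps)
  ultimately show ?thesis unfolding e u1 by simp
qed

lemma closed_loop_L2: "closed_loop_solution \<alpha> F u0 u \<Longrightarrow> t > 0 \<Longrightarrow> L2 (u t)"
  unfolding closed_loop_solution_def
  by (intro L2_continuous continuous_on_slice_x[of "{0<..}" _ u]) auto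

context feedback
begin

text \<open>The derivative \<open>s'\<close> is never evaluated through \<open>coef\<close>:
  differentiating the expansion of a mode in the channels and comparing it with the mode equation
  gives one linear relation per mode, and independence of the directions separates the
  channels.\<close>

lemma Fk_closed_loop:
  assumes u: "closed_loop_solution \<alpha> (Ffb \<alpha> N \<gamma>) u0 u" and a: "a > 0" and t: "t > 0" and k: "k \<in> {1..N}"
  shows "Fk \<alpha> N \<gamma> k (u t) = Fk \<alpha> N \<gamma> k (u a) * exp (- \<gamma> k * (t - a))"
proof (rule linear_ODE_unique[OF _ a t])
  fix t :: real assume t: "t > 0"
  define z where "z i = inner_L2 (u t) (phi i)" for i
  define z' where "z' i = - lam \<alpha> i * z i - dphi1 i * u t 1" for i
  define s where "s k = Fk \<alpha> N \<gamma> k (u t)" for k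
  define s' where "s' k = (\<Sum>i=1..N. coef k i * z' i)" for k
  have dz: "((\<lambda>t. inner_L2 (u t) (phi i)) has_real_derivative z' i) (at t)" for i
    unfolding z'_def z_def by (rule closed_loop_mode_ODE[OF u t])
  have ds: "((\<lambda>t. Fk \<alpha> N \<gamma> k (u t)) has_real_derivative s' k) (at t)" for k
    unfolding Fk_linear s'_def by (intro DERIV_sum DERIV_cmult dz)
  have U: "u t 1 = (\<Sum>k=1..N. s k)"
    using u t unfolding closed_loop_solution_def Ffb_def s_def by simp
  have zs: "z i = (\<Sum>k=1..N. feedback_dir \<alpha> \<gamma> k i * s k)" if "i \<in> {1..N}" for i
    unfolding z_def s_def by (rule mode_eq_sum_Fk[OF that])
  have "s' k + \<gamma> k * s k = 0"
  proof (rule feedback_dir_independent_channels[OF _ k])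
    fix i assume i: "i \<in> {1..N}"
    have "((\<lambda>t. \<Sum>k=1..N. feedback_dir \<alpha> \<gamma> k i * Fk \<alpha> N \<gamma> k (u t)) has_real_derivative (\<Sum>k=1..N. feedback_dir \<alpha> \<gamma> k i * s' k)) (at t)"
      by (intro DERIV_sum DERIV_cmult ds)
    then have "(\<Sum>k=1..N. feedback_dir \<alpha> \<gamma> k i * s' k) = z' i"
      using dz[of i] unfolding mode_eq_sum_Fk[OF i] by (rule DERIV_unique)
    moreover have "(\<Sum>k=1..N. feedback_dir \<alpha> \<gamma> k i * (\<gamma> k * s k)) = (\<Sum>k=1..N. lam \<alpha> i * (feedback_dir \<alpha> \<gamma> k i * s k) + dphi1 i * s k)"
    proof (rule sum.cong[OF refl])
      fix k assume "k \<in> {1..N}"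
      then have "\<gamma> k - lam \<alpha> i \<noteq> 0" using gap[OF _ i, of k] by auto
      then have "feedback_dir \<alpha> \<gamma> k i * \<gamma> k = lam \<alpha> i * feedback_dir \<alpha> \<gamma> k i + dphi1 i"
        by (simp add: feedback_dir_def field_simps)
      then have "(feedback_dir \<alpha> \<gamma> k i * \<gamma> k) * s k = (lam \<alpha> i * feedback_dir \<alpha> \<gamma> k i + dphi1 i) * s k" by simp
      then show "feedback_dir \<alpha> \<gamma> k i * (\<gamma> k * s k) = lam \<alpha> i * (feedback_dir \<alpha> \<gamma> k i * s k) + dphi1 i * s k"
        by (simp add: algebra_simps)
    qed
    moreover have "\<dots> = lam \<alpha> i * z i + dphi1 i * u t 1"
      unfolding zs[OF i] U sum.distrib by (simp add: sum_distrib_left)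
    ultimately show "(\<Sum>k=1..N. feedback_dir \<alpha> \<gamma> k i * (s' k + \<gamma> k * s k)) = 0"
      unfolding distrib_left sum.distrib z'_def by linarith
  qed
  then have "s' k = - \<gamma> k * s k" by simp
  then show "((\<lambda>t. Fk \<alpha> N \<gamma> k (u t)) has_real_derivative - \<gamma> k * Fk \<alpha> N \<gamma> k (u t)) (at t)"
    using ds[of k] unfolding s_def by simp
qed

end

section \<open>Gains and the decay estimate\<close>

locale stabilizing_feedback = feedback +
  fixes \<rho> :: real
  assumes \<rho>: "\<rho> > 0" and \<alpha>: "\<alpha> > 0"
    and gamma_gt: "\<And>k. k \<in> {1..N} \<Longrightarrow> \<rho> < \<gamma> k"
    and lam_ge: "\<And>j. j > N \<Longrightarrow> \<rho> \<le> lam \<alpha> j"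
begin

definition channel_gain :: "nat \<Rightarrow> real" where "channel_gain k = (\<Sum>i=1..N. \<bar>coef k i\<bar>)"

definition total_gain :: real where "total_gain = (\<Sum>k=1..N. channel_gain k)"

text \<open>The influence of the norm at the starting time on mode \<open>j\<close>. Up to
  \<open>N\<close> it is read off from the expansion in the channels; beyond \<open>N\<close> it is
  the constant \<open>R / (l - m)\<close> of \<open>forced_decay\<close> with damping
  \<open>lam \<alpha> j\<close> and forcing rate \<open>\<rho> / 2\<close>.\<close>

definition mode_gain :: "nat \<Rightarrow> real" where
  "mode_gain j = (if j \<le> N then \<Sum>k=1..N. \<bar>feedback_dir \<alpha> \<gamma> k j\<bar> * channel_gain k else pi * real j * total_gain / (lam \<alpha> j - \<rho> / 2))"

lemma channel_gain_nonneg: "channel_gain k \<ge> 0" by (simp add: channel_gain_def sum_nonneg)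

lemma total_gain_nonneg: "total_gain \<ge> 0" by (simp add: total_gain_def sum_nonneg channel_gain_nonneg)

lemma Fk_decay:
  assumes u: "closed_loop_solution \<alpha> (Ffb \<alpha> N \<gamma>) u0 u" and a: "a > 0" and t: "t \<ge> a" and k: "k \<in> {1..N}"
  shows "\<bar>Fk \<alpha> N \<gamma> k (u t)\<bar> \<le> channel_gain k * norm_L2 (u a) * exp (- (\<rho> / 2) * (t - a))"
proof -
  have "\<bar>Fk \<alpha> N \<gamma> k (u t)\<bar> = \<bar>Fk \<alpha> N \<gamma> k (u a)\<bar> * exp (- \<gamma> k * (t - a))"
    using Fk_closed_loop[OF u a _ k, of t] a t by (simp add: abs_mult)
  also have "\<dots> \<le> (channel_gain k * norm_L2 (u a)) * exp (- (\<rho> / 2) * (t - a))"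
  proof (rule mult_mono)
    show "\<bar>Fk \<alpha> N \<gamma> k (u a)\<bar> \<le> channel_gain k * norm_L2 (u a)"
      unfolding channel_gain_def by (rule Fk_bound[OF closed_loop_L2[OF u a]])
    have "- \<gamma> k * (t - a) \<le> - (\<rho> / 2) * (t - a)"
      using gamma_gt[OF k] \<rho> t by (intro mult_right_mono) auto
    then show "exp (- \<gamma> k * (t - a)) \<le> exp (- (\<rho> / 2) * (t - a))" by simp
  qed (auto simp: channel_gain_nonneg norm_L2_nonneg)
  finally show ?thesis .
qed

lemma mode_decay:
  assumes u: "closed_loop_solution \<alpha> (Ffb \<alpha> N \<gamma>) u0 u" and a: "a > 0" and t: "t \<ge> a" and j: "j \<ge> 1"
  shows "\<bar>inner_L2 (u t) (phi j)\<bar> \<le>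
    exp (- (\<rho> / 2) * (t - a)) * (\<bar>inner_L2 (u a) (phi j)\<bar> + mode_gain j * norm_L2 (u a))"
proof (cases "j \<le> N")
  case True
  have jN: "j \<in> {1..N}" using True j by simp
  let ?E = "exp (- (\<rho> / 2) * (t - a))"
  have "\<bar>inner_L2 (u t) (phi j)\<bar> \<le> (\<Sum>k=1..N. \<bar>feedback_dir \<alpha> \<gamma> k j * Fk \<alpha> N \<gamma> k (u t)\<bar>)"
    unfolding mode_eq_sum_Fk[OF jN] by (rule sum_abs)
  also have "\<dots> \<le> (\<Sum>k=1..N. \<bar>feedback_dir \<alpha> \<gamma> k j\<bar> * (channel_gain k * norm_L2 (u a) * ?E))"
    unfolding abs_mult by (intro sum_mono mult_left_mono Fk_decay[OF u a t]) auto
  also have "\<dots> = ?E * (mode_gain j * norm_L2 (u a))"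
    using True by (simp add: mode_gain_def sum_distrib_left sum_distrib_right mult_ac)
  also have "\<dots> \<le> ?E * (\<bar>inner_L2 (u a) (phi j)\<bar> + mode_gain j * norm_L2 (u a))"
    by (intro mult_left_mono) auto
  finally show ?thesis .
next
  case False
  have "\<bar>inner_L2 (u t) (phi j)\<bar> \<le> exp (- (\<rho> / 2) * (t - a)) *
      (\<bar>inner_L2 (u a) (phi j)\<bar> + (pi * real j * (total_gain * norm_L2 (u a))) / (lam \<alpha> j - \<rho> / 2))"
  proof (rule forced_decay[where f = "\<lambda>t. inner_L2 (u t) (phi j)" and B = "\<lambda>t. dphi1 j * u t 1"])
    fix s assume s: "s \<ge> a"
    show "((\<lambda>t. inner_L2 (u t) (phi j)) has_real_derivative
        - lam \<alpha> j * inner_L2 (u s) (phi j) - dphi1 j * u s 1) (at s)"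
      using closed_loop_mode_ODE[OF u, of s] s a by simp
    have "u s 1 = (\<Sum>k=1..N. Fk \<alpha> N \<gamma> k (u s))"
      using u s a unfolding closed_loop_solution_def Ffb_def by simp
    then have "\<bar>u s 1\<bar> \<le> (\<Sum>k=1..N. channel_gain k * norm_L2 (u a) * exp (- (\<rho> / 2) * (s - a)))"
      using Fk_decay[OF u a s] by (simp only:) (rule order_trans[OF sum_abs], rule sum_mono, simp)
    also have "\<dots> = total_gain * norm_L2 (u a) * exp (- (\<rho> / 2) * (s - a))"
      by (simp add: total_gain_def sum_distrib_right)
    finally have "pi * real j * \<bar>u s 1\<bar> \<le> pi * real j * (total_gain * norm_L2 (u a) * exp (- (\<rho> / 2) * (s - a)))"
      by (intro mult_left_mono) auto
    then show "\<bar>dphi1 j * u s 1\<bar> \<le> pi * real j * (total_gain * norm_L2 (u a)) * exp (- (\<rho> / 2) * (s - a))"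
      by (simp only: abs_mult abs_dphi1 mult.assoc)
  qed (use lam_ge[of j] False \<rho> t in auto)
  then show ?thesis using False by (simp add: mode_gain_def mult.assoc)
qed

text \<open>From \<open>lam \<alpha> j \<ge> \<rho>\<close> follow
  \<open>\<alpha> \<le> \<alpha> / \<rho> * lam \<alpha> j\<close> and
  \<open>lam \<alpha> j \<le> 2 * (lam \<alpha> j - \<rho> / 2)\<close>. Hence the denominator of
  the gain is at least a fixed multiple of \<open>(pi * j)^2\<close>, and the gain is at most
  \<open>c / j\<close>.\<close>

lemma summable_mode_gain: "summable (\<lambda>j. (mode_gain (Suc j))\<^sup>2)"
proof -
  define c where "c = 2 * total_gain * (1 + \<alpha> / \<rho>) / pi"
  have "summable (\<lambda>j. c\<^sup>2 * (1 / (real (Suc j))\<^sup>2))"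
    using inverse_power_summable[of 2, where 'a = real]
    by (intro summable_mult, subst summable_Suc_iff) (simp add: inverse_eq_divide)
  then show ?thesis
  \<comment> \<open>Index \<open>n\<close> stands for mode \<open>Suc n\<close>, so from
    \<open>n = N\<close> on the formula for the higher modes applies.\<close>
  proof (rule summable_comparison_test'[where N = N])
    fix n assume n: "n \<ge> N"
    define j where "j = Suc n"
    have lj: "\<rho> \<le> lam \<alpha> j" using lam_ge[of j] n by (simp add: j_def)
    define y where "y = pi * real j"
    have y: "y > 0" by (simp add: y_def j_def)
    have ap: "1 + \<alpha> / \<rho> > 0" using \<alpha> \<rho> by (simp add: add_pos_pos)
    have "\<alpha> * \<rho> \<le> \<alpha> * lam \<alpha> j" using lj \<alpha> by simp
    then have "\<alpha> \<le> \<alpha> / \<rho> * lam \<alpha> j" using \<rho> by (simp add: field_simps)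
    then have "y\<^sup>2 \<le> (1 + \<alpha> / \<rho>) * lam \<alpha> j"
      unfolding y_def lam_def by (simp add: algebra_simps)
    also have "\<dots> \<le> (1 + \<alpha> / \<rho>) * (2 * (lam \<alpha> j - \<rho> / 2))"
      using lj ap by (intro mult_left_mono) auto
    finally have y2: "y\<^sup>2 \<le> 2 * (1 + \<alpha> / \<rho>) * (lam \<alpha> j - \<rho> / 2)" by (simp only: mult_ac)
    have pos: "lam \<alpha> j - \<rho> / 2 > 0" using lj \<rho> by simp
    have "y * total_gain / (lam \<alpha> j - \<rho> / 2) \<le> 2 * total_gain * (1 + \<alpha> / \<rho>) / y"
    proof -
      have "total_gain * y\<^sup>2 \<le> total_gain * (2 * (1 + \<alpha> / \<rho>) * (lam \<alpha> j - \<rho> / 2))"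
        using y2 total_gain_nonneg by (rule mult_left_mono)
      then have "(y * total_gain) * y \<le> (2 * total_gain * (1 + \<alpha> / \<rho>)) * (lam \<alpha> j - \<rho> / 2)"
        by (simp only: power2_eq_square mult_ac)
      then show ?thesis by (intro mult_imp_div_pos_le[OF pos]) (simp add: pos_le_divide_eq[OF y])
    qed
    moreover have qj: "mode_gain j = y * total_gain / (lam \<alpha> j - \<rho> / 2)"
      using n by (simp add: mode_gain_def y_def j_def)
    moreover have "2 * total_gain * (1 + \<alpha> / \<rho>) / y = c * (1 / real j)" by (simp add: c_def y_def)
    ultimately have "mode_gain j \<le> c * (1 / real j)" by simp
    moreover have "0 \<le> mode_gain j" unfolding qj using y pos total_gain_nonneg by simp
    ultimately have "(mode_gain j)\<^sup>2 \<le> (c * (1 / real j))\<^sup>2" by (rule power_mono)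
    then show "norm ((mode_gain (Suc n))\<^sup>2) \<le> c\<^sup>2 * (1 / (real (Suc n))\<^sup>2)"
      by (simp add: j_def power_mult_distrib power_divide)
  qed
qed

text \<open>Splitting the square of a sum costs a factor 2 in each mode. Summation by Parseval's
  identity doubles both parts and returns half of the squared initial norm in the first one, hence
  \<open>2\<close> and \<open>4\<close>.\<close>

definition decay_const :: real where "decay_const = sqrt (2 + 4 * (\<Sum>j. (mode_gain (Suc j))\<^sup>2))"

lemma decay_const_ge_1: "decay_const \<ge> 1"
proof -
  have "(\<Sum>j. (mode_gain (Suc j))\<^sup>2) \<ge> 0" by (rule suminf_nonneg[OF summable_mode_gain]) auto
  then show ?thesis by (simp add: decay_const_def real_le_rsqrt)
qed

lemma norm_decay:
  assumes u: "closed_loop_solution \<alpha> (Ffb \<alpha> N \<gamma>) u0 u" and a: "a > 0" and t: "t \<ge> a"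
  shows "norm_L2 (u t) \<le> decay_const * exp (- (\<rho> / 2) * (t - a)) * norm_L2 (u a)"
proof -
  define E where "E = exp (- (\<rho> / 2) * (t - a))"
  define n where "n = norm_L2 (u a)"
  define S where "S = (\<Sum>j. (mode_gain (Suc j))\<^sup>2)"
  have Lt: "L2 (u t)" and La: "L2 (u a)" using closed_loop_L2[OF u] a t by auto
  have S: "S \<ge> 0" unfolding S_def by (rule suminf_nonneg[OF summable_mode_gain]) auto
  have le: "(inner_L2 (u t) (phi (Suc j)))\<^sup>2 \<le>
      E\<^sup>2 * 2 * (inner_L2 (u a) (phi (Suc j)))\<^sup>2 + E\<^sup>2 * 2 * n\<^sup>2 * (mode_gain (Suc j))\<^sup>2" for j
  proof -
    define b d where "b = \<bar>inner_L2 (u a) (phi (Suc j))\<bar>" and "d = mode_gain (Suc j) * n"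
    have "\<bar>inner_L2 (u t) (phi (Suc j))\<bar> \<le> E * (b + d)"
      unfolding E_def b_def d_def n_def by (rule mode_decay[OF u a t]) simp
    from power_mono[OF this, of 2]
    have "(inner_L2 (u t) (phi (Suc j)))\<^sup>2 \<le> (E * (b + d))\<^sup>2" by simp
    also have "\<dots> = E\<^sup>2 * (b + d)\<^sup>2" by (rule power_mult_distrib)
    also have "\<dots> \<le> E\<^sup>2 * (2 * b\<^sup>2 + 2 * d\<^sup>2)"
      using sum_squares_bound[of b d] by (intro mult_left_mono) (auto simp: power2_sum)
    also have "\<dots> = E\<^sup>2 * 2 * b\<^sup>2 + E\<^sup>2 * 2 * n\<^sup>2 * (mode_gain (Suc j))\<^sup>2"
      unfolding d_def by (simp add: power_mult_distrib distrib_left)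
    finally show ?thesis unfolding b_def by simp
  qed
  have "(\<lambda>j. E\<^sup>2 * 2 * (inner_L2 (u a) (phi (Suc j)))\<^sup>2 + E\<^sup>2 * 2 * n\<^sup>2 * (mode_gain (Suc j))\<^sup>2)
      sums (E\<^sup>2 * 2 * (n\<^sup>2 / 2) + E\<^sup>2 * 2 * n\<^sup>2 * S)"
    unfolding n_def S_def
    by (rule sums_add[OF sums_mult[OF Parseval_sine[OF La]] sums_mult[OF summable_sums[OF summable_mode_gain]]])
  from sums_le[OF le Parseval_sine[OF Lt] this]
  have "(norm_L2 (u t))\<^sup>2 \<le> E\<^sup>2 * n\<^sup>2 * (2 + 4 * S)"
    by (simp add: distrib_left)
  also have "\<dots> = (decay_const * E * n)\<^sup>2"
    using S by (simp add: decay_const_def S_def power_mult_distrib)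
  finally have "(norm_L2 (u t))\<^sup>2 \<le> (decay_const * E * n)\<^sup>2" .
  moreover have "0 \<le> decay_const * E * n" using decay_const_ge_1 by (simp add: E_def n_def norm_L2_nonneg)
  ultimately show ?thesis unfolding E_def n_def by (rule power2_le_imp_le)
qed

text \<open>The estimate from time \<open>a\<close> holds with a constant independent of
  \<open>a\<close>; convergence to \<open>u0\<close> in the norm lets \<open>a\<close> tend to 0. At
  \<open>t = 0\<close> itself the bound is \<open>decay_const \<ge> 1\<close>.\<close>

lemma exponential_decay:
  assumes u: "closed_loop_solution \<alpha> (Ffb \<alpha> N \<gamma>) u0 u" and u0: "L2 u0" and t: "t \<ge> 0"
  shows "norm_L2 (u t) \<le> decay_const * exp (- (\<rho> / 2) * t) * norm_L2 u0"
proof (cases "t = 0")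
  case True
  have "norm_L2 (u 0) = norm_L2 u0"
    using u unfolding closed_loop_solution_def by (intro norm_L2_cong) auto
  moreover have "1 * norm_L2 u0 \<le> decay_const * norm_L2 u0"
    using decay_const_ge_1 norm_L2_nonneg by (rule mult_right_mono)
  ultimately show ?thesis using True by simp
next
  case False
  then have t: "t > 0" using t by simp
  have lim: "((\<lambda>a. norm_L2 (\<lambda>x. u a x - u0 x)) \<longlongrightarrow> 0) (at_right 0)"
    using u unfolding closed_loop_solution_def by blast
  have "((\<lambda>a. decay_const * exp (- (\<rho> / 2) * (t - a)) * (norm_L2 u0 + norm_L2 (\<lambda>x. u a x - u0 x))) \<longlongrightarrow>
      decay_const * exp (- (\<rho> / 2) * (t - 0)) * (norm_L2 u0 + 0)) (at_right 0)"
    by (intro tendsto_intros lim)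
  moreover have "\<forall>\<^sub>F a in at_right 0. norm_L2 (u t) \<le>
      decay_const * exp (- (\<rho> / 2) * (t - a)) * (norm_L2 u0 + norm_L2 (\<lambda>x. u a x - u0 x))"
  proof -
    have "\<forall>\<^sub>F a in at_right 0. 0 < a \<and> a < t"
      using t by (auto simp: eventually_at_right_field)
    then show ?thesis
    proof eventually_elim
      case (elim a)
      have "norm_L2 (u t) \<le> decay_const * exp (- (\<rho> / 2) * (t - a)) * norm_L2 (u a)"
        using norm_decay[OF u] elim by simp
      also have "\<dots> \<le> decay_const * exp (- (\<rho> / 2) * (t - a)) * (norm_L2 u0 + norm_L2 (\<lambda>x. u a x - u0 x))"
        using norm_L2_triangle_diff[OF closed_loop_L2[OF u] u0, of a] elim decay_const_ge_1
        by (intro mult_left_mono) auto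
      finally show ?case .
    qed
  qed
  ultimately have "norm_L2 (u t) \<le> decay_const * exp (- (\<rho> / 2) * (t - 0)) * (norm_L2 u0 + 0)"
    by (intro tendsto_lowerbound) auto
  then show ?thesis by simp
qed

end

section \<open>Existence of closed-loop solutions\<close>

lemma norm_L2_tendsto_initial:
  fixes h :: "real \<Rightarrow> real \<Rightarrow> real"
  assumes c: "continuous_on UNIV (\<lambda>(t, x). h t x)"
  shows "((\<lambda>t. norm_L2 (\<lambda>x. h t x - h 0 x)) \<longlongrightarrow> 0) (at_right 0)"
proof (rule tendstoI)
  fix e :: real assume e: "e > 0"
  have "uniformly_continuous_on ({0..1} \<times> {0..1::real}) (\<lambda>(t, x). h t x)"
    by (rule compact_uniformly_continuous[OF continuous_on_subset[OF c]]) (auto intro: compact_Times)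
  then obtain d where d: "d > 0" "\<And>p p'. p \<in> {0..1} \<times> {0..1} \<Longrightarrow> p' \<in> {0..1} \<times> {0..1} \<Longrightarrow> dist p' p < d \<Longrightarrow>
      dist ((\<lambda>(t, x). h t x) p') ((\<lambda>(t, x). h t x) p) < e / 2"
    unfolding uniformly_continuous_on_def using half_gt_zero[OF e] by meson
  have "\<forall>\<^sub>F t in at_right 0. 0 < t \<and> t < min d 1"
    using eventually_at_right_real[of 0 "min d 1"] d(1) by simp
  then show "\<forall>\<^sub>F t in at_right 0. dist (norm_L2 (\<lambda>x. h t x - h 0 x)) 0 < e"
  proof eventually_elim
    case (elim t)
    have "norm_L2 (\<lambda>x. h t x - h 0 x) \<le> e / 2"
    proof (rule norm_L2_le_sup)
      fix x :: real assume "x \<in> {0..1}"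
      then show "\<bar>h t x - h 0 x\<bar> \<le> e / 2"
        using d(2)[of "(0, x)" "(t, x)"] elim by (simp add: dist_Pair_Pair dist_real_def)
    qed
    then show ?case using e norm_L2_nonneg by (simp add: dist_real_def)
  qed
qed

section \<open>Modes driven by exponential boundary values\<close>

context feedback
begin

text \<open>\<open>E\<close> solves the same forced equation as the mode, so the difference
  \<open>r\<close> solves the homogeneous one and \<open>r t\<close> is \<open>r a\<close> times an
  exponential. By the hypothesis on \<open>f\<close>, \<open>r a\<close> tends to 0 with
  \<open>a\<close>, hence \<open>r t = 0\<close>.\<close>

lemma modes_of_exponential_boundary:
  assumes hs: "heat_solution {0<..} w"
    and cw: "continuous_on ({0<..} \<times> {0..1}) (\<lambda>(t, x). w t x)"
    and w0: "\<And>t. t > 0 \<Longrightarrow> w t 0 = 0"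
    and w1: "\<And>t. t > 0 \<Longrightarrow> w t 1 = (\<Sum>k=1..N. s k * exp (- (\<gamma> k + \<alpha>) * t))"
    and f: "L2 f" and lim: "((\<lambda>t. norm_L2 (\<lambda>x. w t x - f x)) \<longlongrightarrow> 0) (at_right 0)"
    and fs: "\<And>i. i \<in> {1..N} \<Longrightarrow> inner_L2 f (phi i) = (\<Sum>k=1..N. feedback_dir \<alpha> \<gamma> k i * s k)"
    and t: "t > 0" and i: "i \<in> {1..N}"
  shows "inner_L2 (w t) (phi i) = (\<Sum>k=1..N. feedback_dir \<alpha> \<gamma> k i * (s k * exp (- (\<gamma> k + \<alpha>) * t)))"
proof -
  define E where "E t = (\<Sum>k=1..N. feedback_dir \<alpha> \<gamma> k i * (s k * exp (- (\<gamma> k + \<alpha>) * t)))" for t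
  define r where "r t = inner_L2 (w t) (phi i) - E t" for t
  define p where "p = (pi * real i)\<^sup>2"
  have r: "(r has_real_derivative - p * r t) (at t)" if t: "t > 0" for t
  proof -
    have "(E has_real_derivative (\<Sum>k=1..N. feedback_dir \<alpha> \<gamma> k i * (s k * (exp (- (\<gamma> k + \<alpha>) * t) * (- (\<gamma> k + \<alpha>)))))) (at t)"
      unfolding E_def by (intro DERIV_sum DERIV_cmult) (auto intro!: derivative_eq_intros)
    moreover have "(\<Sum>k=1..N. feedback_dir \<alpha> \<gamma> k i * (s k * (exp (- (\<gamma> k + \<alpha>) * t) * (- (\<gamma> k + \<alpha>)))))
        = - p * E t - dphi1 i * w t 1"
      unfolding E_def w1[OF t] sum_distrib_left sum_subtractf[symmetric]
    proof (rule sum.cong[OF refl])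
      fix k assume k: "k \<in> {1..N}"
      \<comment> \<open>Since \<open>p = lam \<alpha> i + \<alpha>\<close>, the shift by
        \<open>\<alpha>\<close> cancels, and what remains is the defining relation of the
        direction.\<close>
      have "\<gamma> k - lam \<alpha> i \<noteq> 0" using gap[OF k i] by simp
      then have "feedback_dir \<alpha> \<gamma> k i * (\<gamma> k - lam \<alpha> i) = dphi1 i" by (simp add: feedback_dir_def)
      then have "feedback_dir \<alpha> \<gamma> k i * (- (\<gamma> k + \<alpha>)) = - p * feedback_dir \<alpha> \<gamma> k i - dphi1 i"
        by (simp add: lam_def p_def algebra_simps)
      then have "(feedback_dir \<alpha> \<gamma> k i * (- (\<gamma> k + \<alpha>))) * X = - p * (feedback_dir \<alpha> \<gamma> k i * X) - dphi1 i * X" for X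
        by (simp only: left_diff_distrib mult.assoc)
      from this[of "s k * exp (- (\<gamma> k + \<alpha>) * t)"] show "feedback_dir \<alpha> \<gamma> k i * (s k * (exp (- (\<gamma> k + \<alpha>) * t) * (- (\<gamma> k + \<alpha>)))) =
         - p * (feedback_dir \<alpha> \<gamma> k i * (s k * exp (- (\<gamma> k + \<alpha>) * t))) - dphi1 i * (s k * exp (- (\<gamma> k + \<alpha>) * t))"
        by (simp only: mult_ac)
    qed
    ultimately have "(E has_real_derivative - p * E t - dphi1 i * w t 1) (at t)" by simp
    from DERIV_diff[OF heat_mode_ODE[OF hs cw w0 t, of i, folded p_def] this]
    show ?thesis unfolding r_def by (simp add: algebra_simps)
  qed
  have wL: "L2 (w a)" if "a > 0" for a
    using that by (intro L2_continuous continuous_on_slice_x[OF cw]) auto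
  have "((\<lambda>a. inner_L2 (w a) (phi i) - inner_L2 f (phi i)) \<longlongrightarrow> 0) (at_right 0)"
  proof (rule tendsto_0_le[OF lim, of _ 1])
    have "\<forall>\<^sub>F a in at_right 0. (0::real) < a" by (rule eventually_at_right_less)
    then show "\<forall>\<^sub>F a in at_right 0. norm (inner_L2 (w a) (phi i) - inner_L2 f (phi i))
        \<le> norm (norm_L2 (\<lambda>x. w a x - f x)) * 1"
    proof eventually_elim
      case (elim a)
      show ?case
        using abs_mode_le[OF L2_diff[OF wL[OF elim] f], of i]
        by (simp add: inner_L2_diff_left wL[OF elim] f norm_L2_nonneg)
    qed
  qed
  from tendsto_add[OF this tendsto_const[of "inner_L2 f (phi i)"]]
  have "((\<lambda>a. inner_L2 (w a) (phi i)) \<longlongrightarrow> inner_L2 f (phi i)) (at_right 0)" by simp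
  moreover have "(E \<longlongrightarrow> (\<Sum>k=1..N. feedback_dir \<alpha> \<gamma> k i * (s k * exp (- (\<gamma> k + \<alpha>) * 0)))) (at_right 0)"
    unfolding E_def by (intro tendsto_intros)
  ultimately have "(r \<longlongrightarrow> inner_L2 f (phi i) - (\<Sum>k=1..N. feedback_dir \<alpha> \<gamma> k i * (s k * exp (- (\<gamma> k + \<alpha>) * 0)))) (at_right 0)"
    unfolding r_def by (rule tendsto_diff)
  then have "(r \<longlongrightarrow> 0) (at_right 0)" using fs[OF i] by simp
  then have "((\<lambda>a. r a * exp (- p * (t - a))) \<longlongrightarrow> 0 * exp (- p * (t - 0))) (at_right 0)"
    by (intro tendsto_intros)
  moreover have "\<forall>\<^sub>F a in at_right 0. r a * exp (- p * (t - a)) = r t"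
    using eventually_at_right_less[of "0::real"]
    by eventually_elim (rule linear_ODE_unique[OF r _ t, symmetric], auto)
  ultimately have "((\<lambda>a. r t) \<longlongrightarrow> 0 * exp (- p * (t - 0))) (at_right (0::real))"
    by (rule Lim_transform_eventually)
  then have "r t = 0" by (simp add: tendsto_const_iff)
  then show ?thesis by (simp add: r_def E_def)
qed

end

section \<open>Construction of a closed-loop solution\<close>

context stabilizing_feedback
begin

text \<open>The feedback is replaced by the input it has to produce, the sum of the
  \<open>s k * exp (- \<gamma> k * t)\<close> with \<open>s k\<close> taken from \<open>u0\<close>.
  This leaves a boundary value problem with known data, solved by an explicit part \<open>h\<close>
  and a homogeneous part \<open>v\<close> that starts from \<open>u0 - h 0\<close>. The modes of the
  result then show that the feedback returns exactly this input.\<close>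

lemma closed_loop_exists:
  assumes u0: "L2 u0"
  shows "\<exists>u. closed_loop_solution \<alpha> (Ffb \<alpha> N \<gamma>) u0 u"
proof -
  define s where "s k = Fk \<alpha> N \<gamma> k u0" for k
  have "\<forall>k\<in>{1..N}. \<exists>h. heat_solution {0<..} h \<and> continuous_on UNIV (\<lambda>(t, x). h t x) \<and>
      (\<forall>t. h t 0 = 0 \<and> h t 1 = exp (- (\<gamma> k + \<alpha>) * t))"
  proof
    fix k assume "k \<in> {1..N}"
    then have "\<gamma> k + \<alpha> > 0" using gamma_gt[of k] \<rho> \<alpha> by simp
    then have "sqrt (\<gamma> k + \<alpha>) > 0" "(sqrt (\<gamma> k + \<alpha>))\<^sup>2 = \<gamma> k + \<alpha>" by simp_all
    then show "\<exists>h. heat_solution {0<..} h \<and> continuous_on UNIV (\<lambda>(t, x). h t x) \<and>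
        (\<forall>t. h t 0 = 0 \<and> h t 1 = exp (- (\<gamma> k + \<alpha>) * t))"
      using exponential_boundary_heat_solution[of "sqrt (\<gamma> k + \<alpha>)"] by simp
  qed
  from bchoice[OF this] obtain hh where
    H: "\<forall>k\<in>{1..N}. heat_solution {0<..} (hh k) \<and> continuous_on UNIV (\<lambda>(t, x). hh k t x) \<and>
      (\<forall>t. hh k t 0 = 0 \<and> hh k t 1 = exp (- (\<gamma> k + \<alpha>) * t))" ..
  have hh: "heat_solution {0<..} (hh k)" "continuous_on UNIV (\<lambda>(t, x). hh k t x)"
    "hh k t 0 = 0" "hh k t 1 = exp (- (\<gamma> k + \<alpha>) * t)" if "k \<in> {1..N}" for k t
    using bspec[OF H that] by simp_all
  define h where "h t x = (\<Sum>k=1..N. s k * hh k t x)" for t x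
  have h: "heat_solution {0<..} h"
    unfolding h_def by (intro heat_solution_sum heat_solution_cmult hh)
  have "continuous_on UNIV (\<lambda>z. \<Sum>k=1..N. s k * (\<lambda>(t, x). hh k t x) z)"
    by (intro continuous_intros hh)
  then have ch: "continuous_on UNIV (\<lambda>(t, x). h t x)"
    unfolding h_def by (simp add: case_prod_unfold)
  have h0: "h t 0 = 0" and h1: "h t 1 = (\<Sum>k=1..N. s k * exp (- (\<gamma> k + \<alpha>) * t))" for t
    unfolding h_def using hh(3,4) by simp_all
  have hL: "L2 (h t)" for t
    by (rule L2_continuous)
      (rule continuous_on_slice_x[of UNIV], rule continuous_on_subset[OF ch], auto)
  define f where "f x = u0 x - h 0 x" for x
  have fL: "L2 f" unfolding f_def by (rule L2_diff[OF u0 hL])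
  obtain v where v: "heat_solution {0<..} v" "continuous_on ({0<..} \<times> {0..1}) (\<lambda>(t, x). v t x)"
    "\<And>t. v t 0 = 0" "\<And>t. v t 1 = 0" "((\<lambda>t. norm_L2 (\<lambda>x. v t x - f x)) \<longlongrightarrow> 0) (at_right 0)"
    using homogeneous_heat_solution[OF fL] by blast
  have vL: "L2 (v t)" if "t > 0" for t
    using that by (intro L2_continuous continuous_on_slice_x[OF v(2)]) auto
  define w where "w t x = h t x + v t x" for t x
  have hw: "heat_solution {0<..} w" unfolding w_def by (rule heat_solution_add[OF h v(1)])
  have cw: "continuous_on ({0<..} \<times> {0..1}) (\<lambda>(t, x). w t x)"
    unfolding w_def using continuous_on_add[OF continuous_on_subset[OF ch subset_UNIV] v(2)]
    by (simp add: case_prod_unfold)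
  have w0: "w t 0 = 0" and w1: "w t 1 = (\<Sum>k=1..N. s k * exp (- (\<gamma> k + \<alpha>) * t))" for t
    by (simp_all add: w_def h0 h1 v)
  have wL: "L2 (w t)" if "t > 0" for t
    unfolding w_def by (rule L2_add[OF hL vL[OF that]])
  have lim_w: "((\<lambda>t. norm_L2 (\<lambda>x. w t x - u0 x)) \<longlongrightarrow> 0) (at_right 0)"
  proof (rule tendsto_0_le[where K = 1])
    show "((\<lambda>t. norm_L2 (\<lambda>x. h t x - h 0 x) + norm_L2 (\<lambda>x. v t x - f x)) \<longlongrightarrow> 0) (at_right 0)"
      using tendsto_add[OF norm_L2_tendsto_initial[OF ch] v(5)] by simp
    show "\<forall>\<^sub>F t in at_right 0. norm (norm_L2 (\<lambda>x. w t x - u0 x)) \<le>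
        norm (norm_L2 (\<lambda>x. h t x - h 0 x) + norm_L2 (\<lambda>x. v t x - f x)) * 1"
      using eventually_at_right_less[of "0::real"]
    proof eventually_elim
      case (elim t)
      have "(\<lambda>x. w t x - u0 x) = (\<lambda>x. (h t x - h 0 x) + (v t x - f x))"
        by (simp add: w_def f_def fun_eq_iff)
      then show ?case
        using norm_L2_triangle[OF L2_diff[OF hL hL] L2_diff[OF vL[OF elim] fL], of t 0]
        by (simp add: norm_L2_nonneg)
    qed
  qed
  have modes: "inner_L2 (w t) (phi i) = (\<Sum>k=1..N. feedback_dir \<alpha> \<gamma> k i * (s k * exp (- (\<gamma> k + \<alpha>) * t)))"
    if "t > 0" "i \<in> {1..N}" for t i
    by (rule modes_of_exponential_boundary[OF hw cw w0 w1 u0 lim_w _ that])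
      (unfold s_def, rule mode_eq_sum_Fk)
  \<comment> \<open>The exponential restores the term with \<open>\<alpha>\<close>. At
    \<open>t = 0\<close> the value is set to \<open>u0\<close>, which \<open>w\<close> approaches
    only in the norm.\<close>
  define u where "u t x = (if t \<le> 0 then u0 x else exp (\<alpha> * t) * w t x)" for t x
  have u_pos: "u t = (\<lambda>x. exp (\<alpha> * t) * w t x)" if "t > 0" for t
    using that by (auto simp: u_def)
  have expo: "exp (\<alpha> * t) * exp (- (\<gamma> k + \<alpha>) * t) = exp (- \<gamma> k * t)" for k t
    by (simp add: mult_exp_exp left_diff_distrib)
  have F: "Fk \<alpha> N \<gamma> k (u t) = s k * exp (- \<gamma> k * t)" if t: "t > 0" and k: "k \<in> {1..N}" for t k
  proof -
    \<comment> \<open>Both families of coefficients represent the same first \<open>N\<close> modes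
      of \<open>u t\<close>, so independence of the directions makes them equal.\<close>
    have "Fk \<alpha> N \<gamma> k (u t) - s k * exp (- \<gamma> k * t) = 0"
    proof (rule feedback_dir_independent_channels[OF _ k])
      fix i assume i: "i \<in> {1..N}"
      have "inner_L2 (u t) (phi i) = exp (\<alpha> * t) * (\<Sum>k=1..N. feedback_dir \<alpha> \<gamma> k i * (s k * exp (- (\<gamma> k + \<alpha>) * t)))"
        unfolding u_pos[OF t] inner_L2_cmult_left modes[OF t i] ..
      also have "\<dots> = (\<Sum>k=1..N. feedback_dir \<alpha> \<gamma> k i * (s k * exp (- \<gamma> k * t)))"
        unfolding sum_distrib_left
      proof (rule sum.cong[OF refl])
        show "exp (\<alpha> * t) * (feedback_dir \<alpha> \<gamma> k i * (s k * exp (- (\<gamma> k + \<alpha>) * t))) = feedback_dir \<alpha> \<gamma> k i * (s k * exp (- \<gamma> k * t))" for k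
          unfolding expo[symmetric] by (simp only: mult_ac)
      qed
      finally show "(\<Sum>k=1..N. feedback_dir \<alpha> \<gamma> k i * (Fk \<alpha> N \<gamma> k (u t) - s k * exp (- \<gamma> k * t))) = 0"
        using mode_eq_sum_Fk[OF i, of "u t"] by (simp add: right_diff_distrib sum_subtractf)
    qed
    then show ?thesis by simp
  qed
  obtain wx D where wD: "heat_derivs {0<..} w wx D" using hw unfolding heat_solution_def by blast
  have dux: "(u t has_real_derivative exp (\<alpha> * t) * wx t x) (at x)" if "t > 0" "x \<in> {0<..<1}" for t x
    using wD that unfolding u_pos[OF that(1)] heat_derivs_def by (intro DERIV_cmult) auto
  have "closed_loop_solution \<alpha> (Ffb \<alpha> N \<gamma>) u0 u"
    unfolding closed_loop_solution_def
  proof (intro conjI allI ballI impI)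
    have "continuous_on ({0<..} \<times> {0..1}) (\<lambda>z. exp (\<alpha> * fst z) * (\<lambda>(t, x). w t x) z)"
      by (intro continuous_intros cw)
    then show "continuous_on ({0<..} \<times> {0..1}) (\<lambda>(t, x). u t x)"
      by (rule continuous_on_eq) (auto simp: u_def)
  next
    fix t x :: real assume t: "t > 0" and x: "x \<in> {0<..<1}"
    show "(u t has_real_derivative deriv (u t) x) (at x)"
      using dux[OF t x] DERIV_imp_deriv[OF dux[OF t x]] by simp
    have w: "((\<lambda>s. w s x) has_real_derivative D t x) (at t)" "(wx t has_real_derivative D t x) (at x)"
      using wD t x unfolding heat_derivs_def by auto
    have "((\<lambda>s. exp (\<alpha> * s) * w s x) has_real_derivative exp (\<alpha> * t) * \<alpha> * w t x + exp (\<alpha> * t) * D t x) (at t)"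
      by (auto intro!: derivative_eq_intros w(1))
    then have ut: "((\<lambda>s. u s x) has_real_derivative exp (\<alpha> * t) * \<alpha> * w t x + exp (\<alpha> * t) * D t x) (at t)"
      by (rule has_field_derivative_transform_within_open[of _ _ _ "{0<..}"]) (use t in \<open>auto simp: u_def\<close>)
    have "((\<lambda>x. exp (\<alpha> * t) * wx t x) has_real_derivative exp (\<alpha> * t) * D t x) (at x)"
      by (rule DERIV_cmult[OF w(2)])
    then have uxx: "(deriv (u t) has_real_derivative exp (\<alpha> * t) * D t x) (at x)"
      by (rule has_field_derivative_transform_within_open[of _ _ _ "{0<..<1}"])
        (use x DERIV_imp_deriv[OF dux[OF t]] in auto)
    show "\<exists>ut uxx. ((\<lambda>s. u s x) has_real_derivative ut) (at t) \<and>
        (deriv (u t) has_real_derivative uxx) (at x) \<and> ut - uxx - \<alpha> * u t x = 0"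
      by (intro exI conjI, rule ut, rule uxx) (simp add: u_pos[OF t])
  next
    fix t :: real assume t: "t > 0"
    show "u t 0 = 0" by (simp add: u_pos[OF t] w0)
    have "u t 1 = (\<Sum>k=1..N. s k * exp (- \<gamma> k * t))"
      unfolding u_pos[OF t] w1 sum_distrib_left
      unfolding expo[symmetric] by (simp only: mult_ac)
    then show "u t 1 = Ffb \<alpha> N \<gamma> (u t)" unfolding Ffb_def using F[OF t] by simp
  next
    show "u 0 x = u0 x" for x by (simp add: u_def)
  next
    show "((\<lambda>t. norm_L2 (\<lambda>x. u t x - u0 x)) \<longlongrightarrow> 0) (at_right 0)"
    proof (rule tendsto_0_le[where K = 1])
      have "((\<lambda>t. exp (\<alpha> * t) * norm_L2 (\<lambda>x. w t x - u0 x) + \<bar>exp (\<alpha> * t) - 1\<bar> * norm_L2 u0) \<longlongrightarrow>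
          exp (\<alpha> * 0) * 0 + \<bar>exp (\<alpha> * 0) - 1\<bar> * norm_L2 u0) (at_right 0)"
        by (intro tendsto_intros lim_w)
      then show "((\<lambda>t. exp (\<alpha> * t) * norm_L2 (\<lambda>x. w t x - u0 x) + \<bar>exp (\<alpha> * t) - 1\<bar> * norm_L2 u0) \<longlongrightarrow> 0) (at_right 0)"
        by simp
      show "\<forall>\<^sub>F t in at_right 0. norm (norm_L2 (\<lambda>x. u t x - u0 x)) \<le>
          norm (exp (\<alpha> * t) * norm_L2 (\<lambda>x. w t x - u0 x) + \<bar>exp (\<alpha> * t) - 1\<bar> * norm_L2 u0) * 1"
        using eventually_at_right_less[of "0::real"]
      proof eventually_elim
        case (elim t)
        have "(\<lambda>x. u t x - u0 x) = (\<lambda>x. exp (\<alpha> * t) * (w t x - u0 x) + (exp (\<alpha> * t) - 1) * u0 x)"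
          by (simp add: u_pos[OF elim] algebra_simps)
        then have "norm_L2 (\<lambda>x. u t x - u0 x) \<le>
            norm_L2 (\<lambda>x. exp (\<alpha> * t) * (w t x - u0 x)) + norm_L2 (\<lambda>x. (exp (\<alpha> * t) - 1) * u0 x)"
          using norm_L2_triangle[OF L2_cmult[OF L2_diff[OF wL[OF elim] u0]] L2_cmult[OF u0]] by simp
        then show ?case by (simp add: norm_L2_cmult norm_L2_nonneg)
      qed
    qed
  qed
  then show ?thesis by blast
qed

end

section \<open>The eigenvalues below \<open>\<rho>\<close> and the conclusion\<close>

lemma lam_mono: "i \<le> j \<Longrightarrow> lam \<alpha> i \<le> lam \<alpha> j"
  unfolding lam_def by (simp add: power_mono)

text \<open>Infinite sets have cardinality 0, so a positive \<open>NN\<close> already makes the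
  counted set finite; monotonicity of \<open>lam\<close> makes it an initial segment
  \<open>{1..M}\<close>, whose cardinality is its maximum.\<close>

lemma lam_less_iff_le_NN:
  assumes N: "NN \<alpha> \<rho> \<ge> 1" and j: "j \<ge> 1"
  shows "lam \<alpha> j < \<rho> \<longleftrightarrow> j \<le> NN \<alpha> \<rho>"
proof -
  define S where "S = {j. 1 \<le> j \<and> lam \<alpha> j < \<rho>}"
  have in_S: "i \<in> S \<longleftrightarrow> 1 \<le> i \<and> lam \<alpha> i < \<rho>" for i by (simp add: S_def)
  have cS: "NN \<alpha> \<rho> = card S" by (simp add: NN_def S_def)
  then have "card S > 0" using N by simp
  then have fS: "finite S" and neS: "S \<noteq> {}" by (simp_all add: card_gt_0_iff)
  define M where "M = Max S"
  have "lam \<alpha> M < \<rho>" using Max_in[OF fS neS] unfolding in_S M_def by simp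
  then have "S = {1..M}"
    using Max_ge[OF fS] lam_mono[of _ M \<alpha>] unfolding set_eq_iff in_S M_def[symmetric] atLeastAtMost_iff
    by (meson le_less_trans)
  moreover from this have "NN \<alpha> \<rho> = M" using cS by simp
  ultimately show ?thesis using in_S[of j] j by simp
qed

theorem theorem2p1:
  fixes \<alpha> \<rho> :: real and \<gamma> :: "nat \<Rightarrow> real"
  assumes "\<alpha> > 0" and "\<rho> > 0"
    and "NN \<alpha> \<rho> \<ge> 1"
    and "\<rho> < \<gamma> 1"
    and "\<forall>k. 1 \<le> k \<and> k < NN \<alpha> \<rho> \<longrightarrow> \<gamma> k < \<gamma> (k+1)"
    and "\<forall>j\<in>{1..NN \<alpha> \<rho>}. gamma_solvable \<alpha> (NN \<alpha> \<rho>) (\<gamma> j)"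
  shows "\<exists>C>0. \<exists>\<mu>>0. \<forall>u0. L2 u0 \<longrightarrow>
           (\<exists>u. closed_loop_solution \<alpha> (Ffb \<alpha> (NN \<alpha> \<rho>) \<gamma>) u0 u)
         \<and> (\<forall>u. closed_loop_solution \<alpha> (Ffb \<alpha> (NN \<alpha> \<rho>) \<gamma>) u0 u \<longrightarrow>
               (\<forall>t\<ge>0. norm_L2 (u t) \<le> C * exp (- \<mu> * t) * norm_L2 u0))"
proof -
  define N where "N = NN \<alpha> \<rho>"
  \<comment> \<open>The hypothesis compares neighbours only; induction extends it to all pairs,
    which yields both injectivity and \<open>\<rho> < \<gamma> k\<close>.\<close>
  have mono: "k \<in> {1..N} \<Longrightarrow> l \<in> {1..N} \<Longrightarrow> k < l \<Longrightarrow> \<gamma> k < \<gamma> l" for k l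
  proof (induction l)
    case (Suc l)
    have step: "\<gamma> l < \<gamma> (Suc l)" using Suc.prems assms(5) by (auto simp: N_def)
    show ?case
    proof (cases "k = l")
      case True
      then show ?thesis using step by simp
    next
      case False
      then have "\<gamma> k < \<gamma> l" using Suc by auto
      then show ?thesis using step by simp
    qed
  qed simp
  have gt: "\<rho> < \<gamma> k" if "k \<in> {1..N}" for k
    using mono[of 1 k] that assms(4) by (cases "k = 1") auto
  have lt: "lam \<alpha> i < \<rho>" if "i \<in> {1..N}" for i
    using lam_less_iff_le_NN[OF assms(3), of i] that by (simp add: N_def)
  interpret stabilizing_feedback \<alpha> N \<gamma> \<rho>
  proof
    show "lam \<alpha> i < \<gamma> k" if "k \<in> {1..N}" "i \<in> {1..N}" for k i
      using gt[OF that(1)] lt[OF that(2)] by simp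
    show "inj_on \<gamma> {1..N}"
      by (rule linorder_inj_onI) (use mono in force)+
    show "\<rho> \<le> lam \<alpha> j" if "j > N" for j
      using lam_less_iff_le_NN[OF assms(3), of j] that by (simp add: N_def)
  qed (use assms gt in auto)
  have "decay_const > 0" using decay_const_ge_1 by simp
  moreover have "\<rho> / 2 > 0" using assms(2) by simp
  ultimately show ?thesis
    unfolding N_def[symmetric] using closed_loop_exists exponential_decay
    by (intro exI[of _ decay_const] exI[of _ "\<rho> / 2"] conjI allI impI)
qed

end
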